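(* Suppose $f$ is polynomial-time computable and the series $\sum_{n=0}^\infty 2^{-f(n)}$ is p-convergent. Let $p$ be a polynomial and \[X=\{S\in\mathbf C : K^p(S\upharpoonright n)<n-f(n)\text{ for infinitely many }n\}.\] Then $X$ has #P-measure 0.
   Context: $\mathbf C=\{0,1\}^\infty$; $S\upharpoonright n$ is the length-$n$ prefix of $S$. For a time bound $t$, $K^t(x)$ is the length of the shortest program $\pi$ such that a fixed universal Turing machine $U$ on input $\pi$ prints $x$ within $t(|x|)$ steps. A series $\sum_n a_n$ of nonnegative reals is p-convergent if there is a polynomial-time computable $m:\mathbb N\to\mathbb N$ (input in unary) with $\sum_{n\ge m(i)}a_n\le 2^{-i}$ for all $i$. A martingale is $d:\{0,1\}^*\to[0,\infty)$ with $d(w)=\frac{d(w0)+d(w1)}{2}$; it succeeds on $S$ if $\limsup_n d(S\upharpoonright n)=\infty$. A #P function counts accepting paths of a fixed polynomial-time nondeterministic Turing machine. A #P-martingale is a martingale $d$ for which there are a #P function $h$ and polynomial-time computable $g$ with power-of-2 values such that $|d(w)-h(w,r)/g(w,r)|\le2^{-r}$ for all $w$ and $r\in\mathbb N$ ($r$ in unary). $X$ has #P-measure 0 if some #P-martingale succeeds on every element of $X$. *)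

theory Defs
  imports Complex_Main
    "HOL-Library.Extended_Real"
    "HOL-Computational_Algebra.Polynomial"
begin

section \<open>Multitape Turing machines\<close>

text \<open>
  Tapes are infinite in both directions, with cells indexed by the integers. The tape alphabet is
  an initial segment of the naturals: 0 is the blank, 1 and 2 are the bits. The states are an
  initial segment of the naturals too, and 0 is the initial state. Tape 0 is the input tape and
  tape 1 is the output tape; the heads may read, write and move both ways on every tape. In a
  given state, reading a given list of symbols (one for each tape), the machine may perform any of
  the actions in \<open>delta\<close>: go to a new state and on each tape write a symbol and then move the head.
  It halts when there is no action to perform. The field \<open>accepting\<close> matters only for machines that
  count or decide, not for machines that compute a string.
\<close>

datatype dir = Left | Stay | Right

type_synonym action = "nat \<times> (nat \<times> dir) list"

record machine =
  num_tapes :: nat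
  num_symbols :: nat
  num_states :: nat
  delta :: "nat \<Rightarrow> nat list \<Rightarrow> action set"
  accepting :: "nat set"

definition readable :: "machine \<Rightarrow> nat list \<Rightarrow> bool" where
  "readable M rs \<longleftrightarrow> length rs = num_tapes M \<and> set rs \<subseteq> {..<num_symbols M}"

definition actions :: "machine \<Rightarrow> action set" where
  "actions M = {(q, ws). q < num_states M \<and> length ws = num_tapes M \<and>
     fst ` set ws \<subseteq> {..<num_symbols M}}"

definition ntm :: "machine \<Rightarrow> bool" where
  "ntm M \<longleftrightarrow> 2 \<le> num_tapes M \<and> 3 \<le> num_symbols M \<and> 1 \<le> num_states M \<and>
     (\<forall>q rs. q < num_states M \<and> readable M rs \<longrightarrow> delta M q rs \<subseteq> actions M)"

definition dtm :: "machine \<Rightarrow> bool" where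
  "dtm M \<longleftrightarrow> ntm M \<and>
     (\<forall>q rs. q < num_states M \<and> readable M rs \<longrightarrow>
        (\<forall>a \<in> delta M q rs. \<forall>b \<in> delta M q rs. a = b))"

type_synonym tape = "int \<times> (int \<Rightarrow> nat)"

type_synonym config = "nat \<times> tape list"

fun offset :: "dir \<Rightarrow> int" where
  "offset Left = -1"
| "offset Stay = 0"
| "offset Right = 1"

fun act :: "nat \<times> dir \<Rightarrow> tape \<Rightarrow> tape" where
  "act (s, m) (pos, cells) = (pos + offset m, cells(pos := s))"

fun step :: "action \<Rightarrow> config \<Rightarrow> config" where
  "step (q', ws) (q, ts) = (q', map2 act ws ts)"

definition enabled :: "machine \<Rightarrow> config \<Rightarrow> action set" where
  "enabled M c = delta M (fst c) (map (\<lambda>(pos, cells). cells pos) (snd c))"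

text \<open>A computation path is identified with the list of actions that the machine performs.\<close>

fun is_path :: "machine \<Rightarrow> config \<Rightarrow> action list \<Rightarrow> bool" where
  "is_path M c [] \<longleftrightarrow> True"
| "is_path M c (a # as) \<longleftrightarrow> a \<in> enabled M c \<and> is_path M (step a c) as"

definition path_end :: "config \<Rightarrow> action list \<Rightarrow> config" where
  "path_end c as = fold step as c"

definition halted :: "machine \<Rightarrow> config \<Rightarrow> bool" where
  "halted M c \<longleftrightarrow> enabled M c = {}"

definition bit_symbol :: "bool \<Rightarrow> nat" where
  "bit_symbol b = (if b then 2 else 1)"

definition input_tape :: "bool list \<Rightarrow> tape" where
  "input_tape x = (0, \<lambda>i. if 0 \<le> i \<and> i < int (length x) then bit_symbol (x ! nat i) else 0)"

definition blank_tape :: tape where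
  "blank_tape = (0, \<lambda>_. 0)"

definition init_config :: "machine \<Rightarrow> bool list \<Rightarrow> config" where
  "init_config M x = (0, input_tape x # replicate (num_tapes M - 1) blank_tape)"

text \<open>The output is the longest string of bits that is written on tape 1 from cell 0 onwards.\<close>

definition has_output :: "config \<Rightarrow> bool list \<Rightarrow> bool" where
  "has_output c y \<longleftrightarrow> (let cells = snd (snd c ! 1) in
     (\<forall>i < length y. cells (int i) = bit_symbol (y ! i)) \<and>
     cells (int (length y)) \<notin> range bit_symbol)"

definition prints_within :: "machine \<Rightarrow> bool list \<Rightarrow> bool list \<Rightarrow> nat \<Rightarrow> bool" where
  "prints_within M x y t \<longleftrightarrow> (\<exists>as. is_path M (init_config M x) as \<and> length as \<le> t \<and>
     halted M (path_end (init_config M x) as) \<and> has_output (path_end (init_config M x) as) y)"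

definition prints :: "machine \<Rightarrow> bool list \<Rightarrow> bool list \<Rightarrow> bool" where
  "prints M x y \<longleftrightarrow> (\<exists>t. prints_within M x y t)"

text \<open>
  Nothing is required of the running time of the simulation, so every efficient universal machine
  is universal in this sense.
\<close>

definition universal :: "machine \<Rightarrow> bool" where
  "universal U \<longleftrightarrow> dtm U \<and>
     (\<forall>M. dtm M \<longrightarrow> (\<exists>\<sigma>. \<forall>\<pi> x. prints U (\<sigma> @ \<pi>) x \<longleftrightarrow> prints M \<pi> x))"


section \<open>Polynomial-time computability and counting\<close>

definition polynomial :: "(nat \<Rightarrow> nat) \<Rightarrow> bool" where
  "polynomial t \<longleftrightarrow> (\<exists>P :: real poly. \<forall>n. real (t n) = poly P (real n))"

definition unary :: "nat \<Rightarrow> bool list" where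
  "unary n = replicate n True"

text \<open>Binary numerals have the most significant bit first; 0 is the empty string.\<close>

fun binary :: "nat \<Rightarrow> bool list" where
  "binary n = (if n = 0 then [] else binary (n div 2) @ [odd n])"

declare binary.simps [simp del]

text \<open>The pair of a string and a number that is given in unary.\<close>

definition pair :: "bool list \<times> nat \<Rightarrow> bool list" where
  "pair = (\<lambda>(w, r). unary r @ False # w)"

definition poly_time :: "('a \<Rightarrow> bool list) \<Rightarrow> ('b \<Rightarrow> bool list) \<Rightarrow> ('a \<Rightarrow> 'b) \<Rightarrow> bool" where
  "poly_time enc_in enc_out F \<longleftrightarrow> (\<exists>M t. dtm M \<and> polynomial t \<and>
     (\<forall>a. prints_within M (enc_in a) (enc_out (F a)) (t (length (enc_in a)))))"

definition poly_time_ntm :: "machine \<Rightarrow> bool" where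
  "poly_time_ntm M \<longleftrightarrow> ntm M \<and> (\<exists>t. polynomial t \<and>
     (\<forall>x as. is_path M (init_config M x) as \<longrightarrow> length as \<le> t (length x)))"

definition accepting_paths :: "machine \<Rightarrow> bool list \<Rightarrow> action list set" where
  "accepting_paths M x = {as. is_path M (init_config M x) as \<and>
     halted M (path_end (init_config M x) as) \<and>
     fst (path_end (init_config M x) as) \<in> accepting M}"

definition sharp_P :: "(bool list \<Rightarrow> nat) \<Rightarrow> bool" where
  "sharp_P h \<longleftrightarrow> (\<exists>M. poly_time_ntm M \<and> (\<forall>x. h x = card (accepting_paths M x)))"

text \<open>The modulus of convergence has its argument and its value in unary.\<close>

definition p_convergent :: "(nat \<Rightarrow> real) \<Rightarrow> bool" where
  "p_convergent a \<longleftrightarrow> (\<forall>n. 0 \<le> a n) \<and> summable a \<and>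
     (\<exists>m. poly_time unary unary m \<and> (\<forall>i. (\<Sum>n. a (n + m i)) \<le> 2 powr - real i))"


section \<open>Time-bounded Kolmogorov complexity\<close>

definition Kt :: "machine \<Rightarrow> (nat \<Rightarrow> nat) \<Rightarrow> bool list \<Rightarrow> enat" where
  "Kt U t x = (INF \<pi> \<in> {\<pi>. prints_within U \<pi> x (t (length x))}. enat (length \<pi>))"


section \<open>Counting martingales\<close>

definition seq_prefix :: "(nat \<Rightarrow> bool) \<Rightarrow> nat \<Rightarrow> bool list" where
  "seq_prefix S n = map S [0..<n]"

definition martingale :: "(bool list \<Rightarrow> real) \<Rightarrow> bool" where
  "martingale d \<longleftrightarrow> (\<forall>w. 0 \<le> d w \<and> d w = (d (w @ [False]) + d (w @ [True])) / 2)"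

definition succeeds_on :: "(bool list \<Rightarrow> real) \<Rightarrow> (nat \<Rightarrow> bool) \<Rightarrow> bool" where
  "succeeds_on d S \<longleftrightarrow> limsup (\<lambda>n. ereal (d (seq_prefix S n))) = \<infinity>"

definition sharp_P_martingale :: "(bool list \<Rightarrow> real) \<Rightarrow> bool" where
  "sharp_P_martingale d \<longleftrightarrow> martingale d \<and>
     (\<exists>h g. sharp_P h \<and> poly_time pair binary g \<and>
        (\<forall>w r. \<exists>k. g (w, r) = 2 ^ k) \<and>
        (\<forall>w r. \<bar>d w - real (h (pair (w, r))) / real (g (w, r))\<bar> \<le> 2 powr - real r))"

definition sharp_P_measure_0 :: "(nat \<Rightarrow> bool) set \<Rightarrow> bool" where
  "sharp_P_measure_0 X \<longleftrightarrow> (\<exists>d. sharp_P_martingale d \<and> (\<forall>S \<in> X. succeeds_on d S))"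

end

theory Submission
  imports Defs
begin

text \<open>
  For each length \<open>n\<close>, give every program of length less than \<open>n - f n\<close> that prints a string of
  length \<open>n\<close> in time the capital \<open>2 ^ (- n)\<close>, and bet it on that string. These are
  at most \<open>2 ^ (n - f n)\<close> programs, so the initial capital of the layer \<open>n\<close> is at most
  \<open>2 powr - f n\<close>, and the sum of the layers is a martingale. If \<open>S\<close> belongs to \<open>X\<close> then
  infinitely many layers reach the capital 1 along \<open>S\<close> and keep it, so the martingale succeeds.

  With \<open>N\<close> the modulus of convergence at \<open>r + length w\<close>, the layers beyond \<open>N\<close> contribute at most
  \<open>2 powr - r\<close> at \<open>w\<close>, and \<open>2 ^ N\<close> times the sum of the others is a number of accepting paths: a
  machine guesses \<open>n\<close> and the program, simulates the program with a clock, checks that the output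
  agrees with \<open>w\<close>, and makes idle guesses to get the weights right. The clock may exceed
  \<open>p\<close>, because programs are counted and not strings.
\<close>

section \<open>Programs over an indexed family of tapes\<close>

text \<open>The martingale must not depend on the precision r, while the machine receives r and
  derives its cutoff N from it. Hence acceptance of a guessed program may depend only on the
  program, on n and on w. This is why the clock is set by n alone, with (n + 2)^\<open>clock\<close>
  - 1 ticks: there is one fixed series, and the count for (w, r) is exactly 2^N times a partial sum
  of it. A guessed program need not halt, yet every path has to end in polynomial time on every
  input; so the clock is part of the machine. A path that settles on a program and on n makes N - n
  idle guesses before the check and min(|w|, n) more during the comparison with w. Divided by 2^N,
  an accepted program thus contributes 2^(min(|w|, n) - n), which is what a stake of 2^(-n) becomes
  after min(|w|, n) successful bets. Paths are lists of actions, so two branches count twice only if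
  their actions differ. Idle guesses therefore write 1 or 2 over a symbol that is not read
  again.\<close>

type_synonym tapes = "nat \<Rightarrow> tape"

text \<open>States of any type let composition use sums and products of state types, and total tape
  families let the parts address tapes by fixed indices. States are numbered and tapes truncated
  only in \<open>compile\<close>.\<close>

record 'q prog =
  start :: 'q
  states :: "'q set"
  finals :: "'q set"
  moves :: "'q \<Rightarrow> (nat \<Rightarrow> nat) \<Rightarrow> ('q \<times> (nat \<Rightarrow> nat \<times> dir)) set"

definition reads :: "tapes \<Rightarrow> nat \<Rightarrow> nat" where
  "reads ts i = snd (ts i) (fst (ts i))"

definition perform :: "(nat \<Rightarrow> nat \<times> dir) \<Rightarrow> tapes \<Rightarrow> tapes" where
  "perform ws ts i = act (ws i) (ts i)"

definition keep :: "(nat \<Rightarrow> nat) \<Rightarrow> nat \<Rightarrow> nat \<times> dir" where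
  "keep rd i = (rd i, Stay)"

text \<open>Requiring \<open>keep\<close> from tape \<open>k\<close> onwards makes a move determined
  by its target and its first \<open>k\<close> writes; the injectivity of \<open>action_of\<close>
  rests on this.\<close>

definition well_formed :: "nat \<Rightarrow> nat \<Rightarrow> 'q prog \<Rightarrow> bool" where
  "well_formed k s A \<longleftrightarrow> finite (states A) \<and> start A \<in> states A \<and>
     (\<forall>q \<in> states A. \<forall>rd. (\<forall>i. rd i < s) \<longrightarrow> (\<forall>(q', ws) \<in> moves A q rd.
        q' \<in> states A \<and> (\<forall>i<k. fst (ws i) < s) \<and> (\<forall>i\<ge>k. ws i = keep rd i)))"

definition deterministic :: "'q prog \<Rightarrow> bool" where
  "deterministic A \<longleftrightarrow> (\<forall>q rd. \<forall>a \<in> moves A q rd. \<forall>b \<in> moves A q rd. a = b)"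

lemma well_formedD:
  assumes "well_formed k s A" "q \<in> states A" "\<forall>i. rd i < s" "a \<in> moves A q rd"
  shows "fst a \<in> states A" "\<forall>i<k. fst (snd a i) < s" "\<forall>i\<ge>k. snd a i = keep rd i"
proof -
  have "case a of (q', ws) \<Rightarrow>
      q' \<in> states A \<and> (\<forall>i<k. fst (ws i) < s) \<and> (\<forall>i\<ge>k. ws i = keep rd i)"
    using assms unfolding well_formed_def by blast
  then show "fst a \<in> states A" "\<forall>i<k. fst (snd a i) < s" "\<forall>i\<ge>k. snd a i = keep rd i"
    by (cases a; simp)+
qed

lemma act_keep [simp]: "act (snd t (fst t), d) t = (fst t + offset d, snd t)"
  by (cases t) simp

lemma act_split: "act a t = (fst t + offset (snd a), (snd t)(fst t := fst a))"
  by (cases t; cases a) simp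

text \<open>
  In continuation-passing style: every path has length at most the time bound, and the
  accepting paths, weighted with a value that \<open>F\<close> admits for the tapes on which they end, sum to
  the last argument.
\<close>

inductive counts :: "'q prog \<Rightarrow> (tapes \<Rightarrow> nat \<Rightarrow> bool) \<Rightarrow> 'q \<Rightarrow> tapes \<Rightarrow> nat \<Rightarrow> nat \<Rightarrow> bool"
  for A F where
  accept: "moves A q (reads ts) = {} \<Longrightarrow> q \<in> finals A \<Longrightarrow> F ts v \<Longrightarrow> counts A F q ts T v"
| reject: "moves A q (reads ts) = {} \<Longrightarrow> q \<notin> finals A \<Longrightarrow> counts A F q ts T 0"
| branch: "moves A q (reads ts) \<noteq> {} \<Longrightarrow> finite (moves A q (reads ts)) \<Longrightarrow>
    (\<And>a. a \<in> moves A q (reads ts) \<Longrightarrow> counts A F (fst a) (perform (snd a) ts) T (V a)) \<Longrightarrow>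
    counts A F q ts (Suc T) (\<Sum>a \<in> moves A q (reads ts). V a)"

lemma counts_mono:
  assumes "counts A F q ts T v" "T \<le> T'"
  shows "counts A F q ts T' v"
  using assms
proof (induction arbitrary: T')
  case (branch q ts T V)
  then obtain T'' where "T' = Suc T''" "T \<le> T''" by (cases T') auto
  then show ?case using branch by (auto intro!: counts.branch)
qed (auto intro: counts.intros)

lemma counts_step:
  assumes "moves A q (reads ts) = {(q', ws)}" "counts A F q' (perform ws ts) T v"
  shows "counts A F q ts (Suc T) v"
  using counts.branch[of A q ts F T "\<lambda>_. v"] assms by simp

lemma counts_step_two:
  assumes "moves A q (reads ts) = {(q1, ws1), (q2, ws2)}" "(q1, ws1) \<noteq> (q2, ws2)"
    and "counts A F q1 (perform ws1 ts) T v1" "counts A F q2 (perform ws2 ts) T v2"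
  shows "counts A F q ts (Suc T) (v1 + v2)"
proof -
  have "counts A F q ts (Suc T)
      (\<Sum>a \<in> moves A q (reads ts). if a = (q1, ws1) then v1 else v2)"
    by (rule counts.branch) (use assms in auto)
  moreover have "(\<Sum>a \<in> moves A q (reads ts). if a = (q1, ws1) then v1 else v2) = v1 + v2"
    using assms(1,2) by auto
  ultimately show ?thesis by simp
qed

subsection \<open>Sequential composition\<close>

text \<open>The handover to \<open>B\<close> is an idle step from a final halt of \<open>A\<close>,
  which explains the \<open>Suc\<close> in the time bounds. A halt of \<open>A\<close> in any other
  state stays a rejecting halt.\<close>

definition seq :: "'q prog \<Rightarrow> 'r prog \<Rightarrow> ('q + 'r) prog" where
  "seq A B = \<lparr>start = Inl (start A), states = Inl ` states A \<union> Inr ` states B,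
     finals = Inr ` finals B,
     moves = (\<lambda>q rd. case q of
         Inl q \<Rightarrow> if moves A q rd = {}
           then (if q \<in> finals A then {(Inr (start B), keep rd)} else {})
           else map_prod Inl id ` moves A q rd
       | Inr q \<Rightarrow> map_prod Inr id ` moves B q rd)\<rparr>"

lemma perform_keep [simp]: "perform (keep (reads ts)) ts = ts"
  by (rule ext) (simp add: perform_def keep_def reads_def)

lemma counts_seq_right:
  assumes "counts B F q ts T v"
  shows "counts (seq A B) F (Inr q) ts T v"
  using assms
proof induction
  case (accept q ts v T)
  then show ?case by (intro counts.accept) (auto simp: seq_def)
next
  case (reject q ts T)
  then show ?case by (intro counts.reject) (auto simp: seq_def)
next
  case (branch q ts T V)
  let ?f = "map_prod (Inr :: _ \<Rightarrow> 'b + _) (id :: (nat \<Rightarrow> nat \<times> dir) \<Rightarrow> _)"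
  have tr: "moves (seq A B) (Inr q) rd = ?f ` moves B q rd" for rd
    by (simp add: seq_def)
  \<comment> \<open>Moves form a set, so a relabelling that merged two of them would lose a
    summand.\<close>
  have inj: "inj ?f" by (rule prod.inj_map[OF inj_Inr inj_on_id])
  have "counts (seq A B) F (Inr q) ts (Suc T)
      (\<Sum>a \<in> moves (seq A B) (Inr q) (reads ts). V (inv ?f a))"
  proof (rule counts.branch)
    fix a assume "a \<in> moves (seq A B) (Inr q) (reads ts)"
    then obtain b where b: "b \<in> moves B q (reads ts)" and a: "a = ?f b"
      using tr by (metis imageE)
    have "inv ?f a = b" unfolding a by (rule inv_f_f[OF inj])
    then show "counts (seq A B) F (fst a) (perform (snd a) ts) T (V (inv ?f a))"
      using branch.IH[OF b] by (simp add: a)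
  qed (use branch.hyps(1,2) in \<open>simp_all add: tr\<close>)
  also have "(\<Sum>a \<in> moves (seq A B) (Inr q) (reads ts). V (inv ?f a)) = (\<Sum>a \<in> moves B q (reads ts). V a)"
    unfolding tr by (subst sum.reindex[OF inj_on_subset[OF inj]]) (simp_all add: inv_f_f[OF inj])
  finally show ?case .
qed

text \<open>The count for \<open>B\<close> serves as the value that \<open>A\<close> admits where it
  ends: summing it over the accepting ends of \<open>A\<close> gives the count for the composition.
  The bound \<open>T'\<close> is common to all these ends, so the times simply add.\<close>

lemma counts_seq:
  assumes "counts A (\<lambda>ts v. counts B F (start B) ts T' v) q ts T v"
  shows "counts (seq A B) F (Inl q) ts (T + Suc T') v"
  using assms
proof induction
  case (accept q ts v T)
  have "counts (seq A B) F (Inl q) ts (Suc T') v"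
    by (rule counts_step) (use accept counts_seq_right in \<open>auto simp: seq_def\<close>)
  then show ?case by (rule counts_mono) simp
next
  case (reject q ts T)
  then show ?case by (intro counts.reject) (auto simp: seq_def)
next
  case (branch q ts T V)
  let ?f = "map_prod (Inl :: _ \<Rightarrow> _ + 'b) (id :: (nat \<Rightarrow> nat \<times> dir) \<Rightarrow> _)"
  have tr: "moves (seq A B) (Inl q) (reads ts) = ?f ` moves A q (reads ts)"
    using branch.hyps(1) by (simp add: seq_def)
  have inj: "inj ?f" by (rule prod.inj_map[OF inj_Inl inj_on_id])
  have "counts (seq A B) F (Inl q) ts (Suc (T + Suc T'))
      (\<Sum>a \<in> moves (seq A B) (Inl q) (reads ts). V (inv ?f a))"
  proof (rule counts.branch)
    fix a assume "a \<in> moves (seq A B) (Inl q) (reads ts)"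
    then obtain b where b: "b \<in> moves A q (reads ts)" and a: "a = ?f b"
      using tr by (metis imageE)
    have "inv ?f a = b" unfolding a by (rule inv_f_f[OF inj])
    then show "counts (seq A B) F (fst a) (perform (snd a) ts) (T + Suc T') (V (inv ?f a))"
      using branch.IH[OF b] by (simp add: a)
  qed (use branch.hyps(1,2) in \<open>simp_all add: tr\<close>)
  also have "(\<Sum>a \<in> moves (seq A B) (Inl q) (reads ts). V (inv ?f a)) = (\<Sum>a \<in> moves A q (reads ts). V a)"
    unfolding tr by (subst sum.reindex[OF inj_on_subset[OF inj]]) (simp_all add: inv_f_f[OF inj])
  finally show ?case by simp
qed

lemma counts_seq_start:
  assumes "counts A (\<lambda>ts v. counts B F (start B) ts T' v) (start A) ts T v"
  shows "counts (seq A B) F (start (seq A B)) ts (T + Suc T') v"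
  using counts_seq[OF assms] by (simp add: seq_def)

lemma well_formed_seq:
  assumes A: "well_formed k s A" and B: "well_formed k s B"
  shows "well_formed k s (seq A B)"
  unfolding well_formed_def
proof (intro conjI ballI allI impI)
  fix p rd a assume p: "p \<in> states (seq A B)" and rd: "\<forall>i. rd i < s" and a: "a \<in> moves (seq A B) p rd"
  show "case a of (q', ws) \<Rightarrow> q' \<in> states (seq A B) \<and> (\<forall>i<k. fst (ws i) < s) \<and> (\<forall>i\<ge>k. ws i = keep rd i)"
  proof (cases p)
    case (Inl q)
    then have q: "q \<in> states A" using p by (auto simp: seq_def)
    show ?thesis
    proof (cases "moves A q rd = {}")
      case True
      then show ?thesis using a Inl rd B
        by (auto simp: seq_def keep_def well_formed_def split: if_splits)
    next
      case False
      then have "moves (seq A B) p rd = map_prod Inl id ` moves A q rd"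
        using Inl by (simp add: seq_def)
      then obtain b where b: "b \<in> moves A q rd" "a = map_prod Inl id b"
        using a by (metis imageE)
      from b(1) have "case b of (q', ws) \<Rightarrow> q' \<in> states A \<and> (\<forall>i<k. fst (ws i) < s) \<and> (\<forall>i\<ge>k. ws i = keep rd i)"
        using A q rd unfolding well_formed_def by blast
      then show ?thesis by (cases b) (simp add: b(2) seq_def)
    qed
  next
    case (Inr q)
    then have q: "q \<in> states B" using p by (auto simp: seq_def)
    have "moves (seq A B) p rd = map_prod Inr id ` moves B q rd"
      using Inr by (simp add: seq_def)
    then obtain b where b: "b \<in> moves B q rd" "a = map_prod Inr id b"
      using a by (metis imageE)
    from b(1) have "case b of (q', ws) \<Rightarrow> q' \<in> states B \<and> (\<forall>i<k. fst (ws i) < s) \<and> (\<forall>i\<ge>k. ws i = keep rd i)"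
      using B q rd unfolding well_formed_def by blast
    then show ?thesis by (cases b) (simp add: b(2) seq_def)
  qed
qed (use A B in \<open>auto simp: well_formed_def seq_def\<close>)

lemma deterministic_seq:
  assumes "deterministic A" "deterministic B"
  shows "deterministic (seq A B)"
  unfolding deterministic_def
proof (intro ballI allI)
  fix p rd a b
  assume ab: "a \<in> moves (seq A B) p rd" "b \<in> moves (seq A B) p rd"
  show "a = b"
  proof (cases p)
    case (Inl q)
    have "\<And>a b. a \<in> moves A q rd \<Longrightarrow> b \<in> moves A q rd \<Longrightarrow> a = b"
      using assms(1) unfolding deterministic_def by blast
    then show ?thesis using ab unfolding Inl seq_def
      by (simp split: if_splits) (metis imageE)
  next
    case (Inr q)
    have "\<And>a b. a \<in> moves B q rd \<Longrightarrow> b \<in> moves B q rd \<Longrightarrow> a = b"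
      using assms(2) unfolding deterministic_def by blast
    then show ?thesis using ab unfolding Inr seq_def
      by (simp) (metis imageE)
  qed
qed

subsection \<open>Compilation to Turing machines\<close>

text \<open>Tapes from \<open>k\<close> onwards are read as 0, in agreement with
  \<open>proper\<close>, where they are blank.\<close>

definition compile :: "nat \<Rightarrow> nat \<Rightarrow> ('q \<Rightarrow> nat) \<Rightarrow> 'q prog \<Rightarrow> machine" where
  "compile k s e A = \<lparr>num_tapes = k, num_symbols = s, num_states = card (states A),
     delta = (\<lambda>m rs. (\<lambda>(q, ws). (e q, map ws [0..<k])) `
        moves A (inv_into (states A) e m) (\<lambda>i. if i < k then rs ! i else 0)),
     accepting = e ` (finals A \<inter> states A)\<rparr>"

definition numbering :: "('q \<Rightarrow> nat) \<Rightarrow> 'q prog \<Rightarrow> bool" where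
  "numbering e A \<longleftrightarrow> bij_betw e (states A) {..<card (states A)} \<and> e (start A) = 0"

lemma numbering_exists:
  assumes "well_formed k s A"
  obtains e where "numbering e A"
proof -
  have fin: "finite (states A)" and st: "start A \<in> states A"
    using assms by (auto simp: well_formed_def)
  obtain e where e: "bij_betw e (states A) {..<card (states A)}"
    using ex_bij_betw_finite_nat[OF fin] by (auto simp: atLeast0LessThan)
  let ?a = "e (start A)"
  have a: "?a < card (states A)" using e st by (auto simp: bij_betw_def)
  \<comment> \<open>An arbitrary numbering is corrected by the transposition of 0 and the number of
    the start state, because machines start in state 0.\<close>
  let ?t = "\<lambda>x. if x = ?a then 0 else if x = 0 then ?a else x"
  have "bij_betw ?t {..<card (states A)} {..<card (states A)}"
    by (rule bij_betw_byWitness[where f' = ?t]) (use a in auto)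
  then have "bij_betw (?t \<circ> e) (states A) {..<card (states A)}"
    using e bij_betw_trans by blast
  then have "numbering (?t \<circ> e) A" by (simp add: numbering_def)
  then show ?thesis by (rule that)
qed

definition proper :: "nat \<Rightarrow> nat \<Rightarrow> 'q prog \<Rightarrow> 'q \<Rightarrow> tapes \<Rightarrow> bool" where
  "proper k s A q ts \<longleftrightarrow> q \<in> states A \<and> (\<forall>i j. snd (ts i) j < s) \<and> (\<forall>i\<ge>k. ts i = blank_tape)"

definition config_of :: "nat \<Rightarrow> ('q \<Rightarrow> nat) \<Rightarrow> 'q \<Rightarrow> tapes \<Rightarrow> config" where
  "config_of k e q ts = (e q, map ts [0..<k])"

definition action_of :: "nat \<Rightarrow> ('q \<Rightarrow> nat) \<Rightarrow> 'q \<times> (nat \<Rightarrow> nat \<times> dir) \<Rightarrow> action" where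
  "action_of k e a = (e (fst a), map (snd a) [0..<k])"

lemma proper_perform:
  assumes "well_formed k s A" "proper k s A q ts" "a \<in> moves A q (reads ts)"
  shows "proper k s A (fst a) (perform (snd a) ts)"
proof -
  have q: "q \<in> states A" and rd: "\<forall>i. reads ts i < s"
    using assms(2) by (simp_all add: proper_def reads_def)
  note * = well_formedD[OF assms(1) q rd assms(3)]
  have "fst (snd a i) < s" for i
    using * rd by (cases "i < k") (simp_all add: keep_def)
  then show ?thesis using * assms(2)
    by (simp add: proper_def perform_def act_split keep_def reads_def)
qed

lemma enabled_compile:
  assumes "well_formed k s A" "numbering e A" "proper k s A q ts"
  shows "enabled (compile k s e A) (config_of k e q ts) = action_of k e ` moves A q (reads ts)"
proof -
  have q: "inv_into (states A) e (e q) = q"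
    using assms(2,3) by (auto simp: numbering_def proper_def bij_betw_def)
  have "(\<lambda>i. if i < k then map (\<lambda>(pos, cells). cells pos) (map ts [0..<k]) ! i else 0) = reads ts"
    using assms(3) by (auto simp: fun_eq_iff reads_def proper_def blank_tape_def split: prod.split)
  then show ?thesis
    unfolding enabled_def compile_def config_of_def action_of_def
    by (simp only: fst_conv snd_conv machine.simps q case_prod_unfold)
qed

lemma step_action_of:
  assumes "well_formed k s A" "proper k s A q ts" "a \<in> moves A q (reads ts)"
  shows "step (action_of k e a) (config_of k e q ts) = config_of k e (fst a) (perform (snd a) ts)"
  by (simp add: action_of_def config_of_def perform_def list_eq_iff_nth_eq)

text \<open>Branches that became the same action would be counted as one path. States are told apart
  by the numbering, writes on the first \<open>k\<close> tapes by the list, and all further writes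
  are \<open>keep\<close>.\<close>

lemma inj_on_action_of:
  assumes "well_formed k s A" "numbering e A" "proper k s A q ts"
  shows "inj_on (action_of k e) (moves A q (reads ts))"
proof
  fix a b assume ab: "a \<in> moves A q (reads ts)" "b \<in> moves A q (reads ts)"
    and eq: "action_of k e a = action_of k e b"
  have q: "q \<in> states A" and rd: "\<forall>i. reads ts i < s"
    using assms(3) by (simp_all add: proper_def reads_def)
  note * = well_formedD[OF assms(1) q rd]
  have "fst a = fst b"
    using eq *(1)[OF ab(1)] *(1)[OF ab(2)] assms(2)
    by (auto simp: action_of_def numbering_def bij_betw_def intro: inj_onD)
  moreover have "snd a i = snd b i" for i
    using eq *[OF ab(1)] *[OF ab(2)] by (cases "i < k") (auto simp: action_of_def)
  ultimately show "a = b" by (auto simp: prod_eq_iff fun_eq_iff)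
qed

section \<open>Counting the paths of compiled programs\<close>

definition accepting_from :: "machine \<Rightarrow> config \<Rightarrow> action list set" where
  "accepting_from M c = {as. is_path M c as \<and> halted M (path_end c as) \<and>
     fst (path_end c as) \<in> accepting M}"

lemma accepting_from_halted:
  assumes "enabled M c = {}"
  shows "accepting_from M c = (if fst c \<in> accepting M then {[]} else {})"
proof -
  have "as = []" if "is_path M c as" for as using that assms by (cases as) auto
  then show ?thesis
    using assms by (force simp: accepting_from_def path_end_def halted_def)
qed

lemma accepting_from_step:
  assumes "enabled M c \<noteq> {}"
  shows "accepting_from M c = (\<Union>a \<in> enabled M c. (#) a ` accepting_from M (step a c))"
    (is "?L = ?R")
proof
  show "?L \<subseteq> ?R"
  proof
    fix as assume "as \<in> ?L"
    then show "as \<in> ?R" using assms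
      by (cases as) (auto simp: accepting_from_def path_end_def halted_def)
  qed
  show "?R \<subseteq> ?L"
    by (auto simp: accepting_from_def path_end_def)
qed

text \<open>With value 1 at every accepting end the weighted count is the number of accepting paths.
  At a branching the paths are sorted by their first action, and the classes are disjoint by
  \<open>inj_on_action_of\<close>.\<close>

lemma counts_compile:
  assumes wf: "well_formed k s A" and e: "numbering e A"
    and "counts A F q ts T v" "proper k s A q ts" and F: "\<And>ts v. F ts v \<Longrightarrow> v = 1"
  shows "(\<forall>as. is_path (compile k s e A) (config_of k e q ts) as \<longrightarrow> length as \<le> T) \<and>
    finite (accepting_from (compile k s e A) (config_of k e q ts)) \<and>
    card (accepting_from (compile k s e A) (config_of k e q ts)) = v"
  using assms(3,4)
proof induction
  case (accept q ts v T)
  let ?M = "compile k s e A" and ?c = "config_of k e q ts"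
  have en: "enabled ?M ?c = {}" using accept by (simp add: enabled_compile[OF wf e])
  moreover have "fst ?c \<in> accepting ?M"
    using accept by (auto simp: config_of_def compile_def proper_def)
  moreover have "length as \<le> T" if "is_path ?M ?c as" for as
    using that en by (cases as) auto
  ultimately show ?case using F[OF accept(3)] by (auto simp: accepting_from_halted)
next
  case (reject q ts T)
  let ?M = "compile k s e A" and ?c = "config_of k e q ts"
  have en: "enabled ?M ?c = {}" using reject by (simp add: enabled_compile[OF wf e])
  moreover have "fst ?c \<notin> accepting ?M"
    using reject e
    by (auto simp: config_of_def compile_def proper_def numbering_def bij_betw_def dest: inj_onD)
  moreover have "length as \<le> T" if "is_path ?M ?c as" for as
    using that en by (cases as) auto
  ultimately show ?case by (auto simp: accepting_from_halted)
next
  case (branch q ts T V)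
  let ?M = "compile k s e A" and ?c = "config_of k e q ts" and ?E = "moves A q (reads ts)"
  have en: "enabled ?M ?c = action_of k e ` ?E"
    using branch by (simp add: enabled_compile[OF wf e])
  have IH: "(\<forall>as. is_path ?M (step (action_of k e a) ?c) as \<longrightarrow> length as \<le> T) \<and>
    finite (accepting_from ?M (step (action_of k e a) ?c)) \<and>
    card (accepting_from ?M (step (action_of k e a) ?c)) = V a" if "a \<in> ?E" for a
    using branch.IH[OF that proper_perform[OF wf branch.prems that]]
    by (simp add: step_action_of[OF wf branch.prems that])
  have "length as \<le> Suc T" if "is_path ?M ?c as" for as
    using that IH en by (cases as) auto
  moreover have acc: "accepting_from ?M ?c =
      (\<Union>a \<in> ?E. (#) (action_of k e a) ` accepting_from ?M (step (action_of k e a) ?c))"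
    using branch.hyps(1) en by (simp add: accepting_from_step)
  moreover have "card (\<Union>a \<in> ?E. (#) (action_of k e a) ` accepting_from ?M (step (action_of k e a) ?c))
      = (\<Sum>a \<in> ?E. V a)"
  proof (subst card_UN_disjoint)
    show "\<forall>a\<in>?E. \<forall>b\<in>?E. a \<noteq> b \<longrightarrow>
      (#) (action_of k e a) ` accepting_from ?M (step (action_of k e a) ?c) \<inter>
      (#) (action_of k e b) ` accepting_from ?M (step (action_of k e b) ?c) = {}"
      using inj_on_action_of[OF wf e branch.prems] by (auto dest: inj_onD)
  qed (use branch.hyps(2) IH in \<open>auto simp: card_image\<close>)
  ultimately show ?case using branch.hyps(2) IH by auto
qed

text \<open>For machines that compute a string: a predicate on the final tapes, put into
  \<open>F\<close>, holds at the end of some halting path as soon as the count is positive.\<close>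

lemma counts_path:
  assumes wf: "well_formed k s A" and e: "numbering e A"
    and "counts A F q ts T v" "proper k s A q ts" "0 < v"
  shows "\<exists>as ts' q' v'. is_path (compile k s e A) (config_of k e q ts) as \<and> length as \<le> T \<and>
    path_end (config_of k e q ts) as = config_of k e q' ts' \<and>
    halted (compile k s e A) (config_of k e q' ts') \<and> F ts' v'"
  using assms(3-)
proof induction
  case (accept q ts v T)
  let ?M = "compile k s e A" and ?c = "config_of k e q ts"
  have en: "halted ?M ?c" using accept by (simp add: enabled_compile[OF wf e] halted_def)
  then show ?case using accept by (intro exI[of _ "[]"]) (auto simp: path_end_def)
next
  case (reject q ts T)
  then show ?case by simp
next
  case (branch q ts T V)
  let ?M = "compile k s e A" and ?c = "config_of k e q ts" and ?E = "moves A q (reads ts)"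
  have en: "enabled ?M ?c = action_of k e ` ?E"
    using branch by (simp add: enabled_compile[OF wf e])
  obtain a where a: "a \<in> ?E" "0 < V a"
    using branch.prems(2) by (metis gr0I sum.neutral less_irrefl)
  obtain as ts' q' v' where "is_path ?M (config_of k e (fst a) (perform (snd a) ts)) as" "length as \<le> T"
    "path_end (config_of k e (fst a) (perform (snd a) ts)) as = config_of k e q' ts'"
    "halted ?M (config_of k e q' ts')" "F ts' v'"
    using branch.IH[OF a(1) proper_perform[OF wf branch.prems(1) a(1)] a(2)] by blast
  then show ?case
    using a en step_action_of[OF wf branch.prems(1) a(1), of e]
    by (intro exI[of _ "action_of k e a # as"] exI[of _ ts'] exI[of _ q'] exI[of _ v'])
      (auto simp: path_end_def)
qed

lemma ntm_compile:
  assumes wf: "well_formed k s A" and e: "numbering e A" and "2 \<le> k" "3 \<le> s"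
  shows "ntm (compile k s e A)"
  unfolding ntm_def
proof (intro conjI allI impI)
  show "1 \<le> num_states (compile k s e A)"
    using wf by (auto simp: compile_def well_formed_def Suc_le_eq card_gt_0_iff)
  fix m rs assume *: "m < num_states (compile k s e A) \<and> readable (compile k s e A) rs"
  let ?rd = "\<lambda>i. if i < k then rs ! i else 0"
  have rd: "\<forall>i. ?rd i < s"
    using * assms(4) by (auto simp: readable_def compile_def dest: nth_mem)
  have "m \<in> e ` states A" using * e by (auto simp: compile_def numbering_def bij_betw_def)
  then have q: "inv_into (states A) e m \<in> states A" by (rule inv_into_into)
  have es: "e q < card (states A)" if "q \<in> states A" for q
    using e that by (auto simp: numbering_def bij_betw_def)
  show "delta (compile k s e A) m rs \<subseteq> actions (compile k s e A)"
  proof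
    fix x assume "x \<in> delta (compile k s e A) m rs"
    then obtain a where a: "a \<in> moves A (inv_into (states A) e m) ?rd"
      and x: "x = (e (fst a), map (snd a) [0..<k])"
      by (auto simp: compile_def)
    note wfD = well_formedD[OF wf q rd a]
    have "fst y < s" if "y \<in> set (map (snd a) [0..<k])" for y
      using wfD(2) that by auto
    then show "x \<in> actions (compile k s e A)"
      using es[OF wfD(1)] by (auto simp: x compile_def actions_def)
  qed
qed (use assms in \<open>auto simp: compile_def\<close>)

lemma dtm_compile:
  assumes wf: "well_formed k s A" and e: "numbering e A" and "2 \<le> k" "3 \<le> s"
    and d: "deterministic A"
  shows "dtm (compile k s e A)"
  unfolding dtm_def
proof (intro conjI allI impI ballI)
  fix m rs a b
  assume *: "m < num_states (compile k s e A) \<and> readable (compile k s e A) rs"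
    and ab: "a \<in> delta (compile k s e A) m rs" "b \<in> delta (compile k s e A) m rs"
  show "a = b" using d ab unfolding deterministic_def compile_def by fastforce
qed (use assms ntm_compile in auto)

definition input_tapes :: "bool list \<Rightarrow> tapes" where
  "input_tapes x = (\<lambda>_. blank_tape)(0 := input_tape x)"

lemma init_config_compile:
  assumes "numbering e A" "1 \<le> k"
  shows "init_config (compile k s e A) x = config_of k e (start A) (input_tapes x)"
  using assms by (auto simp: init_config_def config_of_def numbering_def compile_def input_tapes_def
    list_eq_iff_nth_eq nth_Cons split: nat.split)

lemma proper_input_tapes:
  assumes "well_formed k s A" "1 \<le> k" "3 \<le> s"
  shows "proper k s A (start A) (input_tapes x)"
  using assms by (auto simp: proper_def well_formed_def input_tapes_def input_tape_def
    blank_tape_def bit_symbol_def)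

section \<open>Running a machine on a block of tapes\<close>

text \<open>\<open>R\<close> is the fuel. \<open>None\<close> stands both for a rejecting halt and
  for running out of fuel; \<open>the_elem\<close> is meaningful because the programs concerned have
  at most one move.\<close>

primrec outcome :: "nat \<Rightarrow> 'q prog \<Rightarrow> 'q \<Rightarrow> tapes \<Rightarrow> tapes option" where
  "outcome 0 A q ts = (if moves A q (reads ts) = {} \<and> q \<in> finals A then Some ts else None)"
| "outcome (Suc R) A q ts =
    (if moves A q (reads ts) = {} then (if q \<in> finals A then Some ts else None)
     else (let a = the_elem (moves A q (reads ts)) in outcome R A (fst a) (perform (snd a) ts)))"

lemma counts_outcome:
  assumes "deterministic A" "outcome R A q ts = Some ts'" "F ts' v"
  shows "counts A F q ts R v"
  using assms(2)
proof (induction R arbitrary: q ts)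
  case 0
  then show ?case using assms(3) by (auto intro: counts.accept split: if_splits)
next
  case (Suc R)
  show ?case
  proof (cases "moves A q (reads ts) = {}")
    case True
    then show ?thesis using assms(3) Suc.prems by (auto intro: counts.accept split: if_splits)
  next
    case False
    then obtain a where a: "moves A q (reads ts) = {a}"
      using assms(1) unfolding deterministic_def by blast
    show ?thesis
      by (rule counts_step[of _ _ _ "fst a" "snd a"]) (use a Suc in auto)
  qed
qed

text \<open>This is \<open>has_output\<close> relative to the head instead of cell 0, so that a scan
  can be treated by induction on the string.\<close>

definition displays :: "tape \<Rightarrow> bool list \<Rightarrow> bool" where
  "displays t y \<longleftrightarrow> (\<forall>i < length y. snd t (fst t + int i) = bit_symbol (y ! i)) \<and>
     snd t (fst t + int (length y)) \<notin> {1, 2}"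

lemma range_bit_symbol: "range bit_symbol = {1, 2}"
  by (auto simp: bit_symbol_def)

lemma actionsD:
  assumes "a \<in> actions M" "i < num_tapes M"
  shows "fst (snd a ! i) < num_symbols M"
proof -
  have "snd a ! i \<in> set (snd a)" "fst ` set (snd a) \<subseteq> {..<num_symbols M}"
    using assms by (cases a; simp add: actions_def)+
  then show ?thesis by blast
qed

text \<open>
  The machine \<open>M\<close> runs on the tapes from \<open>off\<close> onwards. The head of the shadow tape \<open>sh\<close> moves along
  with the head of the output tape \<open>off + 1\<close>. Since its cell 0 carries the mark 3 and the state
  remembers whether the head is to the left of it, the output head finds its way back to cell 0.
\<close>

datatype run_state = Launch | Simulate nat bool | Return bool | Finished

text \<open>Outside the states and symbols of \<open>M\<close> nothing is known about
  \<open>delta\<close>, and the host alphabet may be larger. The guard makes the simulated machine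
  halt there, so \<open>run\<close> is well formed and deterministic everywhere.\<close>

definition simulated :: "machine \<Rightarrow> nat \<Rightarrow> nat \<Rightarrow> (nat \<Rightarrow> nat) \<Rightarrow> action set" where
  "simulated M off q rd = (let rs = map (\<lambda>j. rd (off + j)) [0..<num_tapes M] in
     if q < num_states M \<and> readable M rs then delta M q rs else {})"

fun run_moves :: "machine \<Rightarrow> nat \<Rightarrow> nat \<Rightarrow> run_state \<Rightarrow> (nat \<Rightarrow> nat) \<Rightarrow>
    (run_state \<times> (nat \<Rightarrow> nat \<times> dir)) set" where
  "run_moves M off sh Launch rd = {(Simulate 0 False, (keep rd)(sh := (3, Stay)))}"
| "run_moves M off sh (Simulate q b) rd =
    (if simulated M off q rd = {} then {(Return b, keep rd)}
     else (\<lambda>(q', ws). (Simulate q' (if rd sh = 3 then snd (ws ! 1) = Left else b),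
       \<lambda>i. if off \<le> i \<and> i < off + num_tapes M then ws ! (i - off)
         else if i = sh then (rd sh, snd (ws ! 1)) else keep rd i)) ` simulated M off q rd)"
| "run_moves M off sh (Return b) rd =
    (if rd sh = 3 then {(Finished, keep rd)}
     else {(Return b, \<lambda>i. if i = sh \<or> i = off + 1 then (rd i, if b then Right else Left) else keep rd i)})"
| "run_moves M off sh Finished rd = {}"

definition run :: "machine \<Rightarrow> nat \<Rightarrow> nat \<Rightarrow> run_state prog" where
  "run M off sh = \<lparr>start = Launch,
     states = {Launch, Finished} \<union> range Return \<union> (\<lambda>(q, b). Simulate q b) ` ({..<num_states M} \<times> UNIV),
     finals = {Finished}, moves = run_moves M off sh\<rparr>"

lemma simulated_unique:
  assumes "dtm M" "a \<in> simulated M off q rd" "b \<in> simulated M off q rd"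
  shows "a = b"
proof -
  let ?rs = "map (\<lambda>j. rd (off + j)) [0..<num_tapes M]"
  have "q < num_states M" "readable M ?rs" "a \<in> delta M q ?rs" "b \<in> delta M q ?rs"
    using assms(2,3) unfolding simulated_def Let_def by (auto split: if_splits)
  then show ?thesis using assms(1) unfolding dtm_def by blast
qed

lemma deterministic_run:
  assumes "dtm M"
  shows "deterministic (run M off sh)"
  unfolding deterministic_def
proof (intro allI ballI)
  fix q rd a b
  assume ab: "a \<in> moves (run M off sh) q rd" "b \<in> moves (run M off sh) q rd"
  show "a = b"
  proof (cases q)
    case (Simulate m c)
    have "simulated M off m rd = {} \<or> (\<exists>x. simulated M off m rd = {x})"
      using simulated_unique[OF assms] by blast
    then show ?thesis using ab Simulate by (auto simp: run_def)
  qed (use ab in \<open>auto simp: run_def split: if_splits\<close>)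
qed

lemma simulated_subset:
  assumes "ntm M"
  shows "simulated M off q rd \<subseteq> actions M"
  using assms by (auto simp: simulated_def ntm_def Let_def)

lemma well_formed_run:
  assumes "ntm M" "num_symbols M \<le> s" "3 < s" "off + num_tapes M \<le> k" "sh < k"
  shows "well_formed k s (run M off sh)"
  unfolding well_formed_def
proof (intro conjI ballI allI impI)
  show "start (run M off sh) \<in> states (run M off sh)" by (simp add: run_def)
  show "finite (states (run M off sh))" by (simp add: run_def)
  fix q rd a assume q: "q \<in> states (run M off sh)" and rd: "\<forall>i. rd i < s"
    and a: "a \<in> moves (run M off sh) q rd"
  have tapes: "2 \<le> num_tapes M" and st: "1 \<le> num_states M" using assms(1) by (auto simp: ntm_def)
  show "case a of (q', ws) \<Rightarrow> q' \<in> states (run M off sh) \<and> (\<forall>i<k. fst (ws i) < s) \<and>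
      (\<forall>i\<ge>k. ws i = keep rd i)"
  proof (cases q)
    case Launch
    then show ?thesis using a rd st assms(3,5) by (auto simp: run_def keep_def)
  next
    case (Return b)
    then show ?thesis using a rd assms(4,5) tapes
      by (auto simp: run_def keep_def split: if_splits)
  next
    case Finished
    then show ?thesis using a by (simp add: run_def)
  next
    case (Simulate m c)
    show ?thesis
    proof (cases "simulated M off m rd = {}")
      case True
      then show ?thesis using a rd Simulate by (auto simp: run_def keep_def)
    next
      case False
      then obtain q' ws where ws: "(q', ws) \<in> simulated M off m rd"
        and a': "a = (Simulate q' (if rd sh = 3 then snd (ws ! 1) = Left else c),
          \<lambda>i. if off \<le> i \<and> i < off + num_tapes M then ws ! (i - off)
            else if i = sh then (rd sh, snd (ws ! 1)) else keep rd i)"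
        using a Simulate by (auto simp: run_def)
      have act: "(q', ws) \<in> actions M" using ws simulated_subset[OF assms(1)] by blast
      then have "q' < num_states M" "length ws = num_tapes M"
        by (auto simp: actions_def)
      moreover have fst: "fst (ws ! j) < num_symbols M" if "j < num_tapes M" for j
        using actionsD[OF act that] by simp
      moreover have "fst (ws ! (i - off)) < s" if "off \<le> i" "i < off + num_tapes M" for i
        using fst[of "i - off"] that assms(2) by linarith
      moreover have "rd i < s" for i using rd by simp
      ultimately show ?thesis using assms(3-5) by (auto simp: a' run_def keep_def)
    qed
  qed
qed

subsection \<open>Runs of machines\<close>

definition valid :: "machine \<Rightarrow> config \<Rightarrow> bool" where
  "valid M c \<longleftrightarrow> fst c < num_states M \<and> length (snd c) = num_tapes M \<and>
     (\<forall>t \<in> set (snd c). \<forall>i. snd t i < num_symbols M)"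

lemma readable_valid:
  assumes "valid M c"
  shows "readable M (map (\<lambda>(pos, cells). cells pos) (snd c))"
  using assms by (fastforce simp: valid_def readable_def)

lemma enabled_valid:
  assumes "ntm M" "valid M c" "a \<in> enabled M c"
  shows "a \<in> actions M"
  using assms readable_valid[OF assms(2)] by (auto simp: ntm_def enabled_def valid_def)

lemma step_nth:
  assumes "length (snd a) = length (snd c)" "i < length (snd c)"
  shows "snd (step a c) ! i = act (snd a ! i) (snd c ! i)"
  using assms by (cases a; cases c) simp

lemma valid_step:
  assumes "ntm M" "valid M c" "a \<in> enabled M c"
  shows "valid M (step a c)"
proof -
  have a: "a \<in> actions M" by (rule enabled_valid[OF assms])
  have len: "length (snd (step a c)) = num_tapes M"
    using a assms(2) by (cases a; cases c) (auto simp: actions_def valid_def)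
  have "snd (snd (step a c) ! i) j < num_symbols M" if "i < num_tapes M" for i j
  proof -
    have "fst (snd a ! i) < num_symbols M" by (rule actionsD[OF a that])
    moreover have "snd (snd c ! i) l < num_symbols M" for l
      using assms(2) that by (auto simp: valid_def)
    ultimately show ?thesis
      using a assms(2) that by (subst step_nth) (auto simp: actions_def valid_def act_split)
  qed
  moreover have "fst (step a c) < num_states M"
    using a by (cases a; cases c) (simp add: actions_def)
  ultimately show ?thesis
    using len unfolding valid_def by (metis in_set_conv_nth)
qed

lemma valid_init_config:
  assumes "ntm M"
  shows "valid M (init_config M x)"
  using assms by (auto simp: valid_def init_config_def ntm_def input_tape_def blank_tape_def bit_symbol_def)

text \<open>The head advances by at most one cell per step, so what lies \<open>length as\<close> or
  more cells to the right of \<open>b\<close> has not been written yet.\<close>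

lemma path_blank_beyond:
  assumes "ntm M" "valid M c" "is_path M c as"
    and "fst (snd c ! 1) \<le> b" "\<forall>i\<ge>b. snd (snd c ! 1) i = 0"
  shows "\<forall>i \<ge> b + int (length as). snd (snd (path_end c as) ! 1) i = 0"
  using assms(2-)
proof (induction as arbitrary: c b)
  case Nil
  then show ?case by (simp add: path_end_def)
next
  case (Cons a as)
  have a: "a \<in> enabled M c" and path: "is_path M (step a c) as" using Cons.prems by auto
  have "a \<in> actions M" by (rule enabled_valid[OF assms(1) Cons.prems(1) a])
  then have nth: "snd (step a c) ! 1 = act (snd a ! 1) (snd c ! 1)"
    using Cons.prems(1) assms(1) by (intro step_nth) (auto simp: actions_def valid_def ntm_def)
  have "offset d \<le> 1" for d by (cases d) auto
  then have "fst (snd (step a c) ! 1) \<le> b + 1"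
    unfolding nth using Cons.prems(3) by (auto simp: act_split intro: add_mono)
  moreover have "\<forall>i\<ge>b + 1. snd (snd (step a c) ! 1) i = 0"
    unfolding nth using Cons.prems(3,4) by (auto simp: act_split)
  ultimately have "\<forall>i \<ge> b + 1 + int (length as). snd (snd (path_end (step a c) as) ! 1) i = 0"
    using Cons.IH[OF valid_step[OF assms(1) Cons.prems(1) a] path] by blast
  then show ?case by (simp add: path_end_def algebra_simps)
qed

text \<open>Time bounds thereby bound values: the modulus is printed in unary, so the cutoff N is
  polynomial, and the numeral of f n has polynomially many digits.\<close>

lemma prints_within_length:
  assumes "dtm M" "prints_within M x y t"
  shows "length y \<le> t"
proof (rule ccontr)
  assume "\<not> length y \<le> t"
  obtain as where as: "is_path M (init_config M x) as" "length as \<le> t"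
    and y: "has_output (path_end (init_config M x) as) y"
    using assms(2) by (auto simp: prints_within_def)
  have M: "ntm M" using assms(1) by (simp add: dtm_def)
  then have "snd (init_config M x) ! 1 = blank_tape"
    by (auto simp: init_config_def ntm_def)
  then have "\<forall>i \<ge> 0 + int (length as). snd (snd (path_end (init_config M x) as) ! 1) i = 0"
    by (intro path_blank_beyond[OF M valid_init_config[OF M] as(1)]) (auto simp: blank_tape_def)
  then have "snd (snd (path_end (init_config M x) as) ! 1) (int t) = 0" using as(2) by simp
  moreover have "snd (snd (path_end (init_config M x) as) ! 1) (int t) = bit_symbol (y ! t)"
    using y \<open>\<not> length y \<le> t\<close> by (auto simp: has_output_def Let_def)
  ultimately show False by (simp add: bit_symbol_def split: if_splits)
qed

subsection \<open>Correctness of the simulation\<close>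

abbreviation home_mark :: "int \<Rightarrow> nat" where
  "home_mark \<equiv> (\<lambda>_. 0)(0 := 3)"

text \<open>The flag knows the side of the mark, so each step brings both heads one cell closer; one
  more step, on the mark, enters \<open>Finished\<close>.\<close>

lemma outcome_return:
  assumes "ts sh = (p, home_mark)" "p < 0 \<longrightarrow> b" "p > 0 \<longrightarrow> \<not> b" "fst (ts (Suc off)) = p" "Suc off \<noteq> sh"
    and "nat \<bar>p\<bar> < R"
  shows "outcome R (run M off sh) (Return b) ts =
    Some (ts(sh := (0, home_mark), Suc off := (0, snd (ts (Suc off)))))"
  using assms
proof (induction "nat \<bar>p\<bar>" arbitrary: p ts R)
  case 0
  then obtain R' where R: "R = Suc R'" by (cases R) auto
  have "p = 0" using 0 by simp
  moreover have eq: "ts(sh := (0, home_mark), Suc off := (0, snd (ts (Suc off)))) = ts"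
    using 0 \<open>p = 0\<close> by (auto simp: fun_eq_iff prod_eq_iff)
  ultimately show ?case using 0(2) R unfolding eq
    by (cases R') (simp_all add: run_def reads_def)
next
  case (Suc m)
  then obtain R' where R: "R = Suc R'" by (cases R) auto
  have p: "p \<noteq> 0" using Suc by auto
  define d where "d = (if b then Right else Left)"
  let ?ws = "\<lambda>i. if i = sh \<or> i = Suc off then (reads ts i, d) else keep (reads ts) i"
  have "reads ts sh \<noteq> 3" using Suc.prems p by (simp add: reads_def)
  then have mv: "moves (run M off sh) (Return b) (reads ts) = {(Return b, ?ws)}"
    unfolding d_def by (simp add: run_def)
  have pf: "perform ?ws ts = ts(sh := (p + offset d, home_mark), Suc off := (p + offset d, snd (ts (Suc off))))"
    using Suc.prems by (auto simp: perform_def reads_def keep_def fun_eq_iff act_split)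
  have "outcome R' (run M off sh) (Return b) (perform ?ws ts) =
    Some ((perform ?ws ts)(sh := (0, home_mark), Suc off := (0, snd (perform ?ws ts (Suc off)))))"
  proof (rule Suc.hyps(1))
    show "m = nat \<bar>p + offset d\<bar>" "p + offset d < 0 \<longrightarrow> b" "0 < p + offset d \<longrightarrow> \<not> b"
      using Suc.hyps(2) Suc.prems(2,3) p by (auto simp: d_def)
    show "nat \<bar>p + offset d\<bar> < R'"
      using Suc.hyps(2) Suc.prems(2,3,6) R p by (auto simp: d_def)
    show "perform ?ws ts sh = (p + offset d, home_mark)"
      "fst (perform ?ws ts (Suc off)) = p + offset d" "Suc off \<noteq> sh"
      unfolding pf using Suc.prems(5) by simp_all
  qed
  moreover have "(perform ?ws ts)(sh := (0, home_mark), Suc off := (0, snd (perform ?ws ts (Suc off))))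
      = ts(sh := (0, home_mark), Suc off := (0, snd (ts (Suc off))))"
    unfolding pf by (rule ext) simp
  ultimately show ?case using R mv by simp
qed

text \<open>A simulated step can take the output head one cell further from cell 0, so it costs a
  step now and a step on the way back; hence the factor 2. One step enters \<open>Return\<close>,
  and the strict inequality pays for the step on the mark. At \<open>p = 0\<close> the flag is
  unconstrained, because it is set afresh whenever the head leaves the mark.\<close>

lemma outcome_simulate:
  assumes M: "ntm M" "dtm M" and sh: "sh < off \<or> off + num_tapes M \<le> sh"
    and "is_path M (q, map (\<lambda>j. ts (off + j)) [0..<num_tapes M]) as"
    and "halted M (path_end (q, map (\<lambda>j. ts (off + j)) [0..<num_tapes M]) as)"
    and "valid M (q, map (\<lambda>j. ts (off + j)) [0..<num_tapes M])"
    and "ts sh = (p, home_mark)" "p < 0 \<longrightarrow> b" "p > 0 \<longrightarrow> \<not> b" "fst (ts (Suc off)) = p"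
    and "nat \<bar>p\<bar> + 2 * length as + 1 < R"
  shows "\<exists>ts'. outcome R (run M off sh) (Simulate q b) ts = Some ts' \<and>
    (\<forall>i. (i < off \<or> off + num_tapes M \<le> i) \<and> i \<noteq> sh \<longrightarrow> ts' i = ts i) \<and>
    ts' (Suc off) = (0, snd (snd (path_end (q, map (\<lambda>j. ts (off + j)) [0..<num_tapes M]) as) ! 1))"
  using assms(4-)
proof (induction as arbitrary: q b ts p R)
  case Nil
  let ?tl = "map (\<lambda>j. ts (off + j)) [0..<num_tapes M]"
  obtain R' where R: "R = Suc R'" using Nil by (cases R) auto
  have k: "2 \<le> num_tapes M" using M by (simp add: ntm_def)
  have rds: "map (\<lambda>(pos, cells). cells pos) ?tl = map (\<lambda>j. reads ts (off + j)) [0..<num_tapes M]"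
    by (simp add: reads_def case_prod_unfold)
  have "delta M q (map (\<lambda>j. reads ts (off + j)) [0..<num_tapes M]) = {}"
    using Nil.prems(2) unfolding rds[symmetric] by (simp add: halted_def enabled_def path_end_def)
  then have "simulated M off q (reads ts) = {}"
    by (simp add: simulated_def Let_def)
  then have mv: "moves (run M off sh) (Simulate q b) (reads ts) = {(Return b, keep (reads ts))}"
    by (simp add: run_def)
  have "outcome R' (run M off sh) (Return b) ts =
    Some (ts(sh := (0, home_mark), Suc off := (0, snd (ts (Suc off)))))"
    by (rule outcome_return) (use Nil.prems R sh k in auto)
  then show ?case using mv R k by (simp add: path_end_def)
next
  case (Cons a as)
  let ?tl = "map (\<lambda>j. ts (off + j)) [0..<num_tapes M]"
  let ?c = "(q, ?tl)"
  obtain R' where R: "R = Suc R'" using Cons.prems by (cases R) auto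
  have k: "2 \<le> num_tapes M" using M by (simp add: ntm_def)
  obtain q' ws where a_eq: "a = (q', ws)" by (cases a)
  have a: "a \<in> enabled M ?c" using Cons.prems(1) by simp
  have act: "a \<in> actions M" by (rule enabled_valid[OF M(1) Cons.prems(3) a])
  then have len: "length ws = num_tapes M" by (simp add: a_eq actions_def)
  have rds: "map (\<lambda>(pos, cells). cells pos) ?tl = map (\<lambda>j. reads ts (off + j)) [0..<num_tapes M]"
    by (simp add: reads_def case_prod_unfold)
  have sim: "simulated M off q (reads ts) = enabled M ?c"
    using readable_valid[OF Cons.prems(3)] Cons.prems(3)
    unfolding simulated_def Let_def enabled_def fst_conv snd_conv rds by (simp add: valid_def)
  have single: "enabled M ?c = {a}"
    using a M(2) readable_valid[OF Cons.prems(3)] Cons.prems(3)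
    by (auto simp: dtm_def enabled_def valid_def)
  let ?b = "if reads ts sh = 3 then snd (ws ! 1) = Left else b"
  let ?ws = "\<lambda>i. if off \<le> i \<and> i < off + num_tapes M then ws ! (i - off)
         else if i = sh then (reads ts sh, snd (ws ! 1)) else keep (reads ts) i"
  let ?ts = "perform ?ws ts"
  have mv: "moves (run M off sh) (Simulate q b) (reads ts) = {(Simulate q' ?b, ?ws)}"
    by (simp add: run_def sim single a_eq)
  have step: "step a ?c = (q', map (\<lambda>j. ?ts (off + j)) [0..<num_tapes M])"
    using len by (simp add: a_eq list_eq_iff_nth_eq perform_def)
  let ?d = "snd (ws ! 1)"
  have out: "?ts (Suc off) = act (ws ! 1) (ts (Suc off))"
    using k by (simp add: perform_def)
  have shad: "?ts sh = (p + offset ?d, home_mark)"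
    using sh Cons.prems(4) by (auto simp: perform_def reads_def)
  have near: "nat \<bar>p + offset ?d\<bar> \<le> Suc (nat \<bar>p\<bar>)" by (cases ?d) auto
  \<comment> \<open>From a position other than 0 one step leads at most onto the mark, so the old
    flag stays right; from 0 the direction of the step determines the side.\<close>
  have side: "p + offset ?d < 0 \<longrightarrow> ?b" "p + offset ?d > 0 \<longrightarrow> \<not> ?b"
    using Cons.prems(4-6) by (cases ?d; auto simp: reads_def)+
  have "\<exists>ts'. outcome R' (run M off sh) (Simulate q' ?b) ?ts = Some ts' \<and>
    (\<forall>i. (i < off \<or> off + num_tapes M \<le> i) \<and> i \<noteq> sh \<longrightarrow> ts' i = ?ts i) \<and>
    ts' (Suc off) = (0, snd (snd (path_end (step a ?c) as) ! 1))"
    unfolding step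
  proof (rule Cons.IH)
    show "is_path M (q', map (\<lambda>j. ?ts (off + j)) [0..<num_tapes M]) as"
      using Cons.prems(1) step by simp
    show "halted M (path_end (q', map (\<lambda>j. ?ts (off + j)) [0..<num_tapes M]) as)"
      using Cons.prems(2) step by (simp add: path_end_def)
    show "valid M (q', map (\<lambda>j. ?ts (off + j)) [0..<num_tapes M])"
      using valid_step[OF M(1) Cons.prems(3) a] step by simp
    show "fst (?ts (Suc off)) = p + offset ?d"
      unfolding out using Cons.prems(7) by (simp add: act_split)
    show "nat \<bar>p + offset ?d\<bar> + 2 * length as + 1 < R'"
      using near Cons.prems(8) R by simp
  qed (use shad side in blast)+
  then obtain ts' where ts': "outcome R' (run M off sh) (Simulate q' ?b) ?ts = Some ts'"
    "\<forall>i. (i < off \<or> off + num_tapes M \<le> i) \<and> i \<noteq> sh \<longrightarrow> ts' i = ?ts i"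
    "ts' (Suc off) = (0, snd (snd (path_end (step a ?c) as) ! 1))" by blast
  have "ts' i = ts i" if i: "(i < off \<or> off + num_tapes M \<le> i) \<and> i \<noteq> sh" for i
  proof -
    have "ts' i = ?ts i" using ts'(2) i by blast
    also have "?ts i = ts i" using i by (auto simp: perform_def keep_def reads_def)
    finally show ?thesis .
  qed
  moreover have "outcome R (run M off sh) (Simulate q b) ts = Some ts'"
    using ts'(1) mv R by simp
  moreover have "path_end ?c (a # as) = path_end (step a ?c) as" by (simp add: path_end_def)
  ultimately show ?case using ts'(3) by (intro exI[of _ ts']) simp
qed

lemma outcome_run:
  assumes "dtm M" and sh: "sh < off \<or> off + num_tapes M \<le> sh"
    and "prints_within M x y t"
    and "ts off = input_tape x" "\<And>j. 1 \<le> j \<Longrightarrow> j < num_tapes M \<Longrightarrow> ts (off + j) = blank_tape"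
    and "ts sh = blank_tape" and R: "2 * t + 3 \<le> R"
  shows "\<exists>ts'. outcome R (run M off sh) (start (run M off sh)) ts = Some ts' \<and>
    (\<forall>i. (i < off \<or> off + num_tapes M \<le> i) \<and> i \<noteq> sh \<longrightarrow> ts' i = ts i) \<and>
    fst (ts' (Suc off)) = 0 \<and> displays (ts' (Suc off)) y"
proof -
  have M: "ntm M" using assms(1) by (simp add: dtm_def)
  then have k: "2 \<le> num_tapes M" by (simp add: ntm_def)
  obtain R' where R': "R = Suc R'" using R by (cases R) auto
  obtain as where as: "is_path M (init_config M x) as" "length as \<le> t"
    "halted M (path_end (init_config M x) as)" "has_output (path_end (init_config M x) as) y"
    using assms(3) by (auto simp: prints_within_def)
  let ?ts = "ts(sh := (0, home_mark))"
  have mv: "moves (run M off sh) Launch (reads ts) =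
      {(Simulate 0 False, (keep (reads ts))(sh := (3, Stay)))}"
    by (simp add: run_def)
  have pf: "perform ((keep (reads ts))(sh := (3, Stay))) ts = ?ts"
    using assms(6) by (auto simp: fun_eq_iff perform_def keep_def reads_def blank_tape_def)
  have init: "init_config M x = (0, map (\<lambda>j. ?ts (off + j)) [0..<num_tapes M])"
  proof -
    have "ts (off + j) = (input_tape x # replicate (num_tapes M - 1) blank_tape) ! j"
      if "j < num_tapes M" for j using assms(4) assms(5)[of j] that by (cases j) auto
    then show ?thesis using sh k
      by (auto simp: init_config_def list_eq_iff_nth_eq)
  qed
  have "\<exists>ts'. outcome R' (run M off sh) (Simulate 0 False) ?ts = Some ts' \<and>
    (\<forall>i. (i < off \<or> off + num_tapes M \<le> i) \<and> i \<noteq> sh \<longrightarrow> ts' i = ?ts i) \<and>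
    ts' (Suc off) = (0, snd (snd (path_end (0, map (\<lambda>j. ?ts (off + j)) [0..<num_tapes M]) as) ! 1))"
  proof (rule outcome_simulate[OF M assms(1) sh, where p = 0])
    show "fst (?ts (Suc off)) = 0" using assms(5)[of 1] sh k by (auto simp: blank_tape_def)
    \<comment> \<open>Launching has used one of the \<open>2 * t + 3\<close> steps; the other
      \<open>2 * t + 2\<close> are just enough when the run takes time \<open>t\<close>.\<close>
    show "nat \<bar>0\<bar> + 2 * length as + 1 < R'" using as(2) R R' by simp
  qed (use as valid_init_config[OF M, of x] in \<open>simp_all only: init fun_upd_same, simp_all\<close>)
  then obtain ts' where ts': "outcome R' (run M off sh) (Simulate 0 False) ?ts = Some ts'"
    "\<forall>i. (i < off \<or> off + num_tapes M \<le> i) \<and> i \<noteq> sh \<longrightarrow> ts' i = ?ts i"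
    "ts' (Suc off) = (0, snd (snd (path_end (init_config M x) as) ! 1))" unfolding init by blast
  have "outcome R (run M off sh) Launch ts = Some ts'"
    using ts'(1) mv pf R' by simp
  moreover have "displays (ts' (Suc off)) y"
    using as(4) by (auto simp: ts'(3) displays_def has_output_def Let_def range_bit_symbol)
  ultimately show ?thesis using ts' by (auto simp: run_def)
qed

section \<open>Clocked runs\<close>

text \<open>
  The clock is an odometer. The head of each clock tape bounces between the cells \<open>-1\<close> and \<open>n\<close> next
  to a block of \<open>n\<close> nonblank cells; a digit is its distance from the end towards which it moves.
  Turning the head at an end resets the digit from 0 to \<open>n + 1\<close>. The two Booleans of a digit tell
  whether the head moves to the left, and whether it has not moved since it turned: as the cells at
  both ends are blank, the second one is needed to recognise the end.
\<close>

fun tick :: "(bool \<times> bool) list \<Rightarrow> nat list \<Rightarrow> ((bool \<times> bool) list \<times> dir list) option" where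
  "tick ((l, fresh) # ds) (s # ss) =
    (if fresh \<or> s \<noteq> 0
     then Some ((l, False) # ds, (if l then Left else Right) # replicate (length ds) Stay)
     else (case tick ds ss of None \<Rightarrow> None | Some (ds', ms) \<Rightarrow> Some ((\<not> l, True) # ds', Stay # ms)))"
| "tick _ _ = None"

definition digit :: "nat \<Rightarrow> bool \<times> bool \<Rightarrow> int \<Rightarrow> nat" where
  "digit n d p = nat (if fst d then p + 1 else int n - p)"

text \<open>A blank cell only shows that the head is at one of the two ends. The digit is n + 1
  exactly if the flag is set, so a blank cell without the flag means digit 0.\<close>

definition digit_ok :: "nat \<Rightarrow> bool \<times> bool \<Rightarrow> int \<Rightarrow> bool" where
  "digit_ok n d p \<longleftrightarrow> -1 \<le> p \<and> p \<le> int n \<and>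
     (if snd d then digit n d p = n + 1 else digit n d p \<le> n)"

text \<open>Digits range from 0 to n + 1, so the base is n + 2; the least significant digit comes
  first.\<close>

fun clock_value :: "nat \<Rightarrow> (bool \<times> bool) list \<Rightarrow> int list \<Rightarrow> nat" where
  "clock_value n (d # ds) (p # ps) = digit n d p + (n + 2) * clock_value n ds ps"
| "clock_value n _ _ = 0"

text \<open>A tick is subtraction of 1 with borrow. Turning at an end leaves the head in place and
  changes its distance from 0 to n + 1, while the borrow passes on: 0 + (n + 2)(V + 1) = (n + 1) +
  (n + 2) V + 1.\<close>

lemma tick_correct:
  assumes "list_all2 (digit_ok n) ds ps"
    and "list_all2 (\<lambda>p s. s \<noteq> 0 \<longleftrightarrow> 0 \<le> p \<and> p < int n) ps ss"
  shows "case tick ds ss of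
      None \<Rightarrow> clock_value n ds ps = 0
    | Some (ds', ms) \<Rightarrow> length ms = length ds \<and>
        list_all2 (digit_ok n) ds' (map2 (\<lambda>p m. p + offset m) ps ms) \<and>
        clock_value n ds ps = Suc (clock_value n ds' (map2 (\<lambda>p m. p + offset m) ps ms))"
  using assms
proof (induction ds arbitrary: ps ss)
  case Nil
  then show ?case by simp
next
  case (Cons d ds)
  obtain l fresh where d: "d = (l, fresh)" by (cases d)
  obtain p ps' where ps: "ps = p # ps'" "digit_ok n d p" "list_all2 (digit_ok n) ds ps'"
    using Cons.prems(1) by (auto simp: list_all2_Cons1)
  obtain s ss' where ss: "ss = s # ss'" "s \<noteq> 0 \<longleftrightarrow> 0 \<le> p \<and> p < int n"
    "list_all2 (\<lambda>p s. s \<noteq> 0 \<longleftrightarrow> 0 \<le> p \<and> p < int n) ps' ss'"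
    using Cons.prems(2) ps(1) by (auto simp: list_all2_Cons1)
  have len: "length ps' = length ds" using ps(3) by (simp add: list_all2_lengthD)
  have stay: "map2 (\<lambda>p m. p + offset m) ps' (replicate (length ds) Stay) = ps'"
    using len by (simp add: list_eq_iff_nth_eq)
  show ?case
  proof (cases "fresh \<or> s \<noteq> 0")
    case True
    have "digit_ok n (l, False) (p + offset (if l then Left else Right))"
      "digit n d p = Suc (digit n (l, False) (p + offset (if l then Left else Right)))"
      using True ps(2) ss(2) by (auto simp: digit_ok_def digit_def d split: if_splits)
    then show ?thesis using True ps(3) stay by (simp add: d ps(1) ss(1))
  next
    case False
    have zero: "digit n d p = 0"
      using False ps(2) ss(2) by (auto simp: digit_ok_def digit_def d split: if_splits)
    have flip: "digit_ok n (\<not> l, True) p" "digit n (\<not> l, True) p = n + 1"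
      using False ps(2) zero by (auto simp: digit_ok_def digit_def d split: if_splits)
    show ?thesis
      using Cons.IH[OF ps(3) ss(3)] False zero flip
      by (auto simp: d ps(1) ss(1) split: option.splits)
  qed
qed

text \<open>All digits are n + 1 when every head is on cell n and about to move left. This is where
  writing a block of n cells leaves the heads, so the clock needs no preparation.\<close>

lemma clock_value_start:
  "Suc (clock_value n (replicate k (True, b)) (replicate k (int n))) = (n + 2) ^ k"
proof (induction k)
  case (Suc k)
  have "Suc (clock_value n (replicate (Suc k) (True, b)) (replicate (Suc k) (int n)))
     = (n + 2) * Suc (clock_value n (replicate k (True, b)) (replicate k (int n)))"
    by (simp add: digit_def nat_add_distrib)
  then show ?case using Suc.IH by simp
qed simp

definition visible :: "nat set \<Rightarrow> (nat \<Rightarrow> nat) \<Rightarrow> nat \<Rightarrow> nat" where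
  "visible B rd i = (if i \<in> B then rd i else 0)"

text \<open>The clocked program sees blanks outside \<open>B\<close>, so that its outcome depends on
  the tapes in \<open>B\<close> alone, whatever other phases left elsewhere.\<close>

definition restrict_tapes :: "nat set \<Rightarrow> tapes \<Rightarrow> tapes" where
  "restrict_tapes B ts i = (if i \<in> B then ts i else blank_tape)"

lemma visible_reads: "visible B (reads ts) = reads (restrict_tapes B ts)"
  by (auto simp: visible_def reads_def restrict_tapes_def blank_tape_def)

text \<open>Every move comes with a tick. An exhausted clock leaves no move, so an unfinished run
  halts in a state that is not final and rejects.\<close>

definition timed :: "'q prog \<Rightarrow> nat set \<Rightarrow> nat \<Rightarrow> nat \<Rightarrow> ('q \<times> (bool \<times> bool) list) prog" where
  "timed A B c k = \<lparr>start = (start A, replicate k (True, True)),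
     states = states A \<times> {ds. length ds = k},
     finals = finals A \<times> UNIV,
     moves = (\<lambda>(q, ds) rd. case tick ds (map (\<lambda>j. rd (c + j)) [0..<k]) of
         None \<Rightarrow> {}
       | Some (ds', ms) \<Rightarrow> (\<lambda>a. ((fst a, ds'), \<lambda>i. if i \<in> B then snd a i
           else if c \<le> i \<and> i < c + k then (rd i, ms ! (i - c)) else keep rd i)) `
           moves A q (visible B rd))\<rparr>"

definition inert_outside :: "nat set \<Rightarrow> 'q prog \<Rightarrow> bool" where
  "inert_outside B A \<longleftrightarrow> (\<forall>q rd. \<forall>a \<in> moves A q rd. \<forall>i. i \<notin> B \<longrightarrow> snd a i = keep rd i)"

lemma tick_lengths:
  assumes "tick ds ss = Some (ds', ms)"
  shows "length ds' = length ds \<and> length ms = length ds"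
  using assms by (induction ds ss arbitrary: ds' ms rule: tick.induct)
    (auto split: if_splits option.splits)

lemma well_formed_timed:
  assumes A: "well_formed k s A" and c: "c + m \<le> k"
  shows "well_formed k s (timed A B c m)"
  unfolding well_formed_def
proof (intro conjI ballI allI impI)
  have "finite {ds :: (bool \<times> bool) list. length ds = m}"
    using finite_lists_length_eq[of "UNIV :: (bool \<times> bool) set" m] by simp
  then show "finite (states (timed A B c m))"
    using A by (simp add: timed_def well_formed_def)
  show "start (timed A B c m) \<in> states (timed A B c m)"
    using A by (simp add: timed_def well_formed_def)
  fix p rd a assume p: "p \<in> states (timed A B c m)" and rd: "\<forall>i. rd i < s"
    and a: "a \<in> moves (timed A B c m) p rd"
  obtain q ds where p_eq: "p = (q, ds)" by (cases p)
  obtain ds' ms where tick: "tick ds (map (\<lambda>j. rd (c + j)) [0..<m]) = Some (ds', ms)"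
    using a by (cases "tick ds (map (\<lambda>j. rd (c + j)) [0..<m])") (auto simp: timed_def p_eq)
  then obtain b where b: "b \<in> moves A q (visible B rd)"
    and a_eq: "a = ((fst b, ds'), \<lambda>i. if i \<in> B then snd b i
           else if c \<le> i \<and> i < c + m then (rd i, ms ! (i - c)) else keep rd i)"
    using a by (auto simp: timed_def p_eq)
  have "0 < s" using rd less_nat_zero_code by (metis gr_zeroI)
  then have vis: "\<forall>i. visible B rd i < s" using rd by (simp add: visible_def)
  have q: "q \<in> states A" "length ds = m" using p by (auto simp: timed_def p_eq)
  note wfD = well_formedD[OF A q(1) vis b]
  have "keep (visible B rd) i = keep rd i" if "i \<in> B" for i using that by (simp add: keep_def visible_def)
  then show "case a of (q', ws) \<Rightarrow> q' \<in> states (timed A B c m) \<and> (\<forall>i<k. fst (ws i) < s) \<and>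
      (\<forall>i\<ge>k. ws i = keep rd i)"
    using wfD tick_lengths[OF tick] q(2) rd c by (auto simp: a_eq timed_def keep_def)
qed

text \<open>The clock value is the fuel of \<open>outcome\<close>, and both decrease together. Final
  states must have no moves: the clock may expire in one, the clocked program then accepts, and
  \<open>outcome\<close> has to succeed with fuel 0. The tapes of the clock end up in an unspecified
  position, so \<open>F\<close> is required for all tapes that are right elsewhere.\<close>

lemma counts_timed_aux:
  assumes A: "deterministic A" "inert_outside B A" "\<And>q rd. q \<in> finals A \<Longrightarrow> moves A q rd = {}"
    and disj: "B \<inter> {c..<c + k} = {}"
    and "list_all2 (digit_ok n) ds (map (\<lambda>j. fst (ts (c + j))) [0..<k])"
    and "\<And>j i. j < k \<Longrightarrow> snd (ts (c + j)) i \<noteq> 0 \<longleftrightarrow> 0 \<le> i \<and> i < int n"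
    and "clock_value n ds (map (\<lambda>j. fst (ts (c + j))) [0..<k]) = R"
    and "case outcome R A q (restrict_tapes B ts) of None \<Rightarrow> v = 0
      | Some us \<Rightarrow> \<forall>ts'. (\<forall>i \<in> B. ts' i = us i) \<and>
          (\<forall>i. i \<notin> B \<and> i \<notin> {c..<c + k} \<longrightarrow> ts' i = ts i) \<longrightarrow> F ts' v"
  shows "counts (timed A B c k) F (q, ds) ts R v"
  using assms(5-)
proof (induction R arbitrary: q ds ts)
  case 0
  let ?ps = "map (\<lambda>j. fst (ts (c + j))) [0..<k]" and ?ss = "map (\<lambda>j. reads ts (c + j)) [0..<k]"
  have "list_all2 (\<lambda>p s. s \<noteq> 0 \<longleftrightarrow> 0 \<le> p \<and> p < int n) ?ps ?ss"
    using 0(2) by (simp add: list_all2_conv_all_nth reads_def)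
  then have "tick ds ?ss = None"
    using tick_correct[OF 0(1), of ?ss] 0(3) by (auto split: option.splits)
  then have mv: "moves (timed A B c k) (q, ds) (reads ts) = {}" by (simp add: timed_def)
  show ?case
  proof (cases "q \<in> finals A")
    case True
    then have "F ts v" using 0(4) A(3)[OF True] by (simp add: restrict_tapes_def)
    then show ?thesis using mv True by (intro counts.accept) (simp_all add: timed_def)
  next
    case False
    then have "v = 0" using 0(4) by simp
    then show ?thesis using mv False by (simp add: counts.reject timed_def)
  qed
next
  case (Suc R)
  let ?ps = "map (\<lambda>j. fst (ts (c + j))) [0..<k]" and ?ss = "map (\<lambda>j. reads ts (c + j)) [0..<k]"
  show ?case
  proof (cases "moves A q (visible B (reads ts)) = {}")
    case True
    then have mv: "moves (timed A B c k) (q, ds) (reads ts) = {}"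
      by (simp add: timed_def split: option.split)
    show ?thesis
    proof (cases "q \<in> finals A")
      case True
      then have "F ts v" using Suc.prems(4) A(3)[OF True] by (simp add: restrict_tapes_def)
      then show ?thesis using mv True by (intro counts.accept) (simp_all add: timed_def)
    next
      case False
      then have "v = 0" using Suc.prems(4) \<open>moves A q (visible B (reads ts)) = {}\<close>
        by (simp add: visible_reads)
      then show ?thesis using mv False by (simp add: counts.reject timed_def)
    qed
  next
    case False
    then obtain a where a: "moves A q (visible B (reads ts)) = {a}"
      using A(1) unfolding deterministic_def by blast
    have "list_all2 (\<lambda>p s. s \<noteq> 0 \<longleftrightarrow> 0 \<le> p \<and> p < int n) ?ps ?ss"
      using Suc.prems(2) by (simp add: list_all2_conv_all_nth reads_def)
    note tc = tick_correct[OF Suc.prems(1) this]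
    then obtain ds' ms where tick: "tick ds ?ss = Some (ds', ms)"
      using Suc.prems(3) by (cases "tick ds ?ss") auto
    have len: "length ms = k" using tc tick Suc.prems(1) by (simp add: list_all2_lengthD)
    let ?ps' = "map2 (\<lambda>p m. p + offset m) ?ps ms"
    have ok: "list_all2 (digit_ok n) ds' ?ps'" and val: "clock_value n ds' ?ps' = R"
      using tc tick Suc.prems(3) by simp_all
    let ?ws = "\<lambda>i. if i \<in> B then snd a i
           else if c \<le> i \<and> i < c + k then (reads ts i, ms ! (i - c)) else keep (reads ts) i"
    let ?ts = "perform ?ws ts"
    have mv: "moves (timed A B c k) (q, ds) (reads ts) = {((fst a, ds'), ?ws)}"
      unfolding timed_def by (simp add: tick) (simp only: a image_insert image_empty)
    have clk: "?ts (c + j) = (fst (ts (c + j)) + offset (ms ! j), snd (ts (c + j)))" if "j < k" for j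
    proof -
      have "c + j \<notin> B" using disj that by auto
      then show ?thesis using that by (simp add: perform_def reads_def)
    qed
    have ps': "map (\<lambda>j. fst (?ts (c + j))) [0..<k] = ?ps'"
      using len clk by (simp add: list_eq_iff_nth_eq)
    have inert: "snd a i = keep (visible B (reads ts)) i" if "i \<notin> B" for i
      using A(2) a that unfolding inert_outside_def by blast
    have res: "restrict_tapes B ?ts = perform (snd a) (restrict_tapes B ts)"
    proof
      fix i show "restrict_tapes B ?ts i = perform (snd a) (restrict_tapes B ts) i"
        using inert[of i]
        by (cases "i \<in> B") (simp_all add: restrict_tapes_def perform_def keep_def visible_def
            blank_tape_def fun_eq_iff)
    qed
    have same: "?ts i = ts i" if "i \<notin> B" "i \<notin> {c..<c + k}" for i
      using that by (auto simp: perform_def keep_def reads_def)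
    have "counts (timed A B c k) F (fst a, ds') ?ts R v"
    proof (rule Suc.IH)
      show "list_all2 (digit_ok n) ds' (map (\<lambda>j. fst (?ts (c + j))) [0..<k])"
        unfolding ps' by (rule ok)
      show "clock_value n ds' (map (\<lambda>j. fst (?ts (c + j))) [0..<k]) = R"
        unfolding ps' by (rule val)
      show "snd (?ts (c + j)) i \<noteq> 0 \<longleftrightarrow> 0 \<le> i \<and> i < int n" if "j < k" for j i
        unfolding clk[OF that] using Suc.prems(2)[OF that] by simp
      have "outcome (Suc R) A q (restrict_tapes B ts) = outcome R A (fst a) (restrict_tapes B ?ts)"
        using a unfolding res by (simp add: visible_reads)
      then show "case outcome R A (fst a) (restrict_tapes B ?ts) of None \<Rightarrow> v = 0
        | Some us \<Rightarrow> \<forall>ts'. (\<forall>i \<in> B. ts' i = us i) \<and>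
            (\<forall>i. i \<notin> B \<and> i \<notin> {c..<c + k} \<longrightarrow> ts' i = ?ts i) \<longrightarrow> F ts' v"
        using Suc.prems(4) same by (auto split: option.splits)
    qed
    then show ?thesis by (rule counts_step[OF mv])
  qed
qed

lemma counts_timed:
  assumes A: "deterministic A" "inert_outside B A" "\<And>q rd. q \<in> finals A \<Longrightarrow> moves A q rd = {}"
    and disj: "B \<inter> {c..<c + k} = {}"
    and clock: "\<And>j. j < k \<Longrightarrow> ts (c + j) = (int n, \<lambda>i. if 0 \<le> i \<and> i < int n then 2 else 0)"
    and out: "case outcome ((n + 2) ^ k - 1) A (start A) (restrict_tapes B ts) of None \<Rightarrow> v = 0
      | Some us \<Rightarrow> \<forall>ts'. (\<forall>i \<in> B. ts' i = us i) \<and>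
          (\<forall>i. i \<notin> B \<and> i \<notin> {c..<c + k} \<longrightarrow> ts' i = ts i) \<longrightarrow> F ts' v"
  shows "counts (timed A B c k) F (start (timed A B c k)) ts ((n + 2) ^ k - 1) v"
proof -
  have ps: "map (\<lambda>j. fst (ts (c + j))) [0..<k] = replicate k (int n)"
    using clock by (simp add: list_eq_iff_nth_eq)
  have "clock_value n (replicate k (True, True)) (replicate k (int n)) = (n + 2) ^ k - 1"
    using clock_value_start[of n k True] by simp
  then have "counts (timed A B c k) F (start A, replicate k (True, True)) ts ((n + 2) ^ k - 1) v"
    by (intro counts_timed_aux[OF A disj])
      (use clock out in \<open>auto simp: ps list_all2_conv_all_nth digit_ok_def digit_def nat_add_distrib\<close>)
  then show ?thesis by (simp add: timed_def)
qed

lemma inert_outside_run: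
  assumes "ntm M"
  shows "inert_outside (insert sh {off..<off + num_tapes M}) (run M off sh)"
proof -
  have "snd a i = keep rd i" if "a \<in> run_moves M off sh q rd" "i \<noteq> sh" "i < off \<or> off + num_tapes M \<le> i"
    for q rd a i
    using that assms by (cases q) (auto simp: ntm_def split: if_splits)
  then show ?thesis by (auto simp: inert_outside_def run_def)
qed

section \<open>Elementary programs\<close>

lemma perform_upd [simp]: "perform (g(i := a)) ts = (perform g ts)(i := act a (ts i))"
  by (rule ext) (simp add: perform_def)

definition puts :: "tape \<Rightarrow> nat list \<Rightarrow> tape" where
  "puts t ss = (fst t + int (length ss),
     \<lambda>i. if fst t \<le> i \<and> i < fst t + int (length ss) then ss ! nat (i - fst t) else snd t i)"

lemma puts_Nil [simp]: "puts t [] = t"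
  by (cases t) (auto simp: puts_def fun_eq_iff)

lemma puts_act: "puts (act (s, Right) t) ss = puts t (s # ss)"
  by (cases t) (auto simp: puts_def fun_eq_iff nth_Cons' intro!: arg_cong[of _ _ "(!) ss"])

lemma puts_blank: "puts blank_tape (map bit_symbol x) = (int (length x), snd (input_tape x))"
  by (auto simp: puts_def blank_tape_def input_tape_def fun_eq_iff)

lemma displays_Nil: "displays t [] \<longleftrightarrow> snd t (fst t) \<notin> {1, 2}"
  by (simp add: displays_def)

lemma displays_Cons:
  "displays t (b # y) \<longleftrightarrow> snd t (fst t) = bit_symbol b \<and> displays (fst t + 1, snd t) y"
  by (simp add: displays_def All_less_Suc2 algebra_simps)

lemma displays_upd:
  assumes "i < p"
  shows "displays (p, c(i := s)) y \<longleftrightarrow> displays (p, c) y"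
  using assms by (simp add: displays_def)

lemma displays_input_tape: "displays (input_tape x) x"
  by (simp add: displays_def input_tape_def)

lemma bit_symbol_cases: "bit_symbol b = 1 \<or> bit_symbol b = 2"
  by (simp add: bit_symbol_def)

subsection \<open>Splitting the input\<close>

text \<open>The separator is overwritten by a blank, which later stops the rewinding of tape 0 at
  the first bit of w. Tape \<open>a\<close> receives one mark for every other input symbol, that is
  r + |w| in unary, the argument of the modulus.\<close>

definition split_input :: "nat \<Rightarrow> nat prog" where
  "split_input a = \<lparr>start = 0, states = {0, 1}, finals = {1}, moves = (\<lambda>q rd.
     if q = 0 then
       (if rd 0 = 2 then {(0, (keep rd)(0 := (2, Right), a := (2, Right)))}
        else if rd 0 = 1 then {(1, (keep rd)(0 := (0, Right)))} else {})
     else if q = 1 \<and> rd 0 \<in> {1, 2} then {(1, (keep rd)(0 := (rd 0, Right), a := (2, Right)))}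
     else {})\<rparr>"

lemma counts_split_input_1:
  assumes a: "a \<noteq> 0" and "displays (ts 0) w"
    and "F (ts(0 := (fst (ts 0) + int (length w), snd (ts 0)), a := puts (ts a) (replicate (length w) 2))) v"
  shows "counts (split_input a) F 1 ts (length w) v"
  using assms(2,3)
proof (induction w arbitrary: ts)
  case Nil
  then show ?case
    by (intro counts.accept) (auto simp: split_input_def displays_Nil reads_def)
next
  case (Cons b w)
  obtain p c where t0: "ts 0 = (p, c)" by (cases "ts 0")
  have b: "reads ts 0 \<in> {1, 2}"
    using Cons.prems(1) bit_symbol_cases[of b] by (auto simp: displays_Cons reads_def)
  let ?ts = "ts(0 := (p + 1, c), a := act (2, Right) (ts a))"
  let ?ws = "(keep (reads ts))(0 := (reads ts 0, Right), a := (2, Right))"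
  have mv: "moves (split_input a) 1 (reads ts) = {(1, ?ws)}"
    using b by (simp add: split_input_def)
  have pf: "perform ?ws ts = ?ts"
    using a by (simp add: reads_def t0)
  have eq: "?ts(0 := (fst (?ts 0) + int (length w), snd (?ts 0)), a := puts (?ts a) (replicate (length w) 2))
      = ts(0 := (fst (ts 0) + int (length (b # w)), snd (ts 0)), a := puts (ts a) (replicate (length (b # w)) 2))"
    using a by (auto simp: fun_eq_iff t0 puts_act)
  have "counts (split_input a) F 1 ?ts (length w) v"
  proof (rule Cons.IH)
    show "displays (?ts 0) w" using Cons.prems(1) a by (simp add: displays_Cons t0)
  qed (simp only: eq Cons.prems(2))
  then show ?case using counts_step[OF mv] by (simp only: pf list.size add_0_right add_Suc_right)
qed

lemma counts_split_input:
  assumes a: "a \<noteq> 0" and "displays (ts 0) (replicate r True @ False # w)"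
    and "F (ts(0 := (fst (ts 0) + int r + 1 + int (length w), (snd (ts 0))(fst (ts 0) + int r := 0)),
       a := puts (ts a) (replicate (r + length w) 2))) v"
  shows "counts (split_input a) F 0 ts (Suc (r + length w)) v"
  using assms(2,3)
proof (induction r arbitrary: ts)
  case 0
  obtain p c where t0: "ts 0 = (p, c)" by (cases "ts 0")
  have b: "reads ts 0 = 1" using 0 t0 by (simp add: displays_Cons reads_def bit_symbol_def)
  let ?ts = "ts(0 := (p + 1, c(p := 0)))"
  let ?ws = "(keep (reads ts))(0 := (0, Right))"
  have mv: "moves (split_input a) 0 (reads ts) = {(1, ?ws)}"
    using b by (simp add: split_input_def)
  have pf: "perform ?ws ts = ?ts" by (simp add: t0)
  have eq: "?ts(0 := (fst (?ts 0) + int (length w), snd (?ts 0)), a := puts (?ts a) (replicate (length w) 2))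
      = ts(0 := (fst (ts 0) + int 0 + 1 + int (length w), (snd (ts 0))(fst (ts 0) + int 0 := 0)),
       a := puts (ts a) (replicate (0 + length w) 2))"
    using a by (auto simp: fun_eq_iff t0)
  have "counts (split_input a) F 1 ?ts (length w) v"
  proof (rule counts_split_input_1[OF a])
    show "displays (?ts 0) w" using "0.prems"(1) a by (simp add: displays_Cons t0 displays_upd)
  qed (simp only: eq "0.prems"(2))
  then show ?case using counts_step[OF mv] by (simp only: pf add_0)
next
  case (Suc r)
  obtain p c where t0: "ts 0 = (p, c)" by (cases "ts 0")
  have b: "reads ts 0 = 2" using Suc.prems(1) t0 by (simp add: displays_Cons reads_def bit_symbol_def)
  let ?ts = "ts(0 := (p + 1, c), a := act (2, Right) (ts a))"
  let ?ws = "(keep (reads ts))(0 := (2, Right), a := (2, Right))"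
  have mv: "moves (split_input a) 0 (reads ts) = {(0, ?ws)}"
    using b by (simp add: split_input_def)
  have pf: "perform ?ws ts = ?ts"
    using a b by (auto simp: fun_eq_iff t0 reads_def)
  have eq: "?ts(0 := (fst (?ts 0) + int r + 1 + int (length w), (snd (?ts 0))(fst (?ts 0) + int r := 0)),
       a := puts (?ts a) (replicate (r + length w) 2))
      = ts(0 := (fst (ts 0) + int (Suc r) + 1 + int (length w), (snd (ts 0))(fst (ts 0) + int (Suc r) := 0)),
       a := puts (ts a) (replicate (Suc r + length w) 2))"
    using a by (auto simp: fun_eq_iff t0 puts_act algebra_simps)
  have "counts (split_input a) F 0 ?ts (Suc (r + length w)) v"
  proof (rule Suc.IH)
    show "displays (?ts 0) (replicate r True @ False # w)"
      using Suc.prems(1) a by (simp add: displays_Cons t0)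
  qed (simp only: eq Suc.prems(2))
  then show ?case using counts_step[OF mv] by (simp only: pf add_Suc)
qed

text \<open>The time bound is demanded on all inputs, also on those that encode no pair.\<close>

lemma counts_split_input_no_separator:
  assumes a: "a \<noteq> 0" and "displays (ts 0) (replicate r True)"
  shows "counts (split_input a) F 0 ts r 0"
  using assms(2)
proof (induction r arbitrary: ts)
  case 0
  then show ?case by (intro counts.reject) (auto simp: split_input_def displays_Nil reads_def)
next
  case (Suc r)
  obtain p c where t0: "ts 0 = (p, c)" by (cases "ts 0")
  have b: "reads ts 0 = 2" using Suc.prems t0 by (simp add: displays_Cons reads_def bit_symbol_def)
  let ?ts = "ts(0 := (p + 1, c), a := act (2, Right) (ts a))"
  let ?ws = "(keep (reads ts))(0 := (2, Right), a := (2, Right))"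
  have mv: "moves (split_input a) 0 (reads ts) = {(0, ?ws)}"
    using b by (simp add: split_input_def)
  have pf: "perform ?ws ts = ?ts"
    using a b by (auto simp: fun_eq_iff t0 reads_def)
  have "counts (split_input a) F 0 ?ts r 0"
    by (rule Suc.IH) (use Suc.prems a in \<open>simp add: displays_Cons t0\<close>)
  then show ?case using counts_step[OF mv] by (simp only: pf)
qed

subsection \<open>Rewinding\<close>

definition move :: "nat set \<Rightarrow> dir \<Rightarrow> (nat \<Rightarrow> nat) \<Rightarrow> nat \<Rightarrow> nat \<times> dir" where
  "move I d rd i = (rd i, if i \<in> I then d else Stay)"

definition shift :: "nat set \<Rightarrow> int \<Rightarrow> tapes \<Rightarrow> tapes" where
  "shift I z ts i = (if i \<in> I then (fst (ts i) + z, snd (ts i)) else ts i)"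

lemma perform_move: "perform (move I d (reads ts)) ts = shift I (offset d) ts"
  by (rule ext) (simp add: perform_def move_def shift_def reads_def)

lemma shift_shift: "shift I a (shift I b ts) = shift I (a + b) ts"
  by (rule ext) (simp add: shift_def)

text \<open>The first step moves from the cell behind the block into it, and the last one returns
  from the blank before it. The heads in \<open>I\<close> move in lockstep, guided by tape
  \<open>i\<close>.\<close>

definition rewind :: "nat set \<Rightarrow> nat \<Rightarrow> nat prog" where
  "rewind I i = \<lparr>start = 0, states = {0, 1, 2}, finals = {2}, moves = (\<lambda>q rd.
     if q = 0 then {(1, move I Left rd)}
     else if q = 1 then (if rd i \<noteq> 0 then {(1, move I Left rd)} else {(2, move I Right rd)})
     else {})\<rparr>"

lemma counts_rewind_1:
  assumes "i \<in> I" "\<And>l. l < L \<Longrightarrow> snd (ts i) (fst (ts i) - int l) \<noteq> 0"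
    and "snd (ts i) (fst (ts i) - int L) = 0" "F (shift I (1 - int L) ts) v"
  shows "counts (rewind I i) F 1 ts (L + 1) v"
  using assms(2-)
proof (induction L arbitrary: ts)
  case 0
  have "counts (rewind I i) F 2 (perform (move I Right (reads ts)) ts) 0 v"
    using 0 by (intro counts.accept) (simp_all add: rewind_def perform_move)
  moreover have "moves (rewind I i) 1 (reads ts) = {(2, move I Right (reads ts))}"
    using 0 by (simp add: rewind_def reads_def)
  ultimately show ?case by (simp add: counts_step)
next
  case (Suc L)
  have "counts (rewind I i) F 1 (perform (move I Left (reads ts)) ts) (L + 1) v"
  proof (rule Suc.IH)
    fix l assume "l < L"
    then show "snd (perform (move I Left (reads ts)) ts i) (fst (perform (move I Left (reads ts)) ts i) - int l) \<noteq> 0"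
      using Suc.prems(1)[of "Suc l"] assms(1) by (simp add: perform_move shift_def algebra_simps)
  next
    show "F (shift I (1 - int L) (perform (move I Left (reads ts)) ts)) v"
      using Suc.prems(3) by (simp add: perform_move shift_shift)
  qed (use Suc.prems(2) assms(1) in \<open>simp add: perform_move shift_def algebra_simps\<close>)
  moreover have "moves (rewind I i) 1 (reads ts) = {(1, move I Left (reads ts))}"
    using Suc.prems(1)[of 0] by (simp add: rewind_def reads_def)
  ultimately show ?case by (simp add: counts_step)
qed

lemma counts_rewind:
  assumes "i \<in> I" "\<And>l. 1 \<le> l \<Longrightarrow> l \<le> L \<Longrightarrow> snd (ts i) (fst (ts i) - int l) \<noteq> 0"
    and "snd (ts i) (fst (ts i) - int L - 1) = 0" "F (shift I (- int L) ts) v"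
  shows "counts (rewind I i) F (start (rewind I i)) ts (L + 2) v"
proof -
  have "counts (rewind I i) F 1 (perform (move I Left (reads ts)) ts) (L + 1) v"
  proof (rule counts_rewind_1[OF assms(1)])
    fix l assume "l < L"
    then show "snd (perform (move I Left (reads ts)) ts i) (fst (perform (move I Left (reads ts)) ts i) - int l) \<noteq> 0"
      using assms(2)[of "Suc l"] assms(1) by (simp add: perform_move shift_def algebra_simps)
  next
    show "F (shift I (1 - int L) (perform (move I Left (reads ts)) ts)) v"
      using assms(4) by (simp add: perform_move shift_shift)
  qed (use assms(1,3) in \<open>simp add: perform_move shift_def algebra_simps\<close>)
  moreover have "moves (rewind I i) 0 (reads ts) = {(1, move I Left (reads ts))}"
    by (simp add: rewind_def)
  ultimately show ?thesis by (simp add: counts_step rewind_def)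
qed

subsection \<open>Guessing\<close>

definition guess_bit :: "nat \<Rightarrow> nat set \<Rightarrow> nat \<Rightarrow> (nat \<Rightarrow> nat) \<Rightarrow> nat \<Rightarrow> nat \<Rightarrow> nat \<times> dir" where
  "guess_bit b I c rd s i = (if i \<in> I then (2, Right)
     else ((keep rd)(b := (rd b, Right), c := (s, Right))) i)"

text \<open>
  The block of bits on tape \<open>b\<close> bounds the length. In state 0 the program guesses the bits of a string
  on tape \<open>c\<close>, in state 1 it extends the block on tape \<open>e\<close>, and in state 2 it makes idle
  guesses, which double the number of paths. The tapes in \<open>I\<close> record the time spent in the states 0
  and 1.
\<close>

definition guess :: "nat \<Rightarrow> nat set \<Rightarrow> nat \<Rightarrow> nat \<Rightarrow> nat prog" where
  "guess b I c e = \<lparr>start = 0, states = {0, 1, 2}, finals = {0, 1, 2}, moves = (\<lambda>q rd.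
     if rd b \<notin> {1, 2} then {}
     else (if q = 0 then {(0, guess_bit b I c rd 1), (0, guess_bit b I c rd 2)} else {}) \<union>
       (if q \<le> 1 then {(1, guess_bit b I e rd 2)} else {}) \<union>
       {(2, (keep rd)(b := (1, Right))), (2, (keep rd)(b := (2, Right)))})\<rparr>"

lemma counts_branch_list:
  assumes "moves A q (reads ts) = set as" "distinct as" "as \<noteq> []"
    and "list_all2 (\<lambda>a v. counts A F (fst a) (perform (snd a) ts) T v) as vs"
  shows "counts A F q ts (Suc T) (sum_list vs)"
proof -
  let ?V = "\<lambda>a. vs ! (THE i. i < length as \<and> as ! i = a)"
  have V: "?V (as ! i) = vs ! i" if "i < length as" for i
  proof -
    have "(THE j. j < length as \<and> as ! j = as ! i) = i"
      using that assms(2) by (intro the_equality) (auto simp: nth_eq_iff_index_eq)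
    then show ?thesis by simp
  qed
  have "counts A F q ts (Suc T) (\<Sum>a \<in> moves A q (reads ts). ?V a)"
  proof (rule counts.branch)
    fix a assume "a \<in> moves A q (reads ts)"
    then obtain i where i: "i < length as" "as ! i = a"
      unfolding assms(1) by (auto simp: in_set_conv_nth)
    then have "counts A F (fst a) (perform (snd a) ts) T (vs ! i)"
      using assms(4) by (auto simp: list_all2_conv_all_nth)
    then show "counts A F (fst a) (perform (snd a) ts) T (?V a)" using V[OF i(1)] i(2) by simp
  qed (simp_all add: assms(1,3))
  also have "(\<Sum>a \<in> moves A q (reads ts). ?V a) = sum_list (map ?V as)"
    unfolding assms(1) by (rule sum.distinct_set_conv_list[OF assms(2)])
  also have "map ?V as = vs"
    using assms(4) V by (intro nth_equalityI) (auto simp: list_all2_lengthD)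
  finally show ?thesis .
qed

text \<open>A relation instead of an explicit update, because idle guesses leave arbitrary bits on
  tape \<open>b\<close>, about which nothing is said.\<close>

definition guessed :: "nat \<Rightarrow> nat set \<Rightarrow> nat \<Rightarrow> nat \<Rightarrow> tapes \<Rightarrow> bool list \<Rightarrow> nat \<Rightarrow> tapes \<Rightarrow> bool" where
  "guessed b I c e ts \<pi> m ts' \<longleftrightarrow>
     (\<forall>i \<in> I. ts' i = puts (ts i) (replicate (length \<pi> + m) 2)) \<and>
     ts' c = puts (ts c) (map bit_symbol \<pi>) \<and> ts' e = puts (ts e) (replicate m 2) \<and>
     (\<forall>i. i \<notin> I \<and> i \<notin> {b, c, e} \<longrightarrow> ts' i = ts i)"

lemma counts_guess_2:
  assumes "displays (ts b) y" "\<And>ts'. (\<And>i. i \<noteq> b \<Longrightarrow> ts' i = ts i) \<Longrightarrow> F ts' v"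
  shows "counts (guess b I c e) F 2 ts (length y) (2 ^ length y * v)"
  using assms
proof (induction y arbitrary: ts)
  case Nil
  then show ?case by (intro counts.accept) (auto simp: guess_def displays_Nil reads_def)
next
  case (Cons x y)
  obtain p q where b: "ts b = (p, q)" by (cases "ts b")
  have rd: "reads ts b \<in> {1, 2}" using Cons.prems(1) bit_symbol_cases[of x] by (auto simp: displays_Cons reads_def)
  have *: "counts (guess b I c e) F 2 (ts(b := (p + 1, q(p := s)))) (length y) (2 ^ length y * v)" for s
    using Cons.prems by (intro Cons.IH) (auto simp: displays_Cons displays_upd b)
  have ne: "(keep (reads ts))(b := (1, Right)) \<noteq> (keep (reads ts))(b := (2, Right))"
    by (auto simp: fun_eq_iff intro: exI[of _ b])
  have "counts (guess b I c e) F 2 ts (Suc (length y)) (2 ^ length y * v + 2 ^ length y * v)"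
    by (rule counts_step_two[where ?q1.0 = 2 and ?q2.0 = 2 and ?ws1.0 = "(keep (reads ts))(b := (1, Right))"
          and ?ws2.0 = "(keep (reads ts))(b := (2, Right))"])
      (use rd * ne in \<open>simp_all add: guess_def b\<close>)
  moreover have "2 ^ length y * v + 2 ^ length y * v = 2 ^ length (x # y) * v" by simp
  ultimately show ?case by (simp only: list.size add_0_right add_Suc_right)
qed


lemma guess_bit_ne:
  assumes "c \<notin> I"
  shows "guess_bit b I c rd 1 \<noteq> guess_bit b I c rd 2"
proof
  assume "guess_bit b I c rd 1 = guess_bit b I c rd 2"
  then have "guess_bit b I c rd 1 c = guess_bit b I c rd 2 c" by simp
  then show False using assms by (simp add: guess_bit_def)
qed

lemma perform_guess_bit:
  assumes "b \<notin> I" "c \<notin> I" "b \<noteq> c"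
  shows "perform (guess_bit b I c (reads ts) s) ts i =
    (if i \<in> I then act (2, Right) (ts i) else if i = c then act (s, Right) (ts c)
     else if i = b then (fst (ts b) + 1, snd (ts b)) else ts i)"
  using assms by (auto simp: perform_def guess_bit_def keep_def reads_def)

lemma counts_guess_1:
  assumes dist: "b \<notin> I" "c \<notin> I" "e \<notin> I" "distinct [b, c, e]"
    and "displays (ts b) y"
    and "\<And>m ts'. m \<le> length y \<Longrightarrow> guessed b I c e ts [] m ts' \<Longrightarrow> F ts' (v m)"
  shows "counts (guess b I c e) F 1 ts (length y) (\<Sum>m\<le>length y. 2 ^ (length y - m) * v m)"
  using assms(5,6)
proof (induction y arbitrary: ts v)
  case Nil
  have "F ts (v 0)" by (rule Nil.prems(2)) (simp_all add: guessed_def)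
  then show ?case using Nil.prems(1)
    by (intro counts.accept) (auto simp: guess_def displays_Nil reads_def)
next
  case (Cons x y)
  have rd: "reads ts b \<in> {1, 2}"
    using Cons.prems(1) bit_symbol_cases[of x] by (auto simp: displays_Cons reads_def)
  let ?as = "[(1 :: nat, guess_bit b I e (reads ts) 2), (2, (keep (reads ts))(b := (1, Right))),
    (2, (keep (reads ts))(b := (2, Right)))]"
  let ?n = "length y"
  let ?vs = "[\<Sum>m\<le>?n. 2 ^ (?n - m) * v (Suc m), 2 ^ ?n * v 0, 2 ^ ?n * v 0]"
  have mv: "moves (guess b I c e) 1 (reads ts) = set ?as"
    using rd by (auto simp: guess_def)
  have "(keep (reads ts))(b := (1, Right)) \<noteq> (keep (reads ts))(b := (2, Right))"
    by (auto dest: fun_upd_eqD)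
  then have "distinct ?as" by simp
  moreover
  have idle: "counts (guess b I c e) F 2 (ts(b := act (s, Right) (ts b))) ?n (2 ^ ?n * v 0)" for s
  proof (rule counts_guess_2)
    show "displays ((ts(b := act (s, Right) (ts b))) b) y"
      using Cons.prems(1) by (simp add: displays_Cons act_split displays_upd)
    fix ts' assume ts': "\<And>i. i \<noteq> b \<Longrightarrow> ts' i = (ts(b := act (s, Right) (ts b))) i"
    have "ts' i = ts i" if "i \<in> I" for i using ts'[of i] dist(1) that by auto
    then show "F ts' (v 0)"
      by (intro Cons.prems(2)) (use ts' dist in \<open>auto simp: guessed_def\<close>)
  qed
  let ?ts = "perform (guess_bit b I e (reads ts) 2) ts"
  have be: "b \<noteq> e" using dist by auto
  note pf = perform_guess_bit[OF dist(1,3) be]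
  have "counts (guess b I c e) F 1 ?ts ?n (\<Sum>m\<le>?n. 2 ^ (?n - m) * v (Suc m))"
  proof (rule Cons.IH)
    show "displays (?ts b) y"
      using Cons.prems(1) dist by (simp add: pf displays_Cons)
    fix m ts' assume m: "m \<le> ?n" and g: "guessed b I c e ?ts [] m ts'"
    have "guessed b I c e ts [] (Suc m) ts'"
      using g dist by (auto simp: guessed_def pf puts_act)
    then show "F ts' (v (Suc m))" using Cons.prems(2) m by simp
  qed
  ultimately have "counts (guess b I c e) F 1 ts (Suc ?n) (sum_list ?vs)"
    using idle by (intro counts_branch_list[OF mv]) simp_all
  \<comment> \<open>The two idle branches together are the term m = 0; the other branch is the rest
    of the sum with its index shifted by one.\<close>
  moreover have "sum_list ?vs = (\<Sum>m\<le>length (x # y). 2 ^ (length (x # y) - m) * v m)"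
    by (simp add: sum.atMost_Suc_shift del: sum.atMost_Suc)
  ultimately show ?case by (simp only: list.size add_0_right add_Suc_right)
qed

text \<open>The recursion peels off the first guessed bit. The sum collects the paths that guess no
  further bit: m of their steps extend the block and the power counts the idle guesses.\<close>

primrec guess_sum :: "nat \<Rightarrow> (bool list \<Rightarrow> nat \<Rightarrow> nat) \<Rightarrow> nat" where
  "guess_sum 0 v = v [] 0"
| "guess_sum (Suc n) v = (\<Sum>m\<le>Suc n. 2 ^ (Suc n - m) * v [] m) +
     guess_sum n (\<lambda>\<pi>. v (False # \<pi>)) + guess_sum n (\<lambda>\<pi>. v (True # \<pi>))"

lemma counts_guess:
  assumes dist: "b \<notin> I" "c \<notin> I" "e \<notin> I" "distinct [b, c, e]"
    and "displays (ts b) y"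
    and "\<And>\<pi> m ts'. length \<pi> + m \<le> length y \<Longrightarrow> guessed b I c e ts \<pi> m ts' \<Longrightarrow> F ts' (v \<pi> m)"
  shows "counts (guess b I c e) F 0 ts (length y) (guess_sum (length y) v)"
  using assms(5,6)
proof (induction y arbitrary: ts v)
  case Nil
  have "F ts (v [] 0)" by (rule Nil.prems(2)) (simp_all add: guessed_def)
  then show ?case using Nil.prems(1)
    by (simp, intro counts.accept) (auto simp: guess_def displays_Nil reads_def)
next
  case (Cons x y)
  have rd: "reads ts b \<in> {1, 2}"
    using Cons.prems(1) bit_symbol_cases[of x] by (auto simp: displays_Cons reads_def)
  let ?as = "[(0 :: nat, guess_bit b I c (reads ts) 1), (0, guess_bit b I c (reads ts) 2),
    (1, guess_bit b I e (reads ts) 2), (2, (keep (reads ts))(b := (1, Right))),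
    (2, (keep (reads ts))(b := (2, Right)))]"
  let ?n = "length y"
  let ?vs = "[guess_sum ?n (\<lambda>\<pi>. v (False # \<pi>)), guess_sum ?n (\<lambda>\<pi>. v (True # \<pi>)),
    \<Sum>m\<le>?n. 2 ^ (?n - m) * v [] (Suc m), 2 ^ ?n * v [] 0, 2 ^ ?n * v [] 0]"
  have mv: "moves (guess b I c e) 0 (reads ts) = set ?as"
    using rd by (auto simp: guess_def)
  have "(keep (reads ts))(b := (1, Right)) \<noteq> (keep (reads ts))(b := (2, Right))"
    by (auto dest: fun_upd_eqD)
  then have "distinct ?as" using guess_bit_ne[OF dist(2)] by simp
  moreover
  have idle: "counts (guess b I c e) F 2 (ts(b := act (s, Right) (ts b))) ?n (2 ^ ?n * v [] 0)" for s
  proof (rule counts_guess_2)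
    show "displays ((ts(b := act (s, Right) (ts b))) b) y"
      using Cons.prems(1) by (simp add: displays_Cons act_split displays_upd)
    fix ts' assume ts': "\<And>i. i \<noteq> b \<Longrightarrow> ts' i = (ts(b := act (s, Right) (ts b))) i"
    have "ts' i = ts i" if "i \<in> I" for i using ts'[of i] dist(1) that by auto
    then show "F ts' (v [] 0)"
      by (intro Cons.prems(2)) (use ts' dist in \<open>auto simp: guessed_def\<close>)
  qed
  have be: "b \<noteq> e" and bc: "b \<noteq> c" using dist by auto
  note pf = perform_guess_bit[OF dist(1,3) be] perform_guess_bit[OF dist(1,2) bc]
  let ?ts = "perform (guess_bit b I e (reads ts) 2) ts"
  have "counts (guess b I c e) F 1 ?ts ?n (\<Sum>m\<le>?n. 2 ^ (?n - m) * v [] (Suc m))"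
  proof (rule counts_guess_1[OF dist])
    show "displays (?ts b) y"
      using Cons.prems(1) dist by (simp add: pf displays_Cons)
    fix m ts' assume m: "m \<le> ?n" and g: "guessed b I c e ?ts [] m ts'"
    have "guessed b I c e ts [] (Suc m) ts'"
      using g dist by (auto simp: guessed_def pf puts_act)
    then show "F ts' (v [] (Suc m))" using Cons.prems(2)[of "[]" "Suc m"] m by simp
  qed
  moreover
  have bit: "counts (guess b I c e) F 0 (perform (guess_bit b I c (reads ts) (bit_symbol h)) ts) ?n
      (guess_sum ?n (\<lambda>\<pi>. v (h # \<pi>)))" for h
  proof (rule Cons.IH)
    let ?ts = "perform (guess_bit b I c (reads ts) (bit_symbol h)) ts"
    show "displays (?ts b) y"
      using Cons.prems(1) dist by (simp add: pf displays_Cons)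
    fix \<pi> m ts' assume m: "length \<pi> + m \<le> ?n" and g: "guessed b I c e ?ts \<pi> m ts'"
    have "guessed b I c e ts (h # \<pi>) m ts'"
      using g dist by (auto simp: guessed_def pf puts_act)
    then show "F ts' (v (h # \<pi>) m)" using Cons.prems(2)[of "h # \<pi>" m] m by simp
  qed
  ultimately have "counts (guess b I c e) F 0 ts (Suc ?n) (sum_list ?vs)"
    using idle bit[of False] bit[of True]
    by (intro counts_branch_list[OF mv]) (simp_all add: bit_symbol_def)
  moreover have "sum_list ?vs = guess_sum (length (x # y)) v"
    by (simp add: sum.atMost_Suc_shift del: sum.atMost_Suc)
  ultimately show ?case by (simp only: list.size add_0_right add_Suc_right)
qed

lemma finite_lists_le: "finite {xs :: bool list. length xs \<le> n}"
  using finite_lists_length_le[of "UNIV :: bool set" n] by simp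

text \<open>Each pair of a string and an m arises from a single sequence of proper guesses, followed
  by idle ones until the block is used up. This power of 2 brings the contributions of all lengths
  to a common denominator.\<close>

lemma guess_sum_eq:
  "guess_sum n v = (\<Sum>\<pi> | length \<pi> \<le> n. \<Sum>m\<le>n - length \<pi>. 2 ^ (n - length \<pi> - m) * v \<pi> m)"
proof (induction n arbitrary: v)
  case 0
  have "{\<pi> :: bool list. \<pi> = []} = {[]}" by auto
  then show ?case by simp
next
  case (Suc n)
  let ?g = "\<lambda>\<pi>. \<Sum>m\<le>Suc n - length \<pi>. 2 ^ (Suc n - length \<pi> - m) * v \<pi> m"
  let ?L = "{\<pi> :: bool list. length \<pi> \<le> n}"
  have split: "{\<pi> :: bool list. length \<pi> \<le> Suc n} = insert [] ((#) False ` ?L \<union> (#) True ` ?L)"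
  proof (intro set_eqI iffI)
    fix \<pi> :: "bool list" assume "\<pi> \<in> {\<pi>. length \<pi> \<le> Suc n}"
    then show "\<pi> \<in> insert [] ((#) False ` ?L \<union> (#) True ` ?L)"
      by (cases \<pi>; cases "hd \<pi>") auto
  qed auto
  have "sum ?g {\<pi>. length \<pi> \<le> Suc n} = ?g [] + (sum ?g ((#) False ` ?L) + sum ?g ((#) True ` ?L))"
    unfolding split
    using finite_lists_le[of n] by (subst sum.insert; (subst sum.union_disjoint)?) auto
  moreover have "sum ?g ((#) h ` ?L) = guess_sum n (\<lambda>\<pi>. v (h # \<pi>))" for h
    unfolding Suc.IH by (subst sum.reindex) (auto simp: inj_on_def)
  ultimately show ?case by simp
qed


subsection \<open>Copying and counting down\<close>

text \<open>The output of \<open>Mf\<close> may be surrounded by other symbols, whereas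
  \<open>count_down\<close> is analysed with blanks around its numeral; hence the copy on a fresh
  tape. The last step puts the heads on the last bit and on the last cell of the block.\<close>

definition copy_bits :: "nat \<Rightarrow> nat \<Rightarrow> nat \<Rightarrow> nat prog" where
  "copy_bits j e u = \<lparr>start = 0, states = {0, 1}, finals = {1}, moves = (\<lambda>q rd.
     if q = 0 then
       (if rd j \<in> {1, 2} then {(0, (keep rd)(j := (rd j, Right), e := (rd j, Right)))}
        else {(1, (keep rd)(e := (rd e, Left), u := (rd u, Left)))})
     else {})\<rparr>"

lemma counts_copy_bits:
  assumes dist: "distinct [j, e, u]" and "displays (ts j) y"
    and "F (ts(j := (fst (ts j) + int (length y), snd (ts j)),
        e := (fst (ts e) + int (length y) - 1, snd (puts (ts e) (map bit_symbol y))),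
        u := (fst (ts u) - 1, snd (ts u)))) v"
  shows "counts (copy_bits j e u) F 0 ts (Suc (length y)) v"
  using assms(2,3)
proof (induction y arbitrary: ts)
  case Nil
  let ?ws = "(keep (reads ts))(e := (reads ts e, Left), u := (reads ts u, Left))"
  have mv: "moves (copy_bits j e u) 0 (reads ts) = {(1, ?ws)}"
    using Nil.prems(1) by (simp add: copy_bits_def displays_Nil reads_def)
  have pf: "perform ?ws ts = ts(j := (fst (ts j) + int (length ([] :: bool list)), snd (ts j)),
        e := (fst (ts e) + int (length ([] :: bool list)) - 1, snd (puts (ts e) (map bit_symbol []))),
        u := (fst (ts u) - 1, snd (ts u)))"
    using dist by (auto simp: fun_eq_iff reads_def)
  have "counts (copy_bits j e u) F 1 (perform ?ws ts) 0 v"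
    unfolding pf
  proof (rule counts.accept)
    show "F (ts(j := (fst (ts j) + int (length ([] :: bool list)), snd (ts j)),
        e := (fst (ts e) + int (length ([] :: bool list)) - 1, snd (puts (ts e) (map bit_symbol []))),
        u := (fst (ts u) - 1, snd (ts u)))) v" by (rule Nil.prems(2))
  qed (simp_all add: copy_bits_def)
  from counts_step[OF mv this] show ?case by simp
next
  case (Cons b y)
  have b: "reads ts j = bit_symbol b" using Cons.prems(1) by (simp add: displays_Cons reads_def)
  let ?ws = "(keep (reads ts))(j := (reads ts j, Right), e := (reads ts j, Right))"
  let ?ts = "ts(j := (fst (ts j) + 1, snd (ts j)), e := act (bit_symbol b, Right) (ts e))"
  have mv: "moves (copy_bits j e u) 0 (reads ts) = {(0, ?ws)}"
    using b bit_symbol_cases[of b] by (auto simp: copy_bits_def)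
  have "act (reads ts j, Right) (ts j) = (fst (ts j) + 1, snd (ts j))" by (simp add: reads_def)
  then have pf: "perform ?ws ts = ?ts"
    using dist unfolding b[symmetric] by simp
  have pe: "fst (act (bit_symbol b, Right) (ts e)) = fst (ts e) + 1" by (simp add: act_split)
  have eq: "?ts(j := (fst (?ts j) + int (length y), snd (?ts j)),
        e := (fst (?ts e) + int (length y) - 1, snd (puts (?ts e) (map bit_symbol y))),
        u := (fst (?ts u) - 1, snd (?ts u)))
      = ts(j := (fst (ts j) + int (length (b # y)), snd (ts j)),
        e := (fst (ts e) + int (length (b # y)) - 1, snd (puts (ts e) (map bit_symbol (b # y)))),
        u := (fst (ts u) - 1, snd (ts u)))"
    using dist by (simp add: fun_eq_iff puts_act pe)
  have "counts (copy_bits j e u) F 0 ?ts (Suc (length y)) v"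
  proof (rule Cons.IH)
    show "displays (?ts j) y" using Cons.prems(1) dist by (simp add: displays_Cons)
  qed (simp only: eq Cons.prems(2))
  then show ?case using counts_step[OF mv] by (simp only: pf list.size add_0_right add_Suc_right)
qed

section \<open>Values of binary numerals, leading zeros allowed\<close>

definition binary_value :: "bool list \<Rightarrow> nat" where
  "binary_value = foldl (\<lambda>v b. 2 * v + of_bool b) 0"

lemma binary_value_snoc [simp]: "binary_value (x @ [b]) = 2 * binary_value x + of_bool b"
  by (simp add: binary_value_def)

lemma binary_value_Nil [simp]: "binary_value [] = 0"
  by (simp add: binary_value_def)

lemma binary_value_append: "binary_value (x @ y) = binary_value x * 2 ^ length y + binary_value y"
  by (induction y rule: rev_induct) (simp_all add: append_assoc[symmetric] algebra_simps del: append_assoc)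

lemma binary_value_binary [simp]: "binary_value (binary n) = n"
proof (induction n rule: binary.induct)
  case (1 n)
  then show ?case by (subst binary.simps) (simp add: mult_div_mod_eq mod_2_eq_odd[symmetric])
qed

lemma binary_value_zeros [simp]: "binary_value (replicate z False) = 0"
  by (induction z) (simp_all add: replicate_append_same[symmetric] del: replicate_append_same)

lemma binary_value_ones: "Suc (binary_value (replicate z True)) = 2 ^ z"
  by (induction z) (simp_all add: replicate_append_same[symmetric] del: replicate_append_same)

lemma binary_value_borrow:
  "binary_value (x @ True # replicate z False) = Suc (binary_value (x @ False # replicate z True))"
proof -
  have "binary_value (x @ True # replicate z False) = binary_value ((x @ [True]) @ replicate z False)"
    by simp
  also have "\<dots> = 2 * binary_value x * 2 ^ z + 2 ^ z"
    by (subst binary_value_append) (simp add: algebra_simps)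
  also have "\<dots> = Suc (binary_value ((x @ [False]) @ replicate z True))"
    by (subst binary_value_append) (simp add: binary_value_ones[symmetric])
  finally show ?thesis by simp
qed

text \<open>
  The program decrements the number on tape \<open>e\<close> once for each cell of the block on tape \<open>u\<close>, and
  accepts if a decrement fails because the number is 0.
\<close>

definition count_down :: "nat \<Rightarrow> nat \<Rightarrow> nat prog" where
  "count_down e u = \<lparr>start = 0, states = {0, 1, 2}, finals = {2}, moves = (\<lambda>q rd.
     if q = 0 then
       (if rd u = 0 then {}
        else if rd e = 1 then {(0, (keep rd)(e := (2, Left)))}
        else if rd e = 2 then {(1, (keep rd)(e := (1, Right)))}
        else {(2, keep rd)})
     else if q = 1 then
       (if rd e \<noteq> 0 then {(1, (keep rd)(e := (rd e, Right)))}
        else {(0, (keep rd)(e := (rd e, Left), u := (rd u, Left)))})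
     else {})\<rparr>"

lemma input_tape_upd:
  assumes "i < length x"
  shows "(snd (input_tape x))(int i := bit_symbol b) = snd (input_tape (x[i := b]))"
  using assms by (auto simp: input_tape_def fun_eq_iff nth_list_update)

lemma counts_count_down_return:
  assumes "e \<noteq> u" "ts e = (int (length x), snd (input_tape (x @ y)))"
    and "counts (count_down e u) F 0
      (ts(e := (int (length (x @ y)) - 1, snd (input_tape (x @ y))), u := (fst (ts u) - 1, snd (ts u)))) T v"
  shows "counts (count_down e u) F 1 ts (T + Suc (length y)) v"
  using assms(2,3)
proof (induction y arbitrary: x ts)
  case Nil
  let ?ws = "(keep (reads ts))(e := (reads ts e, Left), u := (reads ts u, Left))"
  have "reads ts e = 0" using Nil.prems(1) by (simp add: reads_def input_tape_def)
  then have mv: "moves (count_down e u) 1 (reads ts) = {(0, ?ws)}"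
    by (simp add: count_down_def)
  have pf: "perform ?ws ts = ts(e := (int (length (x @ [])) - 1, snd (input_tape (x @ []))), u := (fst (ts u) - 1, snd (ts u)))"
    using assms(1) Nil.prems(1) by (auto simp: fun_eq_iff reads_def)
  from counts_step[OF mv, unfolded pf, OF Nil.prems(2)] show ?case by simp
next
  case (Cons b y)
  let ?ws = "(keep (reads ts))(e := (reads ts e, Right))"
  let ?ts = "ts(e := (int (length x) + 1, snd (input_tape (x @ b # y))))"
  have "reads ts e = bit_symbol b" using Cons.prems(1) by (simp add: reads_def input_tape_def)
  then have mv: "moves (count_down e u) 1 (reads ts) = {(1, ?ws)}"
    by (simp add: count_down_def bit_symbol_def)
  have pf: "perform ?ws ts = ?ts"
    using Cons.prems(1) by (simp add: reads_def)
  have eq: "?ts(e := (int (length ((x @ [b]) @ y)) - 1, snd (input_tape ((x @ [b]) @ y))), u := (fst (?ts u) - 1, snd (?ts u)))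
    = ts(e := (int (length (x @ b # y)) - 1, snd (input_tape (x @ b # y))), u := (fst (ts u) - 1, snd (ts u)))"
    using assms(1) by (simp add: fun_eq_iff)
  have "counts (count_down e u) F 1 ?ts (T + Suc (length y)) v"
  proof (rule Cons.IH)
    show "?ts e = (int (length (x @ [b])), snd (input_tape ((x @ [b]) @ y)))" by simp
  qed (simp only: eq Cons.prems(2))
  then show ?case using counts_step[OF mv] by (simp only: pf list.size add_0_right add_Suc_right)
qed

text \<open>A sequence of m decrements fails exactly if the number is below m. In this way f n is
  compared with a block without being written in unary, where it could be exponentially long. A
  decrement passes over the numeral at most twice, whence the factor
  \<open>2 * length x + 3\<close>.\<close>

lemma counts_count_down:
  assumes "e \<noteq> u" "ts e = (int (length x) - 1, snd (input_tape x))"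
    and "fst (ts u) = int m - 1" "snd (ts u) (-1) = 0" "\<And>i. 0 \<le> i \<Longrightarrow> i < int m \<Longrightarrow> snd (ts u) i \<noteq> 0"
    and "\<And>ts'. (\<And>i. i \<noteq> e \<Longrightarrow> i \<noteq> u \<Longrightarrow> ts' i = ts i) \<Longrightarrow> F ts' v"
  shows "counts (count_down e u) F 0 ts ((m + 1) * (2 * length x + 3)) (if binary_value x < m then v else 0)"
  using assms(2-)
proof (induction m arbitrary: x ts)
  case 0
  have "moves (count_down e u) 0 (reads ts) = {}"
    using "0.prems"(2,3) by (simp add: count_down_def reads_def)
  then show ?case by (simp, intro counts.reject) (simp_all add: count_down_def)
next
  case (Suc m)
  \<comment> \<open>This is the state in the middle of a borrow: z trailing zeros have already
    become ones on the tape, while the number being decremented is still the one with the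
    zeros.\<close>
  have scan: "counts (count_down e u) F 0 ts' ((m + 1) * (2 * length (y @ replicate z True) + 3) + 2 * length y + z + 3)
      (if binary_value (y @ replicate z False) < Suc m then v else 0)"
    if "ts' e = (int (length y) - 1, snd (input_tape (y @ replicate z True)))"
      "\<And>i. i \<noteq> e \<Longrightarrow> ts' i = ts i" for y z ts'
    using that
  proof (induction y arbitrary: z ts' rule: rev_induct)
    case Nil
    have "reads ts' e = 0" "reads ts' u \<noteq> 0"
      using Nil.prems Suc.prems assms(1) by (simp_all add: reads_def input_tape_def)
    then have mv: "moves (count_down e u) 0 (reads ts') = {(2, keep (reads ts'))}"
      by (simp add: count_down_def)
    have "F ts' v" by (rule Suc.prems(5)) (rule Nil.prems(2))
    then have "counts (count_down e u) F 2 (perform (keep (reads ts')) ts')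
        ((m + 1) * (2 * length ([] @ replicate z True) + 3) + 2 * length ([] :: bool list) + z + 2) v"
      by (intro counts.accept) (simp_all add: count_down_def)
    from counts_step[OF mv this] show ?case by simp
  next
    case (snoc b y)
    have u: "reads ts' u \<noteq> 0"
      using snoc.prems Suc.prems assms(1) by (simp add: reads_def)
    have e: "reads ts' e = bit_symbol b"
      using snoc.prems(1) by (simp add: reads_def input_tape_def nth_append)
    show ?case
    proof (cases b)
      case False
      let ?ts = "ts'(e := (int (length y) - 1, snd (input_tape (y @ replicate (Suc z) True))))"
      have mv: "moves (count_down e u) 0 (reads ts') = {(0, (keep (reads ts'))(e := (2, Left)))}"
        using e u False by (simp add: count_down_def bit_symbol_def)
      have "(snd (input_tape ((y @ [b]) @ replicate z True)))(int (length y) := 2) =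
          snd (input_tape (y @ replicate (Suc z) True))"
        using input_tape_upd[of "length y" "(y @ [b]) @ replicate z True" True]
        by (simp add: bit_symbol_def)
      then have pf: "perform ((keep (reads ts'))(e := (2, Left))) ts' = ?ts"
        using snoc.prems(1) by simp
      have "counts (count_down e u) F 0 ?ts
          ((m + 1) * (2 * length (y @ replicate (Suc z) True) + 3) + 2 * length y + Suc z + 3)
          (if binary_value (y @ replicate (Suc z) False) < Suc m then v else 0)"
        using snoc.prems assms(1) by (intro snoc.IH) auto
      moreover have "y @ replicate (Suc z) False = (y @ [b]) @ replicate z False"
        using False by simp
      ultimately have "counts (count_down e u) F 0 ?ts
          ((m + 1) * (2 * length (y @ replicate (Suc z) True) + 3) + 2 * length y + Suc z + 3)
          (if binary_value ((y @ [b]) @ replicate z False) < Suc m then v else 0)"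
        by (simp only:)
      from counts_step[OF mv this[folded pf]] show ?thesis by (rule counts_mono) simp
    next
      case True
      let ?x = "y @ False # replicate z True"
      let ?ts = "ts'(e := (int (length (y @ [False])), snd (input_tape ((y @ [False]) @ replicate z True))))"
      let ?ts2 = "?ts(e := (int (length ((y @ [False]) @ replicate z True)) - 1,
        snd (input_tape ((y @ [False]) @ replicate z True))), u := (fst (?ts u) - 1, snd (?ts u)))"
      let ?v = "if binary_value ?x < m then v else 0"
      have mv: "moves (count_down e u) 0 (reads ts') = {(1, (keep (reads ts'))(e := (1, Right)))}"
        using e u True by (simp add: count_down_def bit_symbol_def)
      have "(snd (input_tape ((y @ [b]) @ replicate z True)))(int (length y) := 1) = snd (input_tape ?x)"
        using input_tape_upd[of "length y" "(y @ [b]) @ replicate z True" False]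
        by (simp add: bit_symbol_def)
      then have pf: "perform ((keep (reads ts'))(e := (1, Right))) ts' = ?ts"
        using snoc.prems(1) by (simp add: add.commute)
      have "counts (count_down e u) F 0 ?ts2 ((m + 1) * (2 * length ?x + 3)) ?v"
      proof (rule Suc.IH)
        fix us assume us: "\<And>i. i \<noteq> e \<Longrightarrow> i \<noteq> u \<Longrightarrow> us i = ?ts2 i"
        show "F us v" by (rule Suc.prems(5)) (use us snoc.prems(2) in simp)
      qed (use assms(1) snoc.prems(2) Suc.prems in simp_all)
      from counts_count_down_return[OF assms(1) _ this]
      have "counts (count_down e u) F 1 ?ts ((m + 1) * (2 * length ?x + 3) + Suc (length (replicate z True))) ?v"
        by simp
      from counts_step[OF mv this[folded pf]]
      have "counts (count_down e u) F 0 ts' (Suc ((m + 1) * (2 * length ?x + 3) + Suc (length (replicate z True)))) ?v" .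
      moreover have "?v = (if binary_value ((y @ [b]) @ replicate z False) < Suc m then v else 0)"
        using True binary_value_borrow[of y z] by simp
      ultimately have "counts (count_down e u) F 0 ts'
          (Suc ((m + 1) * (2 * length ?x + 3) + Suc (length (replicate z True))))
          (if binary_value ((y @ [b]) @ replicate z False) < Suc m then v else 0)" by (simp only:)
      then show ?thesis by (rule counts_mono) simp
    qed
  qed
  have "counts (count_down e u) F 0 ts ((m + 1) * (2 * length (x @ replicate 0 True) + 3) + 2 * length x + 0 + 3)
      (if binary_value (x @ replicate 0 False) < Suc m then v else 0)"
    using Suc.prems(1) by (intro scan) simp_all
  then have "counts (count_down e u) F 0 ts ((m + 1) * (2 * length x + 3) + 2 * length x + 3)
      (if binary_value x < Suc m then v else 0)" by simp
  then show ?case by (rule counts_mono) (simp add: algebra_simps)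
qed


subsection \<open>Comparing\<close>

text \<open>Comparability in the prefix order. Both directions occur, since w may be shorter or
  longer than the output.\<close>

definition agree :: "bool list \<Rightarrow> bool list \<Rightarrow> bool" where
  "agree x w \<longleftrightarrow> take (length w) x = take (length x) w"

lemma agree_simps [simp]:
  "agree [] w" "agree x []" "agree (a # x) (b # w) \<longleftrightarrow> a = b \<and> agree x w"
  by (auto simp: agree_def)

lemma displays_unique:
  assumes "displays t x" "displays t y"
  shows "x = y"
  using assms
proof (induction x arbitrary: y t)
  case Nil
  then show ?case by (cases y) (auto simp: displays_Nil displays_Cons bit_symbol_def split: if_splits)
next
  case (Cons a x)
  have head: "snd t (fst t) = bit_symbol a" and tail: "displays (fst t + 1, snd t) x"
    using Cons.prems(1) by (simp_all only: displays_Cons)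
  have "y \<noteq> []"
    using Cons.prems(2) head bit_symbol_cases[of a] by (metis displays_Nil insertI1 insertI2)
  then obtain b y' where y: "y = b # y'" by (cases y) simp_all
  have "snd t (fst t) = bit_symbol b" and tail': "displays (fst t + 1, snd t) y'"
    using Cons.prems(2) by (simp_all only: y displays_Cons)
  then have "a = b" using head by (cases a; cases b) (simp_all add: bit_symbol_def)
  moreover have "x = y'" by (rule Cons.IH[OF tail tail'])
  ultimately show ?case by (simp add: y)
qed

text \<open>
  The program accepts if the string on tape \<open>c\<close> has as many bits as tape \<open>l\<close> has cells in its block,
  and agrees with the string on tape 0. Each comparison with a bit of the latter doubles the number of paths.
\<close>

definition compare_bits :: "nat \<Rightarrow> nat \<Rightarrow> nat prog" where
  "compare_bits l c = \<lparr>start = 0, states = {0, 1}, finals = {1}, moves = (\<lambda>q rd.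
     if q \<noteq> 0 then {}
     else if rd l = 0 then (if rd c \<in> {1, 2} then {} else {(1, keep rd)})
     else if rd c \<notin> {1, 2} then {}
     else if rd 0 \<notin> {1, 2} then {(0, (keep rd)(c := (rd c, Right), l := (rd l, Right)))}
     else if rd 0 \<noteq> rd c then {}
     else {(0, (keep rd)(0 := (1, Right), c := (rd c, Right), l := (rd l, Right))),
       (0, (keep rd)(0 := (2, Right), c := (rd c, Right), l := (rd l, Right)))})\<rparr>"

definition matches :: "tape \<Rightarrow> nat \<Rightarrow> bool list \<Rightarrow> bool" where
  "matches t n w \<longleftrightarrow> (\<exists>x. length x = n \<and> displays t x \<and> agree x w)"

lemma matches_0: "matches t 0 w \<longleftrightarrow> snd t (fst t) \<notin> {1, 2}"
  by (auto simp: matches_def displays_Nil)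

lemma matches_Suc_Nil:
  "matches t (Suc n) [] \<longleftrightarrow> snd t (fst t) \<in> {1, 2} \<and> matches (fst t + 1, snd t) n []"
proof
  assume "matches t (Suc n) []"
  then obtain b x where "length x = n" "snd t (fst t) = bit_symbol b" "displays (fst t + 1, snd t) x"
    by (auto simp: matches_def length_Suc_conv displays_Cons)
  then show "snd t (fst t) \<in> {1, 2} \<and> matches (fst t + 1, snd t) n []"
    using bit_symbol_cases[of b] by (auto simp: matches_def)
next
  assume *: "snd t (fst t) \<in> {1, 2} \<and> matches (fst t + 1, snd t) n []"
  then have "snd t (fst t) \<in> range bit_symbol" by (simp add: range_bit_symbol)
  then obtain b where "snd t (fst t) = bit_symbol b" by blast
  moreover obtain x where "length x = n" "displays (fst t + 1, snd t) x"
    using * by (auto simp: matches_def)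
  ultimately show "matches t (Suc n) []"
    by (auto simp: matches_def displays_Cons intro!: exI[of _ "b # x"])
qed

lemma matches_Suc_Cons:
  "matches t (Suc n) (b # w) \<longleftrightarrow> snd t (fst t) = bit_symbol b \<and> matches (fst t + 1, snd t) n w"
proof
  assume "matches t (Suc n) (b # w)"
  then show "snd t (fst t) = bit_symbol b \<and> matches (fst t + 1, snd t) n w"
    by (auto simp: matches_def length_Suc_conv displays_Cons)
next
  assume *: "snd t (fst t) = bit_symbol b \<and> matches (fst t + 1, snd t) n w"
  then obtain x where "length x = n" "displays (fst t + 1, snd t) x" "agree x w"
    by (auto simp: matches_def)
  then show "matches t (Suc n) (b # w)"
    using * by (auto simp: matches_def displays_Cons intro!: exI[of _ "b # x"])
qed

text \<open>The number of paths doubles at each of the first min(|w|, n) positions, like a stake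
  along w. The two branches differ in the symbol they write on a cell of tape 0 that the head leaves
  behind.\<close>

lemma counts_compare_bits:
  assumes dist: "distinct [0, l, c]"
    and "displays (ts 0) w"
    and "\<And>i. i < n \<Longrightarrow> snd (ts l) (fst (ts l) + int i) \<noteq> 0" "snd (ts l) (fst (ts l) + int n) = 0"
    and F: "\<And>ts'. F ts' (1 :: nat)"
  shows "counts (compare_bits l c) F 0 ts (Suc n)
    (if matches (ts c) n w then 2 ^ min (length w) n else 0)"
  using assms(2-4)
proof (induction n arbitrary: w ts)
  case 0
  have l: "reads ts l = 0" using "0.prems"(3) by (simp add: reads_def)
  show ?case
  proof (cases "reads ts c \<in> {1, 2}")
    case True
    then have "moves (compare_bits l c) 0 (reads ts) = {}"
      using l by (simp add: compare_bits_def)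
    moreover have "\<not> matches (ts c) 0 w" using True by (simp add: matches_0 reads_def)
    ultimately show ?thesis by (simp, intro counts.reject) (simp_all add: compare_bits_def)
  next
    case False
    then have mv: "moves (compare_bits l c) 0 (reads ts) = {(1, keep (reads ts))}"
      using l by (simp add: compare_bits_def)
    have "counts (compare_bits l c) F 1 (perform (keep (reads ts)) ts) 0 1"
      using F by (intro counts.accept) (simp_all add: compare_bits_def)
    from counts_step[OF mv this] show ?thesis using False by (simp add: matches_0 reads_def)
  qed
next
  case (Suc n)
  have l: "reads ts l \<noteq> 0" using Suc.prems(2)[of 0] by (simp add: reads_def)
  have next_l: "snd (ts l) (fst (ts l) + 1 + int i) \<noteq> 0" if "i < n" for i
    using Suc.prems(2)[of "Suc i"] that by (simp add: algebra_simps)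
  have end_l: "snd (ts l) (fst (ts l) + 1 + int n) = 0"
    using Suc.prems(3) by (simp add: algebra_simps)
  show ?case
  proof (cases "reads ts c \<in> {1, 2}")
    case False
    then have "moves (compare_bits l c) 0 (reads ts) = {}"
      using l by (simp add: compare_bits_def)
    moreover have "\<not> matches (ts c) (Suc n) w"
    proof (cases w)
      case (Cons a w')
      then show ?thesis using False bit_symbol_cases[of a] by (auto simp: matches_Suc_Cons reads_def)
    qed (use False in \<open>simp add: matches_Suc_Nil reads_def\<close>)
    ultimately show ?thesis by (simp, intro counts.reject) (simp_all add: compare_bits_def)
  next
    case c: True
    let ?ts = "ts(c := (fst (ts c) + 1, snd (ts c)), l := (fst (ts l) + 1, snd (ts l)))"
    show ?thesis
    proof (cases w)
      case Nil
      let ?ws = "(keep (reads ts))(c := (reads ts c, Right), l := (reads ts l, Right))"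
      have "reads ts 0 \<notin> {1, 2}"
        using Suc.prems(1) Nil by (simp add: displays_Nil reads_def)
      then have mv: "moves (compare_bits l c) 0 (reads ts) = {(0, ?ws)}"
        using l c by (simp add: compare_bits_def)
      have pf: "perform ?ws ts = ?ts" using dist by (simp add: reads_def)
      have "counts (compare_bits l c) F 0 ?ts (Suc n)
          (if matches (?ts c) n [] then 2 ^ min (length ([] :: bool list)) n else 0)"
        by (rule Suc.IH) (use Suc.prems(1) dist next_l end_l Nil in simp_all)
      from counts_step[OF mv this[folded pf]] show ?thesis
        using c dist by (cases "matches (fst (ts c) + 1, snd (ts c)) n []")
          (simp_all add: matches_Suc_Nil Nil reads_def pf)
    next
      case (Cons b w')
      have b: "reads ts 0 = bit_symbol b" "displays (fst (ts 0) + 1, snd (ts 0)) w'"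
        using Suc.prems(1) Cons by (simp_all add: displays_Cons reads_def)
      show ?thesis
      proof (cases "reads ts 0 = reads ts c")
        case False
        then have "moves (compare_bits l c) 0 (reads ts) = {}"
          using l c b(1) bit_symbol_cases[of b] by (auto simp: compare_bits_def)
        moreover have "\<not> matches (ts c) (Suc n) w"
          using False b(1) by (simp add: Cons matches_Suc_Cons reads_def)
        ultimately show ?thesis by (simp, intro counts.reject) (simp_all add: compare_bits_def)
      next
        case True
        let ?ws = "\<lambda>s. (keep (reads ts))(0 := (s, Right), c := (reads ts c, Right), l := (reads ts l, Right))"
        let ?v = "if matches (fst (ts c) + 1, snd (ts c)) n w' then 2 ^ min (length w') n else 0"
        have mv: "moves (compare_bits l c) 0 (reads ts) = {(0, ?ws 1), (0, ?ws 2)}"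
          using l c True by (auto simp: compare_bits_def)
        have "?ws 1 \<noteq> ?ws 2"
        proof
          assume "?ws 1 = ?ws 2"
          then have "?ws 1 0 = ?ws 2 0" by (rule fun_cong)
          then show False using dist by simp
        qed
        then have ne: "(0 :: nat, ?ws 1) \<noteq> (0, ?ws 2)" by simp
        have "counts (compare_bits l c) F 0 (perform (?ws s) ts) (Suc n) ?v" for s
        proof -
          have pf: "perform (?ws s) ts = ?ts(0 := act (s, Right) (ts 0))"
            using dist by (auto simp: reads_def fun_eq_iff)
          have "counts (compare_bits l c) F 0 (?ts(0 := act (s, Right) (ts 0))) (Suc n)
            (if matches ((?ts(0 := act (s, Right) (ts 0))) c) n w' then 2 ^ min (length w') n else 0)"
            by (rule Suc.IH) (use b(2) dist next_l end_l in \<open>simp_all add: act_split displays_upd\<close>)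
          then show ?thesis unfolding pf using dist by simp
        qed
        from counts_step_two[OF mv ne this this]
        show ?thesis using True b(1)
          by (simp add: Cons matches_Suc_Cons reads_def mult_2 split: if_splits)
      qed
    qed
  qed
qed

subsection \<open>Writing a power of 2\<close>

text \<open>Symbol 2 is the bit 1 and symbol 1 is the bit 0, so the string written is the numeral of
  a power of 2.\<close>

definition write_power :: "nat \<Rightarrow> nat prog" where
  "write_power b = \<lparr>start = 0, states = {0, 1}, finals = {1}, moves = (\<lambda>q rd.
     if q = 0 then {(1, (keep rd)(1 := (2, Right)))}
     else if rd b \<in> {1, 2} then {(1, (keep rd)(1 := (1, Right), b := (rd b, Right)))}
     else {})\<rparr>"

lemma counts_write_power_1:
  assumes "b \<noteq> 1" "displays (ts b) y"
    and "\<And>ts' :: tapes. ts' 1 = puts (ts 1) (replicate (length y) 1) \<Longrightarrow> F ts' v"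
  shows "counts (write_power b) F 1 ts (length y) v"
  using assms(2,3)
proof (induction y arbitrary: ts)
  case Nil
  then show ?case by (intro counts.accept) (auto simp: write_power_def displays_Nil reads_def)
next
  case (Cons x y)
  let ?ws = "(keep (reads ts))(1 := (1, Right), b := (reads ts b, Right))"
  let ?ts = "ts(1 := act (1, Right) (ts 1), b := (fst (ts b) + 1, snd (ts b)))"
  have "reads ts b \<in> {1, 2}"
    using Cons.prems(1) bit_symbol_cases[of x] by (auto simp: displays_Cons reads_def)
  then have mv: "moves (write_power b) 1 (reads ts) = {(1, ?ws)}"
    by (simp add: write_power_def)
  have pf: "perform ?ws ts = ?ts" using assms(1) by (auto simp: reads_def fun_eq_iff)
  have "counts (write_power b) F 1 ?ts (length y) v"
  proof (rule Cons.IH)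
    show "displays (?ts b) y" using Cons.prems(1) by (simp add: displays_Cons)
    fix ts' :: tapes assume "ts' 1 = puts (?ts 1) (replicate (length y) 1)"
    then show "F ts' v" using assms(1) by (intro Cons.prems(2)) (simp add: puts_act)
  qed
  from counts_step[OF mv this[folded pf]] show ?case by simp
qed

lemma counts_write_power:
  assumes "b \<noteq> 1" "displays (ts b) y"
    and "\<And>ts' :: tapes. ts' 1 = puts (ts 1) (2 # replicate (length y) 1) \<Longrightarrow> F ts' v"
  shows "counts (write_power b) F 0 ts (Suc (length y)) v"
proof -
  have mv: "moves (write_power b) 0 (reads ts) = {(1, (keep (reads ts))(1 := (2, Right)))}"
    by (simp add: write_power_def)
  have "counts (write_power b) F 1 (perform ((keep (reads ts))(1 := (2, Right))) ts) (length y) v"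
  proof (rule counts_write_power_1[OF assms(1)])
    show "displays (perform ((keep (reads ts))(1 := (2, Right))) ts b) y"
      using assms(1,2) by simp
    fix ts' :: tapes assume "ts' 1 = puts (perform ((keep (reads ts))(1 := (2, Right))) ts 1) (replicate (length y) 1)"
    then show "F ts' v" by (intro assms(3)) (simp add: puts_act)
  qed
  from counts_step[OF mv this] show ?thesis .
qed

lemma binary_power_2: "binary (2 ^ n) = True # replicate n False"
proof (induction n)
  case 0
  have "binary 1 = binary 0 @ [True]" by (subst binary.simps) simp
  also have "binary 0 = []" by (subst binary.simps) simp
  finally show ?case by simp
next
  case (Suc n)
  have "binary (2 ^ Suc n) = binary (2 ^ n) @ [False]" by (subst binary.simps) simp
  then show ?case using Suc.IH by (simp add: replicate_append_same)
qed

subsection \<open>Well-formedness\<close>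

lemma well_formedI:
  assumes "finite (states A)" "start A \<in> states A"
    and "\<And>q rd a i. q \<in> states A \<Longrightarrow> (\<And>i. rd i < s) \<Longrightarrow> a \<in> moves A q rd \<Longrightarrow> fst a \<in> states A"
    and "\<And>q rd a i. q \<in> states A \<Longrightarrow> (\<And>i. rd i < s) \<Longrightarrow> a \<in> moves A q rd \<Longrightarrow> i < k \<Longrightarrow> fst (snd a i) < s"
    and "\<And>q rd a i. q \<in> states A \<Longrightarrow> a \<in> moves A q rd \<Longrightarrow> k \<le> i \<Longrightarrow> snd a i = keep rd i"
  shows "well_formed k s A"
  unfolding well_formed_def
proof (intro conjI ballI allI impI)
  fix q rd a assume *: "q \<in> states A" "\<forall>i. rd i < s" "a \<in> moves A q rd"
  then have "fst a \<in> states A" "\<forall>i<k. fst (snd a i) < s" "\<forall>i\<ge>k. snd a i = keep rd i"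
    using assms(3-) by blast+
  then show "case a of (q', ws) \<Rightarrow> q' \<in> states A \<and> (\<forall>i<k. fst (ws i) < s) \<and> (\<forall>i\<ge>k. ws i = keep rd i)"
    by (cases a) simp
qed (fact assms(1,2))+

lemma well_formed_split_input: "0 < k \<Longrightarrow> a < k \<Longrightarrow> 3 \<le> s \<Longrightarrow> well_formed k s (split_input a)"
  by (rule well_formedI) (auto simp: split_input_def keep_def split: if_splits)

lemma well_formed_rewind: "I \<subseteq> {..<k} \<Longrightarrow> well_formed k s (rewind I i)"
  by (rule well_formedI) (auto simp: rewind_def move_def keep_def split: if_splits)

lemma well_formed_guess:
  "I \<subseteq> {..<k} \<Longrightarrow> b < k \<Longrightarrow> c < k \<Longrightarrow> e < k \<Longrightarrow> 3 \<le> s \<Longrightarrow> well_formed k s (guess b I c e)"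
  by (rule well_formedI) (auto simp: guess_def guess_bit_def keep_def split: if_splits)

lemma well_formed_copy_bits: "e < k \<Longrightarrow> j < k \<Longrightarrow> u < k \<Longrightarrow> well_formed k s (copy_bits j e u)"
  by (rule well_formedI) (auto simp: copy_bits_def keep_def split: if_splits)

lemma well_formed_count_down: "e < k \<Longrightarrow> u < k \<Longrightarrow> 3 \<le> s \<Longrightarrow> well_formed k s (count_down e u)"
  by (rule well_formedI) (auto simp: count_down_def keep_def split: if_splits)

lemma well_formed_compare_bits:
  "0 < k \<Longrightarrow> l < k \<Longrightarrow> c < k \<Longrightarrow> 3 \<le> s \<Longrightarrow> well_formed k s (compare_bits l c)"
  by (rule well_formedI) (auto simp: compare_bits_def keep_def split: if_splits)

lemma well_formed_write_power: "1 < k \<Longrightarrow> b < k \<Longrightarrow> 3 \<le> s \<Longrightarrow> well_formed k s (write_power b)"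
  by (rule well_formedI) (auto simp: write_power_def keep_def split: if_splits)

lemma deterministic_elementary:
  "deterministic (split_input a)" "deterministic (rewind I i)" "deterministic (write_power b)"
  by (auto simp: deterministic_def split_input_def rewind_def write_power_def split: if_splits)

section \<open>The counting machine\<close>

lemma prints_within_mono: "prints_within M x y t \<Longrightarrow> t \<le> t' \<Longrightarrow> prints_within M x y t'"
  unfolding prints_within_def by (meson le_trans)

lemma map_bit_symbol_unary [simp]: "map bit_symbol (unary n) = replicate n 2"
  by (simp add: unary_def bit_symbol_def)

lemma length_unary [simp]: "length (unary n) = n"
  by (simp add: unary_def)

lemma snd_unary_tape: "snd (input_tape (unary n)) = (\<lambda>i. if 0 \<le> i \<and> i < int n then 2 else 0)"
  by (auto simp: input_tape_def unary_def bit_symbol_def fun_eq_iff)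

lemma input_tape_unary: "input_tape (unary n) = (0, \<lambda>i. if 0 \<le> i \<and> i < int n then 2 else 0)"
  by (simp add: prod_eq_iff snd_unary_tape) (simp add: input_tape_def)

lemma puts_blank_twos: "puts blank_tape (replicate n 2) = (int n, snd (input_tape (unary n)))"
  using puts_blank[of "unary n"] by simp

lemma input_tape_eq: "input_tape x = (0, snd (input_tape x))"
  by (simp add: input_tape_def)

lemma start_elementary:
  "start (split_input a) = 0" "start (guess b I c e) = 0" "start (copy_bits j e u) = 0"
  "start (count_down e u) = 0" "start (compare_bits l c) = 0" "start (write_power b) = 0"
  by (simp_all add: split_input_def guess_def copy_bits_def count_down_def compare_bits_def write_power_def)

text \<open>
  The machine \<open>Mm\<close> computes the modulus of convergence \<open>m\<close>, and \<open>Mf\<close> computes \<open>f\<close>. Tape 0 holds the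
  input, tapes 2, 3 and 4 are the shadow tapes of \<open>Mm\<close>, \<open>Mf\<close> and \<open>U\<close>, tape 5 holds the guessed length
  \<open>n\<close>, tape 1 the difference of \<open>n\<close> and the length of the guessed program, and tape 6 a copy of
  \<open>f n\<close>. The tapes from 7 onwards belong to \<open>Mm\<close>, \<open>Mf\<close>, \<open>U\<close> and the clock, in this order.
\<close>

locale counting =
  fixes Mm Mf U :: machine and clock :: nat and m f tm tf :: "nat \<Rightarrow> nat"
  assumes dtm_Mm: "dtm Mm" and dtm_Mf: "dtm Mf" and dtm_U: "dtm U"
    and Mm: "\<And>i. prints_within Mm (unary i) (unary (m i)) (tm i)"
    and Mf: "\<And>n. prints_within Mf (unary n) (binary (f n)) (tf n)"
    and mono_tm: "mono tm" and mono_tf: "mono tf"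
begin

definition off_f :: nat where "off_f = 7 + num_tapes Mm"
definition off_U :: nat where "off_U = off_f + num_tapes Mf"
definition off_c :: nat where "off_c = off_U + num_tapes U"

text \<open>Afterwards the head of tape 0 is at the first bit of w, and tape 8, the output tape of
  \<open>Mm\<close>, holds the cutoff N in unary. The machine for the numerator and the one for the
  denominator 2^N share this phase.\<close>

definition prepare :: "(nat + nat + nat + run_state) prog" where
  "prepare = seq (split_input 7) (seq (rewind {0} 0) (seq (rewind {7} 7) (run Mm 7 2)))"

definition U_tapes :: "nat set" where
  "U_tapes = insert 4 {off_U..<off_U + num_tapes U}"

text \<open>A block of n cells is needed for checking the output length, as the input of
  \<open>Mf\<close> and for each digit of the clock; all of them are written while n is being
  guessed.\<close>

definition length_tapes :: "nat set" where
  "length_tapes = {5, off_f} \<union> {off_c..<off_c + clock}"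

definition run_U :: "(run_state \<times> (bool \<times> bool) list) prog" where
  "run_U = timed (run U off_U 4) U_tapes off_c clock"

text \<open>The clock tapes are deliberately not rewound: the odometer starts with its heads behind
  the blocks.\<close>

definition verify where
  "verify = seq (rewind {5, off_f} 5) (seq (rewind {off_U} off_U) (seq (run Mf off_f 3)
     (seq (copy_bits (Suc off_f) 6 1) (seq (count_down 6 1)
       (seq run_U (compare_bits 5 (Suc off_U)))))))"

text \<open>With n guessed as |\<pi>| + l, and l kept on tape 1, the condition |\<pi>| + f n < n
  becomes f n < l, a comparison of a numeral with a block.\<close>

definition count_all where
  "count_all = seq prepare (seq (guess 8 length_tapes off_U 1) verify)"

definition compute_power where
  "compute_power = seq prepare (write_power 8)"

definition program_tapes :: "bool list \<Rightarrow> tapes" where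
  "program_tapes \<pi> = (\<lambda>_. blank_tape)(off_U := input_tape \<pi>)"

text \<open>The fuel is fixed by n, and the tapes of \<open>U\<close> hold nothing but the program
  at the start. So the set of accepted programs is the same for all precisions r and all
  cutoffs.\<close>

definition accepts :: "nat \<Rightarrow> bool list \<Rightarrow> bool list \<Rightarrow> bool" where
  "accepts n \<pi> w \<longleftrightarrow> (\<exists>us. outcome ((n + 2) ^ clock - 1) (run U off_U 4) Launch (program_tapes \<pi>) = Some us \<and>
     matches (us (Suc off_U)) n w)"

definition weight :: "bool list \<Rightarrow> bool list \<Rightarrow> nat \<Rightarrow> nat" where
  "weight w \<pi> l = (if f (length \<pi> + l) < l \<and> accepts (length \<pi> + l) \<pi> w
     then 2 ^ min (length w) (length \<pi> + l) else 0)"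

lemma tapes_ge_2: "2 \<le> num_tapes Mm" "2 \<le> num_tapes Mf" "2 \<le> num_tapes U"
  using dtm_Mm dtm_Mf dtm_U by (simp_all add: dtm_def ntm_def)

lemma offsets: "9 \<le> off_f" "off_f + 2 \<le> off_U" "off_U + 2 \<le> off_c"
  using tapes_ge_2 by (simp_all add: off_f_def off_U_def off_c_def)

lemma m_le: "m i \<le> tm i"
  using prints_within_length[OF dtm_Mm Mm[of i]] by simp

lemma length_f_le: "length (binary (f n)) \<le> tf n"
  by (rule prints_within_length[OF dtm_Mf Mf])

lemma counts_prepare:
  assumes F: "\<And>ts. displays (ts 0) w \<Longrightarrow> displays (ts 8) (unary (m (r + length w))) \<Longrightarrow>
      (\<And>i. i \<notin> {0, 2} \<Longrightarrow> i < 7 \<or> off_f \<le> i \<Longrightarrow> ts i = blank_tape) \<Longrightarrow> F ts v"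
  shows "counts prepare F (start prepare) (input_tapes (replicate r True @ False # w))
    (3 * (r + length w) + 2 * tm (r + length w) + 20) v"
proof -
  let ?x = "replicate r True @ False # w" and ?k = "r + length w"
  let ?c = "(snd (input_tape ?x))(int r := 0)"
  define ts1 where "ts1 = (input_tapes ?x)(0 := (int r + 1 + int (length w), ?c), 7 := puts blank_tape (replicate ?k 2))"
  define ts2 where "ts2 = shift {0} (- int (length w)) ts1"
  define ts3 where "ts3 = shift {7} (- int ?k) ts2"
  have c: "?c (int r + 1 + int i) = bit_symbol (w ! i)" if "i < length w" for i
  proof -
    have "nat (int r + 1 + int i) = Suc (r + i)" by simp
    then show ?thesis using that by (simp add: input_tape_def nth_append)
  qed
  have ts1_7: "ts1 7 = (int ?k, snd (input_tape (unary ?k)))"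
    by (simp only: ts1_def fun_upd_same puts_blank_twos)
  have ts1: "ts1 0 = (int r + 1 + int (length w), ?c)" "ts1 i = blank_tape" if "i \<noteq> 0" "i \<noteq> 7" for i
    using that by (simp_all add: ts1_def input_tapes_def)
  have ts1_0: "ts1 0 = (int r + 1 + int (length w), ?c)" by (simp add: ts1_def)
  have ts3_0: "displays (ts3 0) w"
    using c by (auto simp: ts3_def ts2_def shift_def ts1_0 displays_def input_tape_def)
  have ts3_7: "ts3 7 = input_tape (unary ?k)"
    by (simp add: ts3_def ts2_def shift_def ts1_7 input_tape_eq[symmetric])
  have ts3: "ts3 i = blank_tape" if "i \<noteq> 0" "i \<noteq> 7" for i
    using that by (simp add: ts3_def ts2_def shift_def ts1)
  obtain ts4 where ts4: "outcome (2 * tm ?k + 3) (run Mm 7 2) (start (run Mm 7 2)) ts3 = Some ts4"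
    "\<And>i. (i < 7 \<or> off_f \<le> i) \<and> i \<noteq> 2 \<Longrightarrow> ts4 i = ts3 i" "displays (ts4 8) (unary (m ?k))"
  proof -
    have "\<exists>ts'. outcome (2 * tm ?k + 3) (run Mm 7 2) (start (run Mm 7 2)) ts3 = Some ts' \<and>
        (\<forall>i. (i < 7 \<or> 7 + num_tapes Mm \<le> i) \<and> i \<noteq> 2 \<longrightarrow> ts' i = ts3 i) \<and>
        fst (ts' (Suc 7)) = 0 \<and> displays (ts' (Suc 7)) (unary (m ?k))"
      by (rule outcome_run[OF dtm_Mm _ Mm]) (use ts3 ts3_7 in simp_all)
    then show ?thesis using that unfolding off_f_def by auto
  qed
  have "F ts4 v"
  proof (rule F)
    show "displays (ts4 0) w" using ts4(2)[of 0] ts3_0 by simp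
    show "ts4 i = blank_tape" if "i \<notin> {0, 2}" "i < 7 \<or> off_f \<le> i" for i
      using ts4(2)[of i] ts3[of i] that offsets(1) by auto
  qed (rule ts4(3))
  then have run: "counts (run Mm 7 2) F (start (run Mm 7 2)) ts3 (2 * tm ?k + 3) v"
    by (rule counts_outcome[OF deterministic_run[OF dtm_Mm] ts4(1)])
  have "counts (rewind {7} 7) (\<lambda>ts v. counts (run Mm 7 2) F (start (run Mm 7 2)) ts (2 * tm ?k + 3) v)
      (start (rewind {7} 7)) ts2 (?k + 2) v"
  proof (rule counts_rewind)
    show "counts (run Mm 7 2) F (start (run Mm 7 2)) (shift {7} (- int ?k) ts2) (2 * tm ?k + 3) v"
      using run by (simp only: ts3_def)
  qed (auto simp: ts2_def shift_def ts1_7 snd_unary_tape)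
  from counts_seq_start[OF this]
  have rew: "counts (seq (rewind {7} 7) (run Mm 7 2)) F (start (seq (rewind {7} 7) (run Mm 7 2))) ts2
      (?k + 2 + Suc (2 * tm ?k + 3)) v" .
  have "counts (rewind {0} 0) (\<lambda>ts v. counts (seq (rewind {7} 7) (run Mm 7 2)) F
      (start (seq (rewind {7} 7) (run Mm 7 2))) ts (?k + 2 + Suc (2 * tm ?k + 3)) v)
      (start (rewind {0} 0)) ts1 (length w + 2) v"
  proof (rule counts_rewind)
    fix l assume l: "1 \<le> l" "l \<le> length w"
    have "?c (int r + 1 + int (length w - l)) \<noteq> 0"
      using c[of "length w - l"] l by (simp add: bit_symbol_def)
    then show "snd (ts1 0) (fst (ts1 0) - int l) \<noteq> 0"
      using l by (simp add: ts1_0 of_nat_diff algebra_simps)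
  next
    show "counts (seq (rewind {7} 7) (run Mm 7 2)) F (start (seq (rewind {7} 7) (run Mm 7 2)))
      (shift {0} (- int (length w)) ts1) (?k + 2 + Suc (2 * tm ?k + 3)) v"
      using rew by (simp only: ts2_def)
  qed (auto simp: ts1_0)
  from counts_seq_start[OF this]
  have rew0: "counts (seq (rewind {0} 0) (seq (rewind {7} 7) (run Mm 7 2))) F
    (start (seq (rewind {0} 0) (seq (rewind {7} 7) (run Mm 7 2)))) ts1
      (length w + 2 + Suc (?k + 2 + Suc (2 * tm ?k + 3))) v" .
  have disp: "displays (input_tapes ?x 0) ?x" by (simp add: input_tapes_def displays_input_tape)
  have eq: "(input_tapes ?x)(0 := (fst (input_tapes ?x 0) + int r + 1 + int (length w),
      (snd (input_tapes ?x 0))(fst (input_tapes ?x 0) + int r := 0)),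
      7 := puts (input_tapes ?x 7) (replicate (r + length w) 2)) = ts1"
    by (simp add: ts1_def input_tapes_def input_tape_def)
  have "counts (split_input 7) (\<lambda>ts v. counts (seq (rewind {0} 0) (seq (rewind {7} 7) (run Mm 7 2))) F
    (start (seq (rewind {0} 0) (seq (rewind {7} 7) (run Mm 7 2)))) ts
      (length w + 2 + Suc (?k + 2 + Suc (2 * tm ?k + 3))) v) 0 (input_tapes ?x) (Suc ?k) v"
  proof (rule counts_split_input)
    show "displays (input_tapes ?x 0) ?x" by (rule disp)
  qed (simp, subst eq, rule rew0)
  then have "counts (split_input 7) (\<lambda>ts v. counts (seq (rewind {0} 0) (seq (rewind {7} 7) (run Mm 7 2))) F
    (start (seq (rewind {0} 0) (seq (rewind {7} 7) (run Mm 7 2)))) ts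
      (length w + 2 + Suc (?k + 2 + Suc (2 * tm ?k + 3))) v) (start (split_input 7)) (input_tapes ?x) (Suc ?k) v"
    by (simp only: start_elementary)
  from counts_seq_start[OF this] show ?thesis
    unfolding prepare_def by (rule counts_mono) simp
qed

lemma counts_prepare_no_separator:
  "counts prepare F (start prepare) (input_tapes (replicate r True)) (r + 1) 0"
proof -
  have "displays (input_tapes (replicate r True) 0) (replicate r True)"
    by (simp add: input_tapes_def displays_input_tape)
  then have "counts (split_input 7) G (start (split_input 7)) (input_tapes (replicate r True)) r 0" for G
    unfolding start_elementary by (intro counts_split_input_no_separator) simp_all
  from counts_seq_start[OF this, where T' = 0] show ?thesis
    unfolding prepare_def by simp
qed

section \<open>Correctness of the check of a guess\<close>

definition ready :: "nat \<Rightarrow> bool list \<Rightarrow> bool list \<Rightarrow> tapes \<Rightarrow> bool" where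
  "ready n \<pi> w ts \<longleftrightarrow> displays (ts 0) w \<and> ts 5 = input_tape (unary n) \<and>
     (\<forall>i \<in> U_tapes. ts i = program_tapes \<pi> i) \<and>
     (\<forall>j < clock. ts (off_c + j) = (int n, snd (input_tape (unary n))))"

lemma ready_cong:
  assumes "ready n \<pi> w ts" "\<And>i. i \<in> {0, 4, 5} \<union> {off_U..} \<Longrightarrow> ts' i = ts i"
  shows "ready n \<pi> w ts'"
proof -
  have "U_tapes \<subseteq> {0, 4, 5} \<union> {off_U..}" by (auto simp: U_tapes_def)
  then have "ts' i = ts i" if "i \<in> U_tapes" for i using that assms(2) by blast
  moreover have "ts' (off_c + j) = ts (off_c + j)" for j using assms(2) offsets by simp
  ultimately show ?thesis using assms by (simp add: ready_def)
qed

text \<open>Restricted to \<open>U_tapes\<close> the tapes are exactly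
  \<open>program_tapes \<pi>\<close>, so the clocked run is the one in the definition of
  \<open>accepts\<close>; what it leaves on its output tape then decides the comparison.\<close>

lemma counts_run_compare:
  assumes "ready n \<pi> w ts"
  shows "counts (seq run_U (compare_bits 5 (Suc off_U))) (\<lambda>ts v. v = 1)
    (start (seq run_U (compare_bits 5 (Suc off_U)))) ts ((n + 2) ^ clock + n + 2)
    (if accepts n \<pi> w then 2 ^ min (length w) n else 0)"
    (is "counts _ _ _ _ _ ?v")
proof -
  let ?F = "\<lambda>ts v. counts (compare_bits 5 (Suc off_U)) (\<lambda>ts v. v = 1) (start (compare_bits 5 (Suc off_U))) ts (Suc n) v"
  have M: "ntm U" using dtm_U by (simp add: dtm_def)
  have outU: "Suc off_U \<in> U_tapes" using tapes_ge_2 by (simp add: U_tapes_def)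
  have not_U: "0 \<notin> U_tapes" "5 \<notin> U_tapes" using offsets by (auto simp: U_tapes_def)
  have res: "restrict_tapes U_tapes ts = program_tapes \<pi>"
    using assms tapes_ge_2(3)
    by (auto simp: fun_eq_iff restrict_tapes_def ready_def program_tapes_def U_tapes_def)
  have "counts run_U ?F (start run_U) ts ((n + 2) ^ clock - 1) ?v"
    unfolding run_U_def
  proof (rule counts_timed)
    show "deterministic (run U off_U 4)" by (rule deterministic_run[OF dtm_U])
    show "inert_outside U_tapes (run U off_U 4)"
      unfolding U_tapes_def by (rule inert_outside_run[OF M])
    show "moves (run U off_U 4) q rd = {}" if "q \<in> finals (run U off_U 4)" for q rd
      using that by (auto simp: run_def)
    show "U_tapes \<inter> {off_c..<off_c + clock} = {}"
      using offsets by (auto simp: U_tapes_def off_c_def)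
    show "ts (off_c + j) = (int n, \<lambda>i. if 0 \<le> i \<and> i < int n then 2 else 0)" if "j < clock" for j
      using assms that by (simp add: ready_def snd_unary_tape)
    show "case outcome ((n + 2) ^ clock - 1) (run U off_U 4) (start (run U off_U 4)) (restrict_tapes U_tapes ts) of
        None \<Rightarrow> ?v = 0
      | Some us \<Rightarrow> \<forall>ts'. (\<forall>i\<in>U_tapes. ts' i = us i) \<and>
          (\<forall>i. i \<notin> U_tapes \<and> i \<notin> {off_c..<off_c + clock} \<longrightarrow> ts' i = ts i) \<longrightarrow> ?F ts' ?v"
    proof (cases "outcome ((n + 2) ^ clock - 1) (run U off_U 4) Launch (program_tapes \<pi>)")
      case None
      then show ?thesis by (simp add: res run_def accepts_def)
    next
      case (Some us)
      have "?F ts' ?v" if ts': "\<forall>i\<in>U_tapes. ts' i = us i"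
        "\<forall>i. i \<notin> U_tapes \<and> i \<notin> {off_c..<off_c + clock} \<longrightarrow> ts' i = ts i" for ts'
      proof -
        have eq: "ts' (Suc off_U) = us (Suc off_U)" "ts' 0 = ts 0" "ts' 5 = ts 5"
          using ts' outU not_U offsets by auto
        have v: "?v = (if matches (ts' (Suc off_U)) n w then 2 ^ min (length w) n else 0)"
          using Some by (simp add: accepts_def eq)
        have "counts (compare_bits 5 (Suc off_U)) (\<lambda>ts v. v = 1) 0 ts' (Suc n) ?v"
          unfolding v
        proof (rule counts_compare_bits)
          have 5: "ts' 5 = (0, \<lambda>i. if 0 \<le> i \<and> i < int n then 2 else 0)"
            using assms by (simp add: eq(3) ready_def input_tape_unary)
          show "snd (ts' 5) (fst (ts' 5) + int i) \<noteq> 0" if "i < n" for i using that by (simp add: 5)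
          show "snd (ts' 5) (fst (ts' 5) + int n) = 0" by (simp add: 5)
          show "displays (ts' 0) w" using assms by (simp add: eq(2) ready_def)
        qed (use offsets in simp_all)
        then show ?thesis by (simp only: start_elementary)
      qed
      then show ?thesis using Some by (simp add: res run_def)
    qed
  qed
  from counts_seq_start[OF this] show ?thesis by (rule counts_mono) simp
qed

lemma counts_check_length:
  assumes "ready n \<pi> w ts" and "displays (ts (Suc off_f)) (binary (f n))"
    and "ts 6 = blank_tape" "ts 1 = (int l, snd (input_tape (unary l)))"
  shows "counts (seq (copy_bits (Suc off_f) 6 1) (seq (count_down 6 1) (seq run_U (compare_bits 5 (Suc off_U)))))
    (\<lambda>ts v. v = 1)
    (start (seq (copy_bits (Suc off_f) 6 1) (seq (count_down 6 1) (seq run_U (compare_bits 5 (Suc off_U))))))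
    ts (tf n + (l + 1) * (2 * tf n + 3) + (n + 2) ^ clock + n + 5)
    (if f n < l \<and> accepts n \<pi> w then 2 ^ min (length w) n else 0)"
    (is "counts (seq ?A (seq ?B ?C)) ?F _ _ _ ?v")
proof -
  let ?y = "binary (f n)"
  let ?ts = "ts(Suc off_f := (fst (ts (Suc off_f)) + int (length ?y), snd (ts (Suc off_f))),
        6 := (fst (ts 6) + int (length ?y) - 1, snd (puts (ts 6) (map bit_symbol ?y))),
        1 := (fst (ts 1) - 1, snd (ts 1)))"
  let ?u = "if accepts n \<pi> w then 2 ^ min (length w) n else (0 :: nat)"
  let ?T = "(n + 2) ^ clock + n + 2"
  have "counts ?B (\<lambda>ts v. counts ?C ?F (start ?C) ts ?T v) 0 ?ts ((l + 1) * (2 * length ?y + 3))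
      (if binary_value ?y < l then ?u else 0)"
  proof (rule counts_count_down)
    fix ts' assume ts': "\<And>i. i \<noteq> 6 \<Longrightarrow> i \<noteq> 1 \<Longrightarrow> ts' i = ?ts i"
    have "ready n \<pi> w ts'"
      by (rule ready_cong[OF assms(1)]) (use ts' offsets in auto)
    then show "counts ?C ?F (start ?C) ts' ?T ?u" by (rule counts_run_compare)
  qed (use assms(3,4) offsets in \<open>auto simp: puts_blank blank_tape_def snd_unary_tape\<close>,
      simp add: puts_blank[unfolded blank_tape_def])
  moreover have "(if binary_value ?y < l then ?u else 0) = ?v" by simp
  ultimately have "counts ?B (\<lambda>ts v. counts ?C ?F (start ?C) ts ?T v) (start ?B) ?ts ((l + 1) * (2 * length ?y + 3)) ?v"
    by (simp only: start_elementary)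
  from counts_seq_start[OF this]
  have BC: "counts (seq ?B ?C) ?F (start (seq ?B ?C)) ?ts ((l + 1) * (2 * length ?y + 3) + Suc ?T) ?v" .
  have dist: "distinct [Suc off_f, 6, 1]" using offsets by simp
  have "counts ?A (\<lambda>ts v. counts (seq ?B ?C) ?F (start (seq ?B ?C)) ts ((l + 1) * (2 * length ?y + 3) + Suc ?T) v)
      0 ts (Suc (length ?y)) ?v"
    by (rule counts_copy_bits) (rule dist assms(2) BC)+
  then have "counts ?A (\<lambda>ts v. counts (seq ?B ?C) ?F (start (seq ?B ?C)) ts ((l + 1) * (2 * length ?y + 3) + Suc ?T) v)
      (start ?A) ts (Suc (length ?y)) ?v" by (simp only: start_elementary)
  from counts_seq_start[OF this] show ?thesis
  proof (rule counts_mono)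
    have "(l + 1) * (2 * length ?y + 3) \<le> (l + 1) * (2 * tf n + 3)"
      using length_f_le[of n] by (intro mult_le_mono2) simp
    then show "Suc (length ?y) + Suc ((l + 1) * (2 * length ?y + 3) + Suc ?T)
      \<le> tf n + (l + 1) * (2 * tf n + 3) + (n + 2) ^ clock + n + 5"
      using length_f_le[of n] by linarith
  qed
qed

definition verify_time :: "nat \<Rightarrow> nat" where
  "verify_time N = 3 * N + 3 * tf N + (N + 1) * (2 * tf N + 3) + (N + 2) ^ clock + 20"

text \<open>The bound is expressed by N, because the composition with \<open>guess\<close> needs one
  time bound for all guesses, while |\<pi>| + l varies.\<close>

lemma counts_verify:
  assumes "displays (ts0 0) w"
    and blank: "\<And>i. i \<notin> {0, 2} \<Longrightarrow> i < 7 \<or> off_f \<le> i \<Longrightarrow> ts0 i = blank_tape"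
    and g: "guessed 8 length_tapes off_U 1 ts0 \<pi> l ts" and le: "length \<pi> + l \<le> N"
  shows "counts verify (\<lambda>ts v. v = 1) (start verify) ts (verify_time N) (weight w \<pi> l)"
proof -
  let ?n = "length \<pi> + l"
  let ?F = "\<lambda>ts v. v = (1 :: nat)"
  have len: "ts i = (int ?n, snd (input_tape (unary ?n)))" if "i \<in> length_tapes" for i
  proof -
    have "ts0 i = blank_tape" using that offsets by (intro blank) (auto simp: length_tapes_def)
    then show ?thesis using g that puts_blank_twos[of ?n] by (simp add: guessed_def)
  qed
  have "ts0 off_U = blank_tape" using offsets by (intro blank) auto
  then have tU: "ts off_U = (int (length \<pi>), snd (input_tape \<pi>))"
    using g by (simp add: guessed_def puts_blank)
  have "ts0 1 = blank_tape" by (intro blank) auto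
  then have t1: "ts 1 = (int l, snd (input_tape (unary l)))"
    using g puts_blank_twos[of l] by (simp add: guessed_def)
  have same: "ts i = ts0 i" if "i \<notin> length_tapes" "i \<notin> {8, off_U, 1}" for i
    using g that by (simp add: guessed_def)
  define ts1 where "ts1 = shift {5, off_f} (- int ?n) ts"
  define ts2 where "ts2 = shift {off_U} (- int (length \<pi>)) ts1"
  have notin: "0 \<notin> length_tapes" "1 \<notin> length_tapes" "3 \<notin> length_tapes" "4 \<notin> length_tapes" "6 \<notin> length_tapes"
    "off_U \<notin> length_tapes"
    using offsets by (auto simp: length_tapes_def)
  have in5: "5 \<in> length_tapes" "off_f \<in> length_tapes" by (simp_all add: length_tapes_def)
  have ts2_0: "ts2 0 = ts0 0" using same[of 0] notin offsets by (simp add: ts2_def ts1_def shift_def)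
  have ts2_5: "ts2 5 = input_tape (unary ?n)" "ts2 off_f = input_tape (unary ?n)"
    using len in5 offsets by (simp_all add: ts2_def ts1_def shift_def input_tape_unary snd_unary_tape)
  have ts2_1: "ts2 1 = (int l, snd (input_tape (unary l)))"
    using t1 offsets by (simp add: ts2_def ts1_def shift_def)
  have ts2_blank: "ts2 i = blank_tape" if "i \<in> {3, 4, 6} \<or> off_f < i \<and> i < off_c \<and> i \<noteq> off_U" for i
  proof -
    have i: "i \<notin> length_tapes" "i \<notin> {8, off_U, 1, 5, off_f, 0, 2}" "i < 7 \<or> off_f \<le> i"
      using that offsets by (auto simp: length_tapes_def)
    then have "ts i = blank_tape" using same[of i] blank[of i] by simp
    then show ?thesis using i by (simp add: ts2_def ts1_def shift_def)
  qed
  have ts2_U: "ts2 off_U = input_tape \<pi>"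
    using tU offsets by (simp add: ts2_def ts1_def shift_def input_tape_eq[symmetric])
  have ts2_c: "ts2 (off_c + j) = (int ?n, snd (input_tape (unary ?n)))" if "j < clock" for j
    using len[of "off_c + j"] that offsets by (simp add: ts2_def ts1_def shift_def length_tapes_def)
  have ready2: "ready ?n \<pi> w ts2"
    unfolding ready_def
  proof (intro conjI ballI allI impI)
    show "displays (ts2 0) w" using assms(1) by (simp add: ts2_0)
    fix i assume i: "i \<in> U_tapes"
    show "ts2 i = program_tapes \<pi> i"
    proof (cases "i = off_U")
      case False
      then have "ts2 i = blank_tape"
        using i offsets by (intro ts2_blank) (auto simp: U_tapes_def off_c_def)
      then show ?thesis using False by (simp add: program_tapes_def)
    qed (simp add: ts2_U program_tapes_def)
  qed (rule ts2_5 ts2_c | assumption)+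
  have "\<exists>ts'. outcome (2 * tf ?n + 3) (run Mf off_f 3) (start (run Mf off_f 3)) ts2 = Some ts' \<and>
      (\<forall>i. (i < off_f \<or> off_f + num_tapes Mf \<le> i) \<and> i \<noteq> 3 \<longrightarrow> ts' i = ts2 i) \<and>
      fst (ts' (Suc off_f)) = 0 \<and> displays (ts' (Suc off_f)) (binary (f ?n))"
  proof (rule outcome_run[OF dtm_Mf _ Mf])
    show "ts2 (off_f + j) = blank_tape" if "1 \<le> j" "j < num_tapes Mf" for j
      using that tapes_ge_2(3) by (intro ts2_blank) (auto simp: off_U_def off_c_def)
  qed (use ts2_5 ts2_blank offsets in auto)
  then obtain ts3 where ts3: "outcome (2 * tf ?n + 3) (run Mf off_f 3) (start (run Mf off_f 3)) ts2 = Some ts3"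
    "\<And>i. (i < off_f \<or> off_U \<le> i) \<and> i \<noteq> 3 \<Longrightarrow> ts3 i = ts2 i"
    "displays (ts3 (Suc off_f)) (binary (f ?n))" unfolding off_U_def by auto
  have ready3: "ready ?n \<pi> w ts3"
    by (rule ready_cong[OF ready2]) (use ts3(2) offsets in auto)
  let ?D = "seq (copy_bits (Suc off_f) 6 1) (seq (count_down 6 1) (seq run_U (compare_bits 5 (Suc off_U))))"
  let ?TD = "tf ?n + (l + 1) * (2 * tf ?n + 3) + (?n + 2) ^ clock + ?n + 5"
  let ?v = "weight w \<pi> l"
  have "counts ?D ?F (start ?D) ts3 ?TD ?v"
    unfolding weight_def
    by (rule counts_check_length[OF ready3 ts3(3)]) (use ts3(2) ts2_1 ts2_blank offsets in auto)
  from counts_outcome[OF deterministic_run[OF dtm_Mf] ts3(1), of "\<lambda>ts v. counts ?D ?F (start ?D) ts ?TD v", OF this]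
  have run: "counts (seq (run Mf off_f 3) ?D) ?F (start (seq (run Mf off_f 3) ?D)) ts2
      (2 * tf ?n + 3 + Suc ?TD) ?v"
    by (rule counts_seq_start)
  let ?C = "seq (run Mf off_f 3) ?D" and ?TC = "2 * tf ?n + 3 + Suc ?TD"
  have "counts (rewind {off_U} off_U) (\<lambda>ts v. counts ?C ?F (start ?C) ts ?TC v)
      (start (rewind {off_U} off_U)) ts1 (length \<pi> + 2) ?v"
  proof (rule counts_rewind)
    show "counts ?C ?F (start ?C) (shift {off_U} (- int (length \<pi>)) ts1) ?TC ?v"
      using run by (simp only: ts2_def)
  qed (use tU offsets in \<open>auto simp: ts1_def shift_def input_tape_def bit_symbol_def\<close>)
  from counts_seq_start[OF this]
  have B: "counts (seq (rewind {off_U} off_U) ?C) ?F (start (seq (rewind {off_U} off_U) ?C)) ts1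
      (length \<pi> + 2 + Suc ?TC) ?v" .
  let ?B = "seq (rewind {off_U} off_U) ?C" and ?TB = "length \<pi> + 2 + Suc ?TC"
  have "counts (rewind {5, off_f} 5) (\<lambda>ts v. counts ?B ?F (start ?B) ts ?TB v)
      (start (rewind {5, off_f} 5)) ts (?n + 2) ?v"
  proof (rule counts_rewind)
    show "counts ?B ?F (start ?B) (shift {5, off_f} (- int ?n) ts) ?TB ?v"
      using B by (simp only: ts1_def)
  qed (use len[OF in5(1)] in \<open>auto simp: snd_unary_tape\<close>)
  from counts_seq_start[OF this] show ?thesis
    unfolding verify_def[symmetric]
  proof (rule counts_mono)
    have "tf ?n \<le> tf N" using mono_tf le by (rule monoD)
    moreover have "(?n + 2) ^ clock \<le> (N + 2) ^ clock" using le by (intro power_mono) simp_all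
    moreover have "(l + 1) * (2 * tf ?n + 3) \<le> (N + 1) * (2 * tf N + 3)"
      using le \<open>tf ?n \<le> tf N\<close> by (intro mult_le_mono) simp_all
    ultimately show "?n + 2 + Suc ?TB \<le> verify_time N"
      using le unfolding verify_time_def by linarith
  qed
qed

definition count_time :: "nat \<Rightarrow> nat" where
  "count_time k = 3 * k + 3 * tm k + verify_time (tm k) + 22"

lemma mono_verify_time: "N \<le> N' \<Longrightarrow> verify_time N \<le> verify_time N'"
  using monoD[OF mono_tf, of N N'] unfolding verify_time_def
  by (intro add_mono mult_le_mono power_mono) simp_all

lemma mono_count_time: "k \<le> k' \<Longrightarrow> count_time k \<le> count_time k'"
  using monoD[OF mono_tm, of k k'] unfolding count_time_def
  by (intro add_mono mono_verify_time) simp_all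

lemma counts_count_all:
  "counts count_all (\<lambda>ts v. v = 1) (start count_all) (input_tapes (replicate r True @ False # w))
    (count_time (r + length w)) (guess_sum (m (r + length w)) (weight w))"
proof -
  let ?k = "r + length w" and ?F = "\<lambda>ts v. v = (1 :: nat)"
  let ?N = "m ?k"
  let ?G = "guess 8 length_tapes off_U 1"
  let ?s = "guess_sum ?N (weight w)"
  have "counts prepare (\<lambda>ts v. counts (seq ?G verify) ?F (start (seq ?G verify)) ts (?N + Suc (verify_time ?N)) v)
    (start prepare) (input_tapes (replicate r True @ False # w)) (3 * ?k + 2 * tm ?k + 20) ?s"
  proof (rule counts_prepare)
    fix ts assume ts: "displays (ts 0) w" "displays (ts 8) (unary (m ?k))"
      "\<And>i. i \<notin> {0, 2} \<Longrightarrow> i < 7 \<or> off_f \<le> i \<Longrightarrow> ts i = blank_tape"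
    have "counts ?G (\<lambda>ts v. counts verify ?F (start verify) ts (verify_time ?N) v) 0 ts (length (unary ?N))
        (guess_sum (length (unary ?N)) (weight w))"
    proof (rule counts_guess)
      fix \<pi> l ts' assume "length \<pi> + l \<le> length (unary ?N)" "guessed 8 length_tapes off_U 1 ts \<pi> l ts'"
      then show "counts verify ?F (start verify) ts' (verify_time ?N) (weight w \<pi> l)"
        using ts(1,3) by (intro counts_verify) simp_all
    qed (use ts(2) offsets in \<open>auto simp: length_tapes_def\<close>)
    then have "counts ?G (\<lambda>ts v. counts verify ?F (start verify) ts (verify_time ?N) v) (start ?G) ts ?N ?s"
      by (simp only: start_elementary length_unary)
    then show "counts (seq ?G verify) ?F (start (seq ?G verify)) ts (?N + Suc (verify_time ?N)) ?s"
      by (rule counts_seq_start)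
  qed
  from counts_seq_start[OF this] show ?thesis
    unfolding count_all_def[symmetric]
    by (rule counts_mono) (use m_le[of ?k] mono_verify_time[OF m_le[of ?k]] in \<open>simp add: count_time_def\<close>)
qed

lemma counts_count_all_no_separator:
  "counts count_all F (start count_all) (input_tapes (replicate r True)) (r + 2) 0"
  using counts_seq_start[OF counts_prepare_no_separator[of _ r], where T' = 0]
  unfolding count_all_def by simp

lemma counts_compute_power:
  "counts compute_power (\<lambda>ts v. v = 1 \<and> ts 1 = puts blank_tape (2 # replicate (m (r + length w)) 1))
    (start compute_power) (input_tapes (replicate r True @ False # w))
    (3 * (r + length w) + 3 * tm (r + length w) + 22) 1"
    (is "counts _ ?F _ _ _ _")
proof -
  let ?k = "r + length w"
  have "counts prepare (\<lambda>ts v. counts (write_power 8) ?F (start (write_power 8)) ts (Suc (m ?k)) v)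
    (start prepare) (input_tapes (replicate r True @ False # w)) (3 * ?k + 2 * tm ?k + 20) 1"
  proof (rule counts_prepare)
    fix ts assume ts: "displays (ts 0) w" "displays (ts 8) (unary (m ?k))"
      "\<And>i. i \<notin> {0, 2} \<Longrightarrow> i < 7 \<or> off_f \<le> i \<Longrightarrow> ts i = blank_tape"
    have "counts (write_power 8) ?F 0 ts (Suc (length (unary (m ?k)))) 1"
    proof (rule counts_write_power)
      show "displays (ts 8) (unary (m ?k))" by (rule ts(2))
    qed (use ts(3)[of 1] in simp_all)
    then show "counts (write_power 8) ?F (start (write_power 8)) ts (Suc (m ?k)) 1"
      by (simp only: start_elementary length_unary)
  qed
  from counts_seq_start[OF this] show ?thesis
    unfolding compute_power_def[symmetric] by (rule counts_mono) (use m_le[of ?k] in simp)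
qed

text \<open>Simulating t steps of \<open>U\<close> takes fuel 2 t + 3, and the clock grants (n +
  2)^\<open>clock\<close> - 1.\<close>

lemma accepts_complete:
  assumes "prints_within U \<pi> x t" "2 * t + 3 < (length x + 2) ^ clock" "agree x w"
  shows "accepts (length x) \<pi> w"
proof -
  have "\<exists>ts'. outcome ((length x + 2) ^ clock - 1) (run U off_U 4) (start (run U off_U 4)) (program_tapes \<pi>) = Some ts' \<and>
      (\<forall>i. (i < off_U \<or> off_U + num_tapes U \<le> i) \<and> i \<noteq> 4 \<longrightarrow> ts' i = program_tapes \<pi> i) \<and>
      fst (ts' (Suc off_U)) = 0 \<and> displays (ts' (Suc off_U)) x"
    by (rule outcome_run[OF dtm_U _ assms(1)]) (use assms(2) offsets in \<open>auto simp: program_tapes_def\<close>)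
  then show ?thesis using assms(3) by (auto simp: accepts_def matches_def run_def)
qed

text \<open>The outcome is a function and a tape displays at most one string, so for each n a
  program backs at most one string. The analysis of the martingale works with this partial function
  and without machines.\<close>

lemma accepts_unique_string:
  "\<exists>out. \<forall>n \<pi> w. accepts n \<pi> w \<longleftrightarrow> (\<exists>x. out n \<pi> = Some x \<and> length x = n \<and> agree x w)"
proof -
  let ?P = "\<lambda>n \<pi> x. \<exists>us. outcome ((n + 2) ^ clock - 1) (run U off_U 4) Launch (program_tapes \<pi>) = Some us \<and>
    displays (us (Suc off_U)) x"
  let ?out = "\<lambda>n \<pi>. if \<exists>x. ?P n \<pi> x then Some (THE x. ?P n \<pi> x) else None"
  have uniq: "x = y" if "?P n \<pi> x" "?P n \<pi> y" for n \<pi> x y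
    using that displays_unique by (metis option.inject)
  have P: "?out n \<pi> = Some x \<longleftrightarrow> ?P n \<pi> x" for n \<pi> x
  proof
    assume x: "?P n \<pi> x"
    then have "(THE x. ?P n \<pi> x) = x" using uniq by (intro the_equality)
    then show "?out n \<pi> = Some x" using x by auto
  next
    assume out: "?out n \<pi> = Some x"
    then obtain y where y: "?P n \<pi> y" by (auto split: if_splits)
    then have "(THE x. ?P n \<pi> x) = y" using uniq by (intro the_equality)
    then show "?P n \<pi> x" using out y by (auto split: if_splits)
  qed
  have "accepts n \<pi> w \<longleftrightarrow> (\<exists>x. ?P n \<pi> x \<and> length x = n \<and> agree x w)" for n \<pi> w
    by (auto simp: accepts_def matches_def)
  then show ?thesis using P by (intro exI[of _ ?out]) simp
qed

definition symbols :: nat where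
  "symbols = 4 + num_symbols Mm + num_symbols Mf + num_symbols U"

lemma well_formed_prepare: "well_formed (off_c + clock) symbols prepare"
  unfolding prepare_def
  by (intro well_formed_seq well_formed_split_input well_formed_rewind well_formed_run)
    (use dtm_Mm offsets in \<open>auto simp: dtm_def symbols_def off_f_def\<close>)

lemma well_formed_count_all: "well_formed (off_c + clock) symbols count_all"
proof -
  have "well_formed (off_c + clock) symbols run_U"
    unfolding run_U_def
    by (intro well_formed_timed well_formed_run)
      (use dtm_U offsets in \<open>auto simp: dtm_def symbols_def off_c_def\<close>)
  then have "well_formed (off_c + clock) symbols verify"
    unfolding verify_def
    by (intro well_formed_seq well_formed_rewind well_formed_run well_formed_copy_bits
        well_formed_count_down well_formed_compare_bits)
      (use dtm_Mf offsets in \<open>auto simp: dtm_def symbols_def off_U_def\<close>)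
  then show ?thesis
    unfolding count_all_def
    by (intro well_formed_seq well_formed_prepare well_formed_guess)
      (use offsets in \<open>auto simp: length_tapes_def symbols_def\<close>)
qed

lemma well_formed_compute_power: "well_formed (off_c + clock) symbols compute_power"
  unfolding compute_power_def
  by (intro well_formed_seq well_formed_prepare well_formed_write_power)
    (use offsets in \<open>auto simp: symbols_def\<close>)

lemma deterministic_compute_power: "deterministic compute_power"
  unfolding compute_power_def prepare_def
  by (intro deterministic_seq deterministic_elementary deterministic_run dtm_Mm)

end

lemma unary_prefix_cases:
  obtains r where "x = replicate r True" | r w where "x = replicate r True @ False # w"
proof (induction x arbitrary: thesis)
  case Nil
  show ?case by (rule Nil(1)[of 0]) simp
next
  case (Cons b x)
  show ?case
  proof (cases b)
    case True
    show ?thesis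
    proof (rule Cons.IH)
      show thesis if "x = replicate r True" for r
        by (rule Cons.prems(1)[of "Suc r"]) (simp add: that True)
      show thesis if "x = replicate r True @ False # w" for r w
        by (rule Cons.prems(2)[of "Suc r" w]) (simp add: that True)
    qed
  next
    case False
    show ?thesis by (rule Cons.prems(2)[of 0 x]) (simp add: False)
  qed
qed

subsection \<open>Polynomial time bounds\<close>

lemma polynomial_id: "polynomial (\<lambda>n. n)"
  unfolding polynomial_def by (rule exI[of _ "[:0, 1:]"]) simp

lemma polynomial_const: "polynomial (\<lambda>_. c)"
  unfolding polynomial_def by (rule exI[of _ "[:real c:]"]) simp

lemma polynomial_add: "polynomial s \<Longrightarrow> polynomial t \<Longrightarrow> polynomial (\<lambda>n. s n + t n)"
  unfolding polynomial_def by (metis of_nat_add poly_add)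

lemma polynomial_mult: "polynomial s \<Longrightarrow> polynomial t \<Longrightarrow> polynomial (\<lambda>n. s n * t n)"
  unfolding polynomial_def by (metis of_nat_mult poly_mult)

lemma polynomial_power: "polynomial s \<Longrightarrow> polynomial (\<lambda>n. s n ^ k)"
  by (induction k) (simp_all add: polynomial_const polynomial_mult)

lemma polynomial_comp: "polynomial s \<Longrightarrow> polynomial t \<Longrightarrow> polynomial (\<lambda>n. s (t n))"
  unfolding polynomial_def by (metis poly_pcompose)

lemmas polynomial_intros = polynomial_id polynomial_const polynomial_add polynomial_mult polynomial_power

text \<open>A \<open>polynomial\<close> function may have coefficients of either sign and need not
  be monotone; absolute values of the coefficients yield a bound that is.\<close>

lemma polynomial_bounded:
  assumes "polynomial t"
  obtains c k where "\<And>n. t n \<le> c * (n + 1) ^ k"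
proof -
  obtain P where P: "\<And>n. real (t n) = poly P (real n)" using assms by (auto simp: polynomial_def)
  let ?c = "\<Sum>i\<le>degree P. \<bar>coeff P i\<bar>"
  have "t n \<le> nat \<lceil>?c\<rceil> * (n + 1) ^ degree P" for n
  proof -
    have "real (t n) = (\<Sum>i\<le>degree P. coeff P i * real n ^ i)" by (simp add: P poly_altdef)
    also have "\<dots> \<le> (\<Sum>i\<le>degree P. \<bar>coeff P i\<bar> * (real n + 1) ^ degree P)"
    proof (rule sum_mono)
      fix i assume "i \<in> {..degree P}"
      then have "real n ^ i \<le> (real n + 1) ^ degree P"
        by (intro order_trans[OF power_mono[of "real n" "real n + 1"] power_increasing]) auto
      then show "coeff P i * real n ^ i \<le> \<bar>coeff P i\<bar> * (real n + 1) ^ degree P"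
        by (intro mult_mono) auto
    qed
    also have "\<dots> = ?c * (real n + 1) ^ degree P" by (simp add: sum_distrib_right)
    also have "\<dots> \<le> real (nat \<lceil>?c\<rceil>) * (real n + 1) ^ degree P"
      by (intro mult_right_mono) (simp_all add: of_nat_ceiling)
    also have "\<dots> = real (nat \<lceil>?c\<rceil> * (n + 1) ^ degree P)" by (simp add: add.commute)
    finally show ?thesis using of_nat_le_iff by blast
  qed
  then show ?thesis by (rule that)
qed

lemma polynomial_majorant:
  assumes "polynomial t"
  obtains u where "polynomial u" "mono u" "\<And>n. t n \<le> u n"
proof -
  obtain c k where "\<And>n. t n \<le> c * (n + 1) ^ k" using polynomial_bounded[OF assms] by blast
  moreover have "polynomial (\<lambda>n. c * (n + 1) ^ k)" by (intro polynomial_intros)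
  moreover have "mono (\<lambda>n. c * (n + 1) ^ k)"
    by (intro monoI mult_le_mono power_mono) simp_all
  ultimately show ?thesis by (rule that[rotated 2])
qed

text \<open>The coefficient is absorbed into the exponent by c < 2^c \<le> (n + 2)^c. The base n + 2
  is the number of values of a clock digit and is at least 2 even for n = 0.\<close>

lemma polynomial_clock:
  assumes "polynomial t"
  obtains k where "\<And>n. t n < (n + 2) ^ k"
proof -
  obtain c j where cj: "\<And>n. t n \<le> c * (n + 1) ^ j" using polynomial_bounded[OF assms] by blast
  have "t n < (n + 2) ^ (c + j)" for n
  proof -
    have "c < 2 ^ c" by (rule less_exp)
    also have "\<dots> \<le> (n + 2) ^ c" by (intro power_mono) simp_all
    finally have "c < (n + 2) ^ c" .
    moreover have "(n + 1) ^ j \<le> (n + 2) ^ j" by (intro power_mono) simp_all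
    ultimately have "c * (n + 1) ^ j < (n + 2) ^ c * (n + 2) ^ j"
      by (intro mult_less_le_imp_less) simp_all
    then show ?thesis using cj[of n] by (simp add: power_add)
  qed
  then show ?thesis by (rule that)
qed

section \<open>The martingale\<close>

definition programs :: "(nat \<Rightarrow> bool list \<Rightarrow> bool list option) \<Rightarrow> (nat \<Rightarrow> nat) \<Rightarrow> nat \<Rightarrow> bool list \<Rightarrow> bool list set" where
  "programs out f n w =
     {\<pi>. length \<pi> + f n < n \<and> (\<exists>x. out n \<pi> = Some x \<and> length x = n \<and> agree x w)}"

text \<open>Each consistent program has staked 2^(-n) and doubled it min(|w|, n) times. From |w| = n
  onwards the capital is the number of eligible programs for the prefix of length n.\<close>

definition layer :: "(nat \<Rightarrow> bool list \<Rightarrow> bool list option) \<Rightarrow> (nat \<Rightarrow> nat) \<Rightarrow> nat \<Rightarrow> bool list \<Rightarrow> real" where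
  "layer out f n w = 2 ^ min (length w) n * real (card (programs out f n w)) / 2 ^ n"

definition mixture :: "(nat \<Rightarrow> bool list \<Rightarrow> bool list option) \<Rightarrow> (nat \<Rightarrow> nat) \<Rightarrow> bool list \<Rightarrow> real" where
  "mixture out f w = (\<Sum>n. layer out f n w)"

lemma finite_programs: "finite (programs out f n w)"
  by (rule finite_subset[OF _ finite_lists_le[of n]]) (auto simp: programs_def)

lemma card_short_lists: "card {xs :: bool list. length xs < L} \<le> 2 ^ L"
proof (induction L)
  case (Suc L)
  have "{xs :: bool list. length xs < Suc L} = {xs. length xs < L} \<union> {xs. length xs = L}" by auto
  moreover have "card {xs :: bool list. length xs = L} = 2 ^ L"
    using card_lists_length_eq[of "UNIV :: bool set" L] by simp
  ultimately show ?case using card_Un_le[of "{xs :: bool list. length xs < L}" "{xs. length xs = L}"] Suc.IH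
    by simp
qed simp

lemma card_programs_le:
  assumes "f n \<le> n"
  shows "card (programs out f n w) \<le> 2 ^ (n - f n)"
proof -
  have "finite {xs :: bool list. length xs < n - f n}"
    by (rule finite_subset[OF _ finite_lists_le[of n]]) auto
  then have "card (programs out f n w) \<le> card {xs :: bool list. length xs < n - f n}"
    by (rule card_mono) (auto simp: programs_def)
  then show ?thesis using card_short_lists le_trans by blast
qed

lemma layer_nonneg: "0 \<le> layer out f n w"
  by (simp add: layer_def)

text \<open>The number of programs gives 2 powr (- f n), and at most |w| bets have doubled it. If f
  n > n the subtraction n - f n is truncated and this count would be too weak, but then no program
  is eligible.\<close>

lemma layer_le: "layer out f n w \<le> 2 ^ length w * 2 powr - real (f n)"
proof (cases "f n \<le> n")
  case True
  have "real (card (programs out f n w)) \<le> 2 ^ (n - f n)"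
    using card_programs_le[of f n, OF True, of out w] by (metis of_nat_le_iff of_nat_numeral of_nat_power)
  moreover have "(2 :: real) ^ min (length w) n \<le> 2 ^ length w" by (intro power_increasing) simp_all
  ultimately have "layer out f n w \<le> 2 ^ length w * 2 ^ (n - f n) / 2 ^ n"
    unfolding layer_def by (intro divide_right_mono mult_mono) simp_all
  also have "\<dots> = 2 ^ length w * 2 powr - real (f n)"
    using True by (simp add: powr_minus powr_realpow power_diff field_simps)
  finally show ?thesis .
next
  case False
  then have "programs out f n w = {}" by (auto simp: programs_def)
  then show ?thesis by (simp add: layer_def)
qed

lemma agree_snoc_long: "length x \<le> length w \<Longrightarrow> agree x (w @ [b]) \<longleftrightarrow> agree x w"
  by (simp add: agree_def)

lemma agree_snoc_short:
  "length w < length x \<Longrightarrow> agree x (w @ [b]) \<longleftrightarrow> agree x w \<and> x ! length w = b"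
  by (auto simp: agree_def take_Suc_conv_app_nth)

text \<open>Before depth n the next bit splits the consistent programs into two classes while the
  stake doubles; from depth n on neither the programs nor the stake change.\<close>

lemma layer_average: "layer out f n w = (layer out f n (w @ [False]) + layer out f n (w @ [True])) / 2"
proof (cases "length w < n")
  case True
  have "programs out f n w = programs out f n (w @ [False]) \<union> programs out f n (w @ [True])"
    using True by (auto simp: programs_def agree_snoc_short)
  moreover have "programs out f n (w @ [False]) \<inter> programs out f n (w @ [True]) = {}"
    using True by (auto simp: programs_def agree_snoc_short)
  ultimately have "card (programs out f n w) =
      card (programs out f n (w @ [False])) + card (programs out f n (w @ [True]))"
    by (simp add: card_Un_disjoint finite_programs)
  moreover have "min (length w) n = length w" "min (Suc (length w)) n = Suc (length w)"
    using True by simp_all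
  ultimately show ?thesis by (simp add: layer_def field_simps)
next
  case False
  then have "programs out f n (w @ [b]) = programs out f n w" for b
    by (auto simp: programs_def agree_snoc_long)
  moreover have "min (length w) n = n" "min (Suc (length w)) n = n" using False by simp_all
  ultimately show ?thesis by (simp add: layer_def)
qed

lemma summable_layer:
  assumes "summable (\<lambda>n. 2 powr - real (f n))"
  shows "summable (\<lambda>n. layer out f n w)"
proof (rule summable_comparison_test')
  show "summable (\<lambda>n. 2 ^ length w * 2 powr - real (f n))" by (rule summable_mult[OF assms])
  show "norm (layer out f n w) \<le> 2 ^ length w * 2 powr - real (f n)" if "0 \<le> n" for n
    using layer_le layer_nonneg by simp
qed

lemma martingale_mixture:
  assumes "summable (\<lambda>n. 2 powr - real (f n))"
  shows "martingale (mixture out f)"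
  unfolding martingale_def
proof (intro allI conjI)
  fix w
  note s = summable_layer[OF assms, of out]
  show "0 \<le> mixture out f w"
    unfolding mixture_def by (rule suminf_nonneg[OF s layer_nonneg])
  have "mixture out f w = (\<Sum>n. (layer out f n (w @ [False]) + layer out f n (w @ [True])) / 2)"
    unfolding mixture_def using layer_average by (rule suminf_cong)
  also have "\<dots> = (\<Sum>n. layer out f n (w @ [False]) + layer out f n (w @ [True])) / 2"
    by (rule suminf_divide[OF summable_add[OF s s]])
  also have "\<dots> = (mixture out f (w @ [False]) + mixture out f (w @ [True])) / 2"
    unfolding mixture_def by (simp add: suminf_add[OF s s])
  finally show "mixture out f w = (mixture out f (w @ [False]) + mixture out f (w @ [True])) / 2" .
qed

text \<open>The tail bound is taken at r + |w| because a layer can have grown by the factor 2^|w| on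
  the way to w, and this factor cancels.\<close>

lemma mixture_approx:
  assumes s: "summable (\<lambda>n. 2 powr - real (f n))"
    and tail: "(\<Sum>n. 2 powr - real (f (n + N))) \<le> 2 powr - real (r + length w)"
  shows "\<bar>mixture out f w - (\<Sum>n\<le>N. layer out f n w)\<bar> \<le> 2 powr - real r"
proof -
  note sl = summable_layer[OF s, of out w]
  have sN: "summable (\<lambda>n. 2 powr - real (f (n + N)))" using s by (subst summable_iff_shift)
  have slN: "summable (\<lambda>n. layer out f (n + N) w)" using sl by (subst summable_iff_shift)
  have "mixture out f w = (\<Sum>n. layer out f (n + Suc N) w) + (\<Sum>n<Suc N. layer out f n w)"
    unfolding mixture_def by (rule suminf_split_initial_segment[OF sl])
  then have eq: "mixture out f w - (\<Sum>n\<le>N. layer out f n w) = (\<Sum>n. layer out f (n + Suc N) w)"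
    by (simp add: lessThan_Suc_atMost)
  have slS: "summable (\<lambda>n. layer out f (n + Suc N) w)" using sl by (subst summable_iff_shift)
  \<comment> \<open>The partial sum includes layer N, so the remainder starts at N + 1, whereas the
    modulus speaks of the tail from N; the surplus layer is nonnegative.\<close>
  have "(\<Sum>n. layer out f (Suc n + N) w) = (\<Sum>n. layer out f (n + N) w) - layer out f (0 + N) w"
    by (rule suminf_split_head[OF slN])
  then have "(\<Sum>n. layer out f (n + Suc N) w) \<le> (\<Sum>n. layer out f (n + N) w)"
    using layer_nonneg[of out f N w] by simp
  also have "\<dots> \<le> (\<Sum>n. 2 ^ length w * 2 powr - real (f (n + N)))"
    by (rule suminf_le[OF layer_le slN summable_mult[OF sN]])
  also have "\<dots> = 2 ^ length w * (\<Sum>n. 2 powr - real (f (n + N)))"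
    by (rule suminf_mult[OF sN])
  also have "\<dots> \<le> 2 ^ length w * 2 powr - real (r + length w)"
    using tail by (intro mult_left_mono) simp_all
  also have "\<dots> = 2 powr - real r"
    by (simp add: powr_realpow[symmetric] powr_add[symmetric])
  finally show ?thesis
    unfolding eq using suminf_nonneg[OF slS layer_nonneg] by simp
qed

lemma length_seq_prefix [simp]: "length (seq_prefix S n) = n"
  by (simp add: seq_prefix_def)

lemma agree_seq_prefix: "n \<le> k \<Longrightarrow> agree (seq_prefix S n) (seq_prefix S k)"
  by (simp add: agree_def seq_prefix_def take_map)

lemma mixture_succeeds:
  assumes s: "summable (\<lambda>n. 2 powr - real (f n))"
    and inf: "infinite {n. \<exists>\<pi>. length \<pi> + f n < n \<and> out n \<pi> = Some (seq_prefix S n)}"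
  shows "succeeds_on (mixture out f) S"
proof -
  let ?I = "{n. \<exists>\<pi>. length \<pi> + f n < n \<and> out n \<pi> = Some (seq_prefix S n)}"
  have ge1: "1 \<le> layer out f n (seq_prefix S k)" if n: "n \<in> ?I" "n \<le> k" for n k
  proof -
    obtain \<pi> where "length \<pi> + f n < n" "out n \<pi> = Some (seq_prefix S n)" using n(1) by blast
    then have "\<pi> \<in> programs out f n (seq_prefix S k)"
      using agree_seq_prefix[OF n(2)] by (simp add: programs_def)
    then have "1 \<le> card (programs out f n (seq_prefix S k))"
      using finite_programs by (metis One_nat_def Suc_leI card_gt_0_iff empty_iff)
    then show ?thesis using n(2) by (simp add: layer_def)
  qed
  have "eventually (\<lambda>k. ereal b < ereal (mixture out f (seq_prefix S k))) sequentially" for b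
  proof -
    obtain B :: nat where B: "b < real B" using reals_Archimedean2 by blast
    \<comment> \<open>Beyond the largest of B chosen lengths, each of these layers holds capital at
      least 1.\<close>
    obtain T where T: "finite T" "card T = B" "T \<subseteq> ?I"
      using infinite_arbitrarily_large[OF inf] by blast
    have "ereal b < ereal (mixture out f (seq_prefix S k))" if "Max (insert 0 T) \<le> k" for k
    proof -
      have le: "n \<le> k" if "n \<in> T" for n
        using T(1) that \<open>Max (insert 0 T) \<le> k\<close> by simp
      have "real B = (\<Sum>n\<in>T. 1)" using T(2) by simp
      also have "\<dots> \<le> (\<Sum>n\<in>T. layer out f n (seq_prefix S k))"
        using ge1 le T(3) by (intro sum_mono) blast
      also have "\<dots> \<le> mixture out f (seq_prefix S k)"
        unfolding mixture_def by (rule sum_le_suminf[OF summable_layer[OF s] T(1) layer_nonneg])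
      finally show ?thesis using B by simp
    qed
    then show ?thesis unfolding eventually_sequentially by blast
  qed
  \<comment> \<open>Because the layers keep their capital, even the limit is infinite.\<close>
  then have "(\<lambda>k. ereal (mixture out f (seq_prefix S k))) \<longlonglongrightarrow> \<infinity>"
    by (simp add: tendsto_PInfty)
  then show ?thesis unfolding succeeds_on_def by (intro lim_imp_Limsup) simp_all
qed

text \<open>An empty infimum would be \<infinity>, which the assumption excludes, and a nonempty
  infimum in \<open>enat\<close> is attained. As the difference is taken in the reals, the
  assumption fails whenever k is at least \<open>length x\<close>.\<close>

lemma Kt_less:
  assumes "ereal_of_enat (Kt U p x) < ereal (real (length x) - real k)"
  obtains \<pi> where "prints_within U \<pi> x (p (length x))" "length \<pi> + k < length x"
proof -
  let ?P = "{\<pi>. prints_within U \<pi> x (p (length x))}"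
  have "?P \<noteq> {}"
  proof
    assume "?P = {}"
    then have "Kt U p x = \<infinity>" unfolding Kt_def by (simp add: top_enat_def)
    then show False using assms by simp
  qed
  then obtain \<pi>\<^sub>0 where "\<pi>\<^sub>0 \<in> ?P" by blast
  then have "Kt U p x \<in> (\<lambda>\<pi>. enat (length \<pi>)) ` ?P"
    unfolding Kt_def by (intro wellorder_InfI[OF imageI])
  then obtain \<pi> where "\<pi> \<in> ?P" "Kt U p x = enat (length \<pi>)" by blast
  then show ?thesis using assms by (intro that[of \<pi>]) auto
qed

section \<open>Counts as scaled partial sums, and polynomial time\<close>

context counting
begin

text \<open>Substituting n = |\<pi>| + l and exchanging the sums groups the guesses by n. Each
  program then carries 2^(N - n) * 2^(min(|w|, n)), which is 2^N times its share of the
  layer.\<close>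

lemma guess_sum_weight:
  assumes out: "\<And>n \<pi> w. accepts n \<pi> w \<longleftrightarrow> (\<exists>x. out n \<pi> = Some x \<and> length x = n \<and> agree x w)"
  shows "real (guess_sum N (weight w)) = 2 ^ N * (\<Sum>n\<le>N. layer out f n w)"
proof -
  let ?P = "\<lambda>n \<pi>. length \<pi> + f n < n \<and> accepts n \<pi> w"
  let ?g = "\<lambda>\<pi> n. 2 ^ (N - n) * (if ?P n \<pi> then 2 ^ min (length w) n else (0 :: nat))"
  let ?L = "{\<pi> :: bool list. length \<pi> \<le> N}"
  have inner: "(\<Sum>l\<le>N - length \<pi>. 2 ^ (N - length \<pi> - l) * weight w \<pi> l) =
      (\<Sum>n | n \<in> {..N} \<and> length \<pi> \<le> n. ?g \<pi> n)" if "\<pi> \<in> ?L" for \<pi>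
  proof (rule sum.reindex_bij_witness[where i = "\<lambda>n. n - length \<pi>" and j = "\<lambda>l. length \<pi> + l"])
    fix l assume "l \<in> {..N - length \<pi>}"
    then show "?g \<pi> (length \<pi> + l) = 2 ^ (N - length \<pi> - l) * weight w \<pi> l"
      by (simp add: weight_def)
  qed (use that in auto)
  have "guess_sum N (weight w) = (\<Sum>\<pi>\<in>?L. \<Sum>n | n \<in> {..N} \<and> length \<pi> \<le> n. ?g \<pi> n)"
    unfolding guess_sum_eq by (rule sum.cong[OF refl inner])
  also have "\<dots> = (\<Sum>n\<le>N. \<Sum>\<pi> | \<pi> \<in> ?L \<and> length \<pi> \<le> n. ?g \<pi> n)"
    by (rule sum.swap_restrict[OF finite_lists_le finite_atMost])
  also have "\<dots> = (\<Sum>n\<le>N. 2 ^ (N - n) * 2 ^ min (length w) n * card (programs out f n w))"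
  proof (rule sum.cong[OF refl])
    fix n assume n: "n \<in> {..N}"
    have "finite {\<pi>. \<pi> \<in> ?L \<and> length \<pi> \<le> n}"
      using finite_lists_le[of N] by (rule rev_finite_subset) auto
    then have "(\<Sum>\<pi> | \<pi> \<in> ?L \<and> length \<pi> \<le> n. ?g \<pi> n) = (\<Sum>\<pi> \<in> programs out f n w. ?g \<pi> n)"
      using n by (intro sum.mono_neutral_right) (auto simp: programs_def out)
    also have "\<dots> = (\<Sum>\<pi> \<in> programs out f n w. 2 ^ (N - n) * 2 ^ min (length w) n)"
      by (intro sum.cong) (auto simp: programs_def out)
    finally show "(\<Sum>\<pi> | \<pi> \<in> ?L \<and> length \<pi> \<le> n. ?g \<pi> n) =
        2 ^ (N - n) * 2 ^ min (length w) n * card (programs out f n w)" by simp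
  qed
  finally have "real (guess_sum N (weight w)) =
      (\<Sum>n\<le>N. 2 ^ (N - n) * 2 ^ min (length w) n * real (card (programs out f n w)))" by simp
  also have "\<dots> = (\<Sum>n\<le>N. 2 ^ N * layer out f n w)"
    by (intro sum.cong) (simp_all add: layer_def power_diff)
  finally show ?thesis by (simp add: sum_distrib_left)
qed

lemma sharp_P_count_all:
  assumes "polynomial tm" "polynomial tf"
  obtains h where "sharp_P h" "\<And>w r. h (pair (w, r)) = guess_sum (m (r + length w)) (weight w)"
proof -
  let ?k = "off_c + clock"
  obtain e where e: "numbering e count_all"
    using numbering_exists[OF well_formed_count_all] .
  let ?M = "compile ?k symbols e count_all"
  \<comment> \<open>The sum covers both kinds of input: \<open>count_time\<close> those with a
    separator, and l + 2 the strings of ones, which are rejected.\<close>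
  let ?T = "\<lambda>l. count_time l + l + 2"
  have k: "1 \<le> ?k" "2 \<le> ?k" "3 \<le> symbols" using offsets by (simp_all add: symbols_def)
  have acc: "accepting_paths ?M x = accepting_from ?M (config_of ?k e (start count_all) (input_tapes x))" for x
    by (simp add: accepting_paths_def accepting_from_def init_config_compile[OF e k(1)])
  note c = counts_compile[OF well_formed_count_all e _ proper_input_tapes[OF well_formed_count_all k(1,3)],
      where F = "\<lambda>ts v. v = 1", simplified]
  have bound: "length as \<le> ?T (length x)" if "is_path ?M (init_config ?M x) as" for x as
  proof (cases x rule: unary_prefix_cases)
    case (1 r)
    show ?thesis
      using c[OF counts_count_all_no_separator[of _ r, unfolded 1[symmetric], simplified]] that 1
      by (auto simp: init_config_compile[OF e k(1)])
  next
    case (2 r w)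
    have "length as \<le> count_time (r + length w)"
      using c[OF counts_count_all[of r w, unfolded 2[symmetric], simplified]] that
      by (auto simp: init_config_compile[OF e k(1)])
    also have "\<dots> \<le> count_time (length x)" using 2 by (intro mono_count_time) simp
    finally show ?thesis by simp
  qed
  have "polynomial ?T"
    unfolding count_time_def verify_time_def
    by (intro polynomial_intros polynomial_comp[OF assms(2)] assms(1))
  then have "poly_time_ntm ?M"
    unfolding poly_time_ntm_def using bound ntm_compile[OF well_formed_count_all e k(2,3)] by blast
  then have "sharp_P (\<lambda>x. card (accepting_paths ?M x))"
    unfolding sharp_P_def by blast
  moreover have "card (accepting_paths ?M (pair (w, r))) = guess_sum (m (r + length w)) (weight w)" for w r
    using c[OF counts_count_all[of r w, simplified]] by (simp add: acc pair_def unary_def)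
  ultimately show ?thesis by (rule that)
qed

text \<open>The numeral of 2^N has N + 1 digits and N is at most the running time of
  \<open>Mm\<close>, so there is time to write it out.\<close>

lemma poly_time_compute_power:
  assumes "polynomial tm"
  shows "poly_time pair binary (\<lambda>(w, r). 2 ^ m (r + length w))"
  unfolding poly_time_def
proof (intro exI conjI allI)
  let ?k = "off_c + clock"
  define e where "e = (SOME e. numbering e compute_power)"
  have e: "numbering e compute_power"
    unfolding e_def using numbering_exists[OF well_formed_compute_power] by (metis someI)
  let ?M = "compile ?k symbols e compute_power"
  have k: "1 \<le> ?k" "2 \<le> ?k" "3 \<le> symbols" using offsets by (simp_all add: symbols_def)
  show "dtm ?M"
    by (rule dtm_compile[OF well_formed_compute_power e k(2,3) deterministic_compute_power])
  show "polynomial (\<lambda>l. 3 * l + 3 * tm l + 22)" by (intro polynomial_intros assms)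
  fix a :: "bool list \<times> nat"
  obtain w r where a: "a = (w, r)" by (cases a)
  let ?l = "r + length w" and ?x = "replicate r True @ False # w"
  obtain as ts q v where as: "is_path ?M (config_of ?k e (start compute_power) (input_tapes ?x)) as"
    "length as \<le> 3 * ?l + 3 * tm ?l + 22"
    "path_end (config_of ?k e (start compute_power) (input_tapes ?x)) as = config_of ?k e q ts"
    "halted ?M (config_of ?k e q ts)" "ts 1 = puts blank_tape (2 # replicate (m ?l) 1)"
    using counts_path[OF well_formed_compute_power e counts_compute_power[of r w]
        proper_input_tapes[OF well_formed_compute_power k(1,3)]] by auto
  have "2 # replicate (m ?l) 1 = map bit_symbol (binary (2 ^ m ?l))"
    by (simp add: binary_power_2 bit_symbol_def)
  then have "ts 1 = (int (length (binary (2 ^ m ?l))), snd (input_tape (binary (2 ^ m ?l))))"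
    using as(5) puts_blank by metis
  then have out: "has_output (config_of ?k e q ts) (binary (2 ^ m ?l))"
    using k(2) by (auto simp: has_output_def config_of_def input_tape_def range_bit_symbol)
  have "3 * ?l + 3 * tm ?l + 22 \<le> 3 * length ?x + 3 * tm (length ?x) + 22"
    by (intro add_mono mult_le_mono2 monoD[OF mono_tm]) simp_all
  then have "length as \<le> 3 * length ?x + 3 * tm (length ?x) + 22" using as(2) by linarith
  then show "prints_within ?M (pair a) (binary (case a of (w, r) \<Rightarrow> 2 ^ m (r + length w)))
      (3 * length (pair a) + 3 * tm (length (pair a)) + 22)"
    using as(1,3,4) out
    by (auto simp: prints_within_def a pair_def unary_def init_config_compile[OF e k(1)])
qed

end

theorem mainTheorem16:
  fixes U :: machine and f p :: "nat \<Rightarrow> nat" and X :: "(nat \<Rightarrow> bool) set"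
  assumes "universal U"
    and "poly_time unary binary f"
    and "p_convergent (\<lambda>n. 2 powr - real (f n))"
    and "polynomial p"
    and "X = {S. infinite {n. ereal_of_enat (Kt U p (seq_prefix S n)) < ereal (real n - real (f n))}}"
  shows "sharp_P_measure_0 X"
proof -
  obtain Mf tf' where Mf: "dtm Mf" "polynomial tf'"
    "\<And>n. prints_within Mf (unary n) (binary (f n)) (tf' n)"
    using assms(2) by (auto simp: poly_time_def)
  have s: "summable (\<lambda>n. 2 powr - real (f n))" using assms(3) by (simp add: p_convergent_def)
  obtain m where "poly_time unary unary m"
    and tail: "\<And>i. (\<Sum>n. 2 powr - real (f (n + m i))) \<le> 2 powr - real i"
    using assms(3) by (auto simp: p_convergent_def)
  then obtain Mm tm' where Mm: "dtm Mm" "polynomial tm'"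
    "\<And>i. prints_within Mm (unary i) (unary (m i)) (tm' i)"
    by (auto simp: poly_time_def)
  \<comment> \<open>Monotone bounds are needed because the guessed lengths vary and the times are
    estimated at the largest one.\<close>
  obtain tf where tf: "polynomial tf" "mono tf" "\<And>n. tf' n \<le> tf n"
    using polynomial_majorant[OF Mf(2)] by blast
  obtain tm where tm: "polynomial tm" "mono tm" "\<And>n. tm' n \<le> tm n"
    using polynomial_majorant[OF Mm(2)] by blast
  \<comment> \<open>This is the fuel for simulating p n steps of \<open>U\<close>, including the
    return of the output head.\<close>
  have "polynomial (\<lambda>n. 2 * p n + 3)" by (intro polynomial_intros assms(4))
  then obtain clock where clock: "\<And>n. 2 * p n + 3 < (n + 2) ^ clock"
    using polynomial_clock by blast
  interpret counting Mm Mf U clock m f tm tf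
  proof
    show "dtm U" using assms(1) by (simp add: universal_def)
    show "prints_within Mm (unary i) (unary (m i)) (tm i)" for i
      by (rule prints_within_mono[OF Mm(3) tm(3)])
    show "prints_within Mf (unary n) (binary (f n)) (tf n)" for n
      by (rule prints_within_mono[OF Mf(3) tf(3)])
  qed (fact Mm(1) Mf(1) tm(2) tf(2))+
  obtain out where out: "\<And>n \<pi> w. accepts n \<pi> w \<longleftrightarrow> (\<exists>x. out n \<pi> = Some x \<and> length x = n \<and> agree x w)"
    using accepts_unique_string by blast
  obtain h where h: "sharp_P h" "\<And>w r. h (pair (w, r)) = guess_sum (m (r + length w)) (weight w)"
    using sharp_P_count_all[OF tm(1) tf(1)] by blast
  let ?d = "mixture out f"
  \<comment> \<open>After division by 2^N the count is exactly the partial sum of the layers up to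
    N, so the tail is the only error.\<close>
  have "\<bar>?d w - real (h (pair (w, r))) / real (2 ^ m (r + length w))\<bar> \<le> 2 powr - real r" for w r
    using mixture_approx[OF s tail[of "r + length w"]]
    by (simp add: h(2) guess_sum_weight[OF out])
  then have "sharp_P_martingale ?d"
    unfolding sharp_P_martingale_def
    using martingale_mixture[OF s] h(1) poly_time_compute_power[OF tm(1)]
    by (intro conjI exI[of _ h] exI[of _ "\<lambda>(w, r). 2 ^ m (r + length w)"]) auto
  moreover have "succeeds_on ?d S" if "S \<in> X" for S
  proof (rule mixture_succeeds[OF s])
    have "{n. ereal_of_enat (Kt U p (seq_prefix S n)) < ereal (real n - real (f n))} \<subseteq>
        {n. \<exists>\<pi>. length \<pi> + f n < n \<and> out n \<pi> = Some (seq_prefix S n)}"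
    proof clarify
      fix n assume "ereal_of_enat (Kt U p (seq_prefix S n)) < ereal (real n - real (f n))"
      then obtain \<pi> where \<pi>: "prints_within U \<pi> (seq_prefix S n) (p n)" "length \<pi> + f n < n"
        using Kt_less[of U p "seq_prefix S n" "f n"] by auto
      have "accepts n \<pi> (seq_prefix S n)"
        using accepts_complete[OF \<pi>(1)] clock[of n] agree_seq_prefix[of n n S] by simp
      then obtain x where "out n \<pi> = Some x" "length x = n" "agree x (seq_prefix S n)"
        using out by blast
      \<comment> \<open>Strings of equal length that agree are equal.\<close>
      then have "out n \<pi> = Some (seq_prefix S n)" by (simp add: agree_def)
      then show "\<exists>\<pi>. length \<pi> + f n < n \<and> out n \<pi> = Some (seq_prefix S n)" using \<pi>(2) by blast
    qed
    moreover have "infinite {n. ereal_of_enat (Kt U p (seq_prefix S n)) < ereal (real n - real (f n))}"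
      using that assms(5) by blast
    ultimately show "infinite {n. \<exists>\<pi>. length \<pi> + f n < n \<and> out n \<pi> = Some (seq_prefix S n)}"
      by (rule infinite_super)
  qed
  ultimately show ?thesis unfolding sharp_P_measure_0_def by blast
qed

end
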